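(* There exists an absolute constant $n_0$ such that for all integers $n \ge n_0$ and $2 \le t \le n-2$ the following holds. If $\mathcal{F}\subset \mathcal{T}_n$ is $t$-intersecting, then $|\mathcal{F}| \le c_{n, t}\, n^{n-2-t}$. Moreover, equality holds if and only if $\mathcal{F}$ is the family of all spanning trees of $K_n$ containing a fixed forest $F$ with $t$ edges whose connected components have almost equal sizes (i.e., $F$ has $n-t$ connected components, counting isolated vertices, and any two component sizes differ by at most $1$).
   Context: $\mathcal{T}_n$ denotes the set of all labelled spanning trees of the complete graph $K_n$ on vertex set $[n]$; each tree is regarded as its set of $n-1$ edges. A family $\mathcal{F}\subset\mathcal{T}_n$ is $t$-intersecting if any two (not necessarily distinct) trees $A,B\in\mathcal{F}$ share at least $t$ edges. $c_{n,t}$ denotes the largest possible product of $n-t$ positive integers whose sum is $n$. *)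

theory Defs
  imports Main
begin

text \<open>
  A graph on the vertex set \<open>{1..n}\<close> is given by its edge set, a set of two-element
  subsets of \<open>{1..n}\<close>. Isolated vertices are therefore present although no edge shows them.
\<close>

definition complete_graph_edges :: "nat \<Rightarrow> nat set set" where
  "complete_graph_edges n = {e. e \<subseteq> {1..n} \<and> card e = 2}"

definition adj_rel :: "nat set set \<Rightarrow> (nat \<times> nat) set" where
  "adj_rel E = {(u, v). {u, v} \<in> E}"

text \<open>
  Cycles have at least three vertices: traversing an edge forth and back is not a cycle.
\<close>

definition graph_cycle :: "nat set set \<Rightarrow> nat list \<Rightarrow> bool" where
  "graph_cycle E vs \<longleftrightarrow> 3 \<le> length vs \<and> distinct vs \<and>
     (\<forall>i < length vs. {vs ! i, vs ! (Suc i mod length vs)} \<in> E)"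

definition forest_on :: "nat \<Rightarrow> nat set set \<Rightarrow> bool" where
  "forest_on n E \<longleftrightarrow> E \<subseteq> complete_graph_edges n \<and> (\<nexists>vs. graph_cycle E vs)"

definition connected_graph_on :: "nat \<Rightarrow> nat set set \<Rightarrow> bool" where
  "connected_graph_on n E \<longleftrightarrow> (\<forall>u \<in> {1..n}. \<forall>v \<in> {1..n}. (u, v) \<in> (adj_rel E)\<^sup>*)"

definition spanning_trees :: "nat \<Rightarrow> nat set set set" where
  "spanning_trees n = {T. forest_on n T \<and> connected_graph_on n T}"

definition graph_components :: "nat \<Rightarrow> nat set set \<Rightarrow> nat set set" where
  "graph_components n E = (\<lambda>v. {u \<in> {1..n}. (v, u) \<in> (adj_rel E)\<^sup>*}) ` {1..n}"

definition t_intersecting :: "nat \<Rightarrow> nat set set set \<Rightarrow> bool" where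
  "t_intersecting t \<F> \<longleftrightarrow> (\<forall>A \<in> \<F>. \<forall>B \<in> \<F>. t \<le> card (A \<inter> B))"

definition max_prod :: "nat \<Rightarrow> nat \<Rightarrow> nat" where
  "max_prod n t = Max {prod_list xs | xs.
     length xs = n - t \<and> (\<forall>x \<in> set xs. 0 < x) \<and> sum_list xs = n}"

text \<open>
  A forest on \<open>{1..n}\<close> with \<open>t\<close> edges always has \<open>n - t\<close> components; the conjunct on their
  number only makes this explicit.
\<close>

definition balanced_forest :: "nat \<Rightarrow> nat \<Rightarrow> nat set set \<Rightarrow> bool" where
  "balanced_forest n t F \<longleftrightarrow> forest_on n F \<and> card F = t \<and>
     card (graph_components n F) = n - t \<and>
     (\<forall>C \<in> graph_components n F. \<forall>D \<in> graph_components n F. card C \<le> card D + 1)"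

end

theory Submission
  imports Defs Complex_Main "HOL-Library.FuncSet"
begin

text \<open>
  The number of spanning trees containing a forest \<open>F\<close> with component sizes \<open>a\<^sub>1, \<dots>, a\<^sub>k\<close> is
  \<open>n\<^bsup>k-2\<^esup> a\<^sub>1 \<cdots> a\<^sub>k\<close>, so prescribing one more edge costs a factor of order \<open>2/n\<close>. For a
  t-intersecting family call a set \<open>S\<close> of edges heavy if some subfamily of trees above \<open>S\<close> is spread,
  that is, each further edge costs a factor of order \<open>1/n\<close>. A two-round colouring argument shows that
  two spread subfamilies contain trees meeting only inside their sets \<open>S\<close>, hence heavy sets of
  similar shape are themselves t-intersecting.

  Start with a family of sets of size at most \<open>t + q\<close> that is maximal t-intersecting and covers nearly
  all trees. It has two members meeting in a set \<open>F\<^sub>0\<close> of size exactly \<open>t\<close>, and a tree that misses \<open>j\<close>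
  elements of \<open>F\<^sub>0\<close> contains \<open>j\<close> elements of each of the two differences. Counting such exchanges shows
  that the covering sets may be chosen of size at most \<open>t + \<eta>q\<close>; iterating, \<open>q\<close> becomes bounded.
  Then either nearly all trees contain one t-set, or nearly all contain a set \<open>(F\<^sub>0 - J) \<union> K \<union> L\<close> with
  fixed \<open>K, L\<close> of size \<open>k \<ge> 1\<close> and varying \<open>J \<subseteq> F\<^sub>0\<close> of size \<open>k\<close>. The latter families are too small.
  In the former case, a tree not containing \<open>F\<^sub>0\<close> would exclude a fraction of order \<open>n\<^bsup>-4\<^esup>\<close> of the
  trees containing \<open>F\<^sub>0\<close>, more than the exponentially small rest of the family can compensate.
\<close>

section \<open>Spread families\<close>

text \<open>One more edge costs a factor of up to \<open>2 / n\<close>, whereas spreadness is only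
  asked for at rate \<open>n / 128\<close>. The gap is deliberate: a set whose degree is too large
  for spreadness pays 1/64 for each further element, and this pays for the number of exchanges.
  Since the spreadness is of the same order as the size of the members, the fragments left by one
  random round already have bounded size, and a second round finishes.

  The delicate comparison is with the \<open>t\<close> sets obtained from \<open>F0\<close> by
  adding two fixed edges and dropping one edge of \<open>F0\<close>. Each carries at most a fraction
  \<open>2 / n\<close> of the bound, and \<open>t * (2 / n)\<close> is close to 1 when
  \<open>t\<close> is just below \<open>n / 2\<close>. Elsewhere cruder estimates leave room.

  The condition that \<open>t\<close> is at least 2 comes from stars. A star meets every spanning
  tree, so for \<open>t = 1\<close> a star avoiding a fixed edge could be added to the family of all
  trees containing that edge.\<close>

definition colorings :: "'a set \<Rightarrow> ('a \<Rightarrow> nat) set" where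
  "colorings E = (E \<rightarrow>\<^sub>E {..<4})"

definition color_class :: "'a set \<Rightarrow> ('a \<Rightarrow> nat) \<Rightarrow> nat \<Rightarrow> 'a set" where
  "color_class E \<chi> c = {x \<in> E. \<chi> x = c}"

definition recolor :: "('a \<Rightarrow> nat) \<Rightarrow> 'a set \<Rightarrow> nat \<Rightarrow> 'a \<Rightarrow> nat" where
  "recolor \<chi> u c = (\<lambda>x. if x \<in> u then c else \<chi> x)"

text \<open>A minimum fragment in the sense of Park and Pham. It need not be a part of a member
  closest to \<open>U i\<close>; minimality over all members covered by \<open>W\<close> and
  \<open>U i\<close> is what later allows it to be located from little information.\<close>

definition fragment :: "'a set \<Rightarrow> 'i set \<Rightarrow> ('i \<Rightarrow> 'a set) \<Rightarrow> 'i \<Rightarrow> 'a set" where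
  "fragment W D U i = (SOME u. \<exists>i'\<in>D. u = U i' - W \<and> U i' \<subseteq> W \<union> U i \<and>
     (\<forall>i''\<in>D. U i'' \<subseteq> W \<union> U i \<longrightarrow> card u \<le> card (U i'' - W)))"

lemma fragmentE:
  assumes "i \<in> D"
  obtains i' where "i' \<in> D" "fragment W D U i = U i' - W" "U i' \<subseteq> W \<union> U i"
    "\<And>i''. i'' \<in> D \<Longrightarrow> U i'' \<subseteq> W \<union> U i \<Longrightarrow> card (fragment W D U i) \<le> card (U i'' - W)"
proof -
  have "\<exists>j. (j \<in> D \<and> U j \<subseteq> W \<union> U i) \<and>
      (\<forall>j'. (j' \<in> D \<and> U j' \<subseteq> W \<union> U i) \<longrightarrow> card (U j - W) \<le> card (U j' - W))"
    by (rule ex_has_least_nat[of _ i]) (use assms in auto)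
  then obtain j where "j \<in> D" "U j \<subseteq> W \<union> U i"
    "\<And>j'. j' \<in> D \<Longrightarrow> U j' \<subseteq> W \<union> U i \<Longrightarrow> card (U j - W) \<le> card (U j' - W)" by blast
  then have "\<exists>u. \<exists>i'\<in>D. u = U i' - W \<and> U i' \<subseteq> W \<union> U i \<and>
     (\<forall>i''\<in>D. U i'' \<subseteq> W \<union> U i \<longrightarrow> card u \<le> card (U i'' - W))" by blast
  from someI_ex[OF this] show ?thesis
    unfolding fragment_def[symmetric] using that by blast
qed

lemma fragment_subset: "i \<in> D \<Longrightarrow> fragment W D U i \<subseteq> U i - W"
  by (erule fragmentE[of i D W U]) blast

text \<open>If a member covered by \<open>W\<close> and the fragment missed a point of the fragment,
  its part outside \<open>W\<close> would be a smaller fragment.\<close>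

lemma fragment_subset_of_covered:
  assumes i: "i \<in> D" and j: "j \<in> D" "U j \<subseteq> W \<union> fragment W D U i" and fin: "finite (U i)"
  shows "fragment W D U i \<subseteq> U j"
proof -
  let ?u = "fragment W D U i"
  have sub: "?u \<subseteq> U i - W" using fragment_subset[OF i] .
  then have "finite ?u" using fin finite_subset by blast
  have "U j \<subseteq> W \<union> U i" using j sub by blast
  then have "card ?u \<le> card (U j - W)" using i j by (metis fragmentE)
  moreover have "U j - W \<subseteq> ?u" using j by blast
  ultimately have "U j - W = ?u" using \<open>finite ?u\<close> by (metis card_seteq)
  then show ?thesis by blast
qed

lemma finite_colorings: "finite E \<Longrightarrow> finite (colorings E)"
  unfolding colorings_def by (simp add: finite_PiE)

lemma recolor_in_colorings: "\<chi> \<in> colorings E \<Longrightarrow> u \<subseteq> E \<Longrightarrow> c < 4 \<Longrightarrow> recolor \<chi> u c \<in> colorings E"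
  unfolding colorings_def recolor_def by (auto simp: PiE_iff extensional_def)

lemma color_class_recolor:
  "u \<subseteq> E \<Longrightarrow> color_class E (recolor \<chi> u c) c = color_class E \<chi> c \<union> u"
  unfolding color_class_def recolor_def by auto

lemma color_class_recolor_other:
  "c \<noteq> d \<Longrightarrow> u \<inter> color_class E \<chi> d = {} \<Longrightarrow> color_class E (recolor \<chi> u c) d = color_class E \<chi> d"
  unfolding color_class_def recolor_def by auto

text \<open>
  A pair of a colouring and an index is encoded by the colouring in which the fragment has been
  recoloured, the fragment, its old colours, and the index. The fragment lies in every set of the
  family that the new colour class covers, hence there are few candidates for it.
\<close>

lemma fragment_count:
  fixes E :: "'a set" and I :: "'i set" and U :: "('a \<Rightarrow> nat) \<Rightarrow> 'i \<Rightarrow> 'a set"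
  assumes fin: "finite E" "finite I" and c: "c < 4"
    and D: "\<And>\<chi>. D \<chi> \<subseteq> I" and U: "\<And>\<chi> i. i \<in> D \<chi> \<Longrightarrow> U \<chi> i \<subseteq> a i"
    and a: "\<And>i. i \<in> I \<Longrightarrow> a i \<subseteq> E"
    and k: "\<And>\<chi> i. i \<in> D \<chi> \<Longrightarrow> card (U \<chi> i) \<le> k"
    and inv: "\<And>\<chi> i u. \<chi> \<in> colorings E \<Longrightarrow> i \<in> D \<chi> \<Longrightarrow> u \<subseteq> U \<chi> i \<Longrightarrow>
       U (recolor \<chi> u c) = U \<chi> \<and> D (recolor \<chi> u c) = D \<chi>"
    and \<rho>: "\<rho> > 0"
    and spread: "\<And>u. u \<subseteq> E \<Longrightarrow> real (card {i \<in> I. u \<subseteq> a i}) \<le> card I / \<rho> ^ card u"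
  shows "real (card {(\<chi>, i). \<chi> \<in> colorings E \<and> i \<in> D \<chi> \<and>
        card (fragment (color_class E \<chi> c) (D \<chi>) (U \<chi>) i) = m})
     \<le> (k choose m) * (4 / \<rho>) ^ m * card (colorings E) * card I"
proof -
  define fr where "fr \<chi> i = fragment (color_class E \<chi> c) (D \<chi>) (U \<chi>) i" for \<chi> i
  define P where "P = {(\<chi>, i). \<chi> \<in> colorings E \<and> i \<in> D \<chi> \<and> card (fr \<chi> i) = m}"
  \<comment> \<open>\<open>cand Z\<close> is read off the colouring \<open>Z\<close> alone: one
    chosen member inside class \<open>c\<close>. For a recoloured colouring it contains the
    fragment, so the fragment is one of few subsets. The empty default keeps the size bound when no
    member is covered.\<close>
  define cand where "cand Z = (if \<exists>i\<in>D Z. U Z i \<subseteq> color_class E Z c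
      then U Z (SOME i. i \<in> D Z \<and> U Z i \<subseteq> color_class E Z c) else {})" for Z
  define \<phi> where "\<phi> = (\<lambda>(\<chi>, i). (recolor \<chi> (fr \<chi> i) c, fr \<chi> i, restrict \<chi> (fr \<chi> i), i))"
  define Q where "Q = (SIGMA Z : colorings E. SIGMA u : {u. u \<subseteq> cand Z \<and> card u = m}.
      (u \<rightarrow>\<^sub>E {..<4::nat}) \<times> {i \<in> I. u \<subseteq> a i})"
  have UE: "U \<chi> i \<subseteq> E" if "i \<in> D \<chi>" for \<chi> i using that U D a by blast
  have cand: "cand Z \<subseteq> E \<and> card (cand Z) \<le> k" for Z
  proof (cases "\<exists>i\<in>D Z. U Z i \<subseteq> color_class E Z c")
    case True
    then have "(SOME i. i \<in> D Z \<and> U Z i \<subseteq> color_class E Z c) \<in> D Z"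
      by (metis (mono_tags, lifting) someI_ex)
    then show ?thesis using True k UE by (simp add: cand_def)
  qed (simp add: cand_def)
  have frU: "fr \<chi> i \<subseteq> U \<chi> i - color_class E \<chi> c" if "i \<in> D \<chi>" for \<chi> i
    unfolding fr_def by (rule fragment_subset[OF that])
  have inj: "inj_on \<phi> P"
  proof (rule inj_onI)
    fix x y assume xy: "x \<in> P" "y \<in> P" "\<phi> x = \<phi> y"
    obtain \<chi> i \<chi>' i' where eq: "x = (\<chi>, i)" "y = (\<chi>', i')" by force
    have e: "recolor \<chi> (fr \<chi> i) c = recolor \<chi>' (fr \<chi>' i') c" "fr \<chi> i = fr \<chi>' i'"
       "restrict \<chi> (fr \<chi> i) = restrict \<chi>' (fr \<chi>' i')" "i = i'"
      using xy(3) by (auto simp: \<phi>_def eq)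
    have "\<chi> z = \<chi>' z" for z
    proof (cases "z \<in> fr \<chi> i")
      case True
      then show ?thesis using e(2) fun_cong[OF e(3), of z] by (metis restrict_apply)
    next
      case False
      then show ?thesis using e fun_cong[OF e(1), of z] by (simp add: recolor_def)
    qed
    then show "x = y" using e eq by auto
  qed
  have img: "\<phi> ` P \<subseteq> Q"
  proof
    fix y assume "y \<in> \<phi> ` P"
    then obtain \<chi> i where y: "y = \<phi> (\<chi>, i)" and \<chi>: "\<chi> \<in> colorings E" and i: "i \<in> D \<chi>"
      and m: "card (fr \<chi> i) = m" by (auto simp: P_def)
    let ?u = "fr \<chi> i"
    let ?Z = "recolor \<chi> ?u c"
    have uU: "?u \<subseteq> U \<chi> i" and uE: "?u \<subseteq> E" using frU[OF i] UE[OF i] by auto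
    have inv': "U ?Z = U \<chi>" "D ?Z = D \<chi>" using inv[OF \<chi> i uU] by auto
    have cls: "color_class E ?Z c = color_class E \<chi> c \<union> ?u"
      by (rule color_class_recolor[OF uE])
    obtain i' where i': "i' \<in> D \<chi>" "?u = U \<chi> i' - color_class E \<chi> c"
      unfolding fr_def using fragmentE[OF i] by metis
    have ex: "\<exists>j. j \<in> D ?Z \<and> U ?Z j \<subseteq> color_class E ?Z c"
      unfolding inv' cls using i' by blast
    define j where "j = (SOME j. j \<in> D ?Z \<and> U ?Z j \<subseteq> color_class E ?Z c)"
    have j: "j \<in> D ?Z" "U ?Z j \<subseteq> color_class E ?Z c"
      using someI_ex[OF ex] by (auto simp: j_def)
    have "cand ?Z = U ?Z j" using ex unfolding cand_def j_def by auto
    then have "cand ?Z = U \<chi> j" by (simp only: inv')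
    moreover have "?u \<subseteq> U \<chi> j"
      using fragment_subset_of_covered[OF i, of j "U \<chi>" "color_class E \<chi> c"]
        j[unfolded inv' cls] finite_subset[OF UE[OF i] fin(1)] by (simp add: fr_def)
    ultimately have "?u \<subseteq> cand ?Z" by simp
    moreover have "?Z \<in> colorings E" using recolor_in_colorings[OF \<chi> uE c] .
    moreover have "restrict \<chi> ?u \<in> ?u \<rightarrow>\<^sub>E {..<4}"
      using \<chi> uE by (auto simp: colorings_def)
    moreover have "i \<in> I" "?u \<subseteq> a i" using i D uU U by blast+
    ultimately show "y \<in> Q" using m by (simp add: y Q_def \<phi>_def)
  qed
  have fc: "finite (colorings E)" using fin finite_colorings by blast
  have fincand: "finite (cand Z)" for Z using cand fin finite_subset by blast
  have finu: "finite {u. u \<subseteq> cand Z \<and> card u = m}" for Z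
    by (rule finite_subset[of _ "Pow (cand Z)"]) (use fincand in auto)
  have fu: "finite u" if "u \<subseteq> cand Z" for u Z using that fincand finite_subset by blast
  have finQi: "finite ((u \<rightarrow>\<^sub>E {..<4::nat}) \<times> {i \<in> I. u \<subseteq> a i})" if "u \<subseteq> cand Z" for u Z
    using fu[OF that] fin by (simp add: finite_PiE)
  have finR: "finite (SIGMA u : {u. u \<subseteq> cand Z \<and> card u = m}.
      (u \<rightarrow>\<^sub>E {..<4::nat}) \<times> {i \<in> I. u \<subseteq> a i})" for Z
    by (rule finite_SigmaI, rule finu, rule finQi[of _ Z], simp)
  have finQ: "finite Q" unfolding Q_def by (rule finite_SigmaI, rule fc, rule finR)
  have "card P = card (\<phi> ` P)" using inj by (simp add: card_image)
  also have "\<dots> \<le> card Q" using img finQ by (rule card_mono[rotated])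
  finally have "real (card P) \<le> real (card Q)" by simp
  also have "real (card Q) = (\<Sum>Z\<in>colorings E. \<Sum>u\<in>{u. u \<subseteq> cand Z \<and> card u = m}.
      4 ^ m * real (card {i \<in> I. u \<subseteq> a i}))"
  proof -
    have "card ((u \<rightarrow>\<^sub>E {..<4::nat}) \<times> {i \<in> I. u \<subseteq> a i}) = 4 ^ m * card {i \<in> I. u \<subseteq> a i}"
      if "u \<subseteq> cand Z" "card u = m" for u Z
      using fu[OF that(1)] that(2) by (simp add: card_cartesian_product card_PiE)
    then have "card (SIGMA u : {u. u \<subseteq> cand Z \<and> card u = m}. (u \<rightarrow>\<^sub>E {..<4::nat}) \<times> {i \<in> I. u \<subseteq> a i})
        = (\<Sum>u\<in>{u. u \<subseteq> cand Z \<and> card u = m}. 4 ^ m * card {i \<in> I. u \<subseteq> a i})" for Z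
      using finu[of Z] finQi[of _ Z] by (subst card_SigmaI) (auto intro!: sum.cong)
    then show ?thesis unfolding Q_def
      using fc finR by (simp add: card_SigmaI)
  qed
  also have "\<dots> \<le> (\<Sum>Z\<in>colorings E. \<Sum>u\<in>{u. u \<subseteq> cand Z \<and> card u = m}. 4 ^ m * (card I / \<rho> ^ m))"
  proof (intro sum_mono mult_left_mono)
    fix Z u assume u: "u \<in> {u. u \<subseteq> cand Z \<and> card u = m}"
    then have "u \<subseteq> E" using cand by blast
    from spread[OF this] show "real (card {i \<in> I. u \<subseteq> a i}) \<le> card I / \<rho> ^ m" using u by simp
  qed simp
  also have "\<dots> = (\<Sum>Z\<in>colorings E. (card (cand Z) choose m) * ((4 / \<rho>) ^ m * card I))"
    using fincand by (simp add: n_subsets power_divide)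
  also have "\<dots> \<le> (\<Sum>Z\<in>colorings E. (k choose m) * ((4 / \<rho>) ^ m * card I))"
  proof (intro sum_mono mult_right_mono)
    fix Z show "real (card (cand Z) choose m) \<le> real (k choose m)"
      using cand[of Z] by (simp add: binomial_right_mono)
  qed (use \<rho> in simp)
  finally show ?thesis by (simp add: P_def fr_def mult_ac)
qed

lemma real_card_le_imp: "real a \<le> x * real b \<Longrightarrow> x < 1 \<Longrightarrow> b > 0 \<Longrightarrow> a < b"
proof -
  assume "real a \<le> x * real b" "x < 1" "b > 0"
  then have "real a < 1 * real b" by (metis mult_strict_right_mono of_nat_0_less_iff order_le_less_trans)
  then show "a < b" by simp
qed

text \<open>
  First round: for most colourings most fragments outside the first colour class have bounded size.
  Second round: the same count, applied to these fragments, shows that the second class usually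
  swallows one of them.
\<close>

lemma spread_family_hits:
  fixes E :: "'a set" and I :: "'i set"
  assumes fin: "finite E" "finite I" and I0: "I \<noteq> {}"
    and c: "c0 < 4" "c1 < 4" "c0 \<noteq> c1"
    and a: "\<And>i. i \<in> I \<Longrightarrow> a i \<subseteq> E" "\<And>i. i \<in> I \<Longrightarrow> card (a i) \<le> n"
    and \<rho>: "\<rho> > 0"
    and spread: "\<And>u. u \<subseteq> E \<Longrightarrow> real (card {i \<in> I. u \<subseteq> a i}) \<le> card I / \<rho> ^ card u"
    and num1: "(\<Sum>m\<in>{mb..n}. real (n choose m) * (4 / \<rho>) ^ m) \<le> 1/16"
    and num2: "(\<Sum>m\<in>{1..mb}. real (mb choose m) * (4 / \<rho>) ^ m) \<le> 1/16"
  shows "real (card {\<chi> \<in> colorings E. \<not> (\<exists>i\<in>I. a i \<subseteq> color_class E \<chi> c0 \<union> color_class E \<chi> c1)})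
     \<le> 1/4 * real (card (colorings E))"
proof -
  let ?C = "colorings E"
  define f where "f \<chi> i = fragment (color_class E \<chi> c0) I a i" for \<chi> i
  define D where "D \<chi> = {i \<in> I. card (f \<chi> i) < mb}" for \<chi>
  define g where "g \<chi> i = fragment (color_class E \<chi> c1) (D \<chi>) (f \<chi>) i" for \<chi> i
  have finC: "finite ?C" using fin finite_colorings by blast
  have fa: "f \<chi> i \<subseteq> a i - color_class E \<chi> c0" if "i \<in> I" for \<chi> i
    unfolding f_def by (rule fragment_subset[OF that])
  have fa': "f \<chi> i \<subseteq> a i" if "i \<in> I" for \<chi> i using fa[OF that] by blast
  have fina: "finite (a i)" if "i \<in> I" for i using a(1)[OF that] fin finite_subset by blast
  have cf: "card (f \<chi> i) \<le> n" if "i \<in> I" for \<chi> i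
    using fa[OF that, of \<chi>] a(2)[OF that] card_mono[OF fina[OF that]]
    by (meson Diff_subset order_trans)
  have r1: "real (card {(\<chi>, i). \<chi> \<in> ?C \<and> i \<in> I \<and> card (f \<chi> i) = m})
     \<le> (n choose m) * (4 / \<rho>) ^ m * card ?C * card I" for m
    unfolding f_def
    by (rule fragment_count[where a = a and D = "\<lambda>_. I" and U = "\<lambda>_. a"]) (use assms in auto)
  have fdep: "f \<chi>' = f \<chi> \<and> D \<chi>' = D \<chi>" if "color_class E \<chi>' c0 = color_class E \<chi> c0" for \<chi> \<chi>'
    using that by (simp add: f_def D_def fun_eq_iff)
  have r2: "real (card {(\<chi>, i). \<chi> \<in> ?C \<and> i \<in> D \<chi> \<and> card (g \<chi> i) = m})
     \<le> (mb choose m) * (4 / \<rho>) ^ m * card ?C * card I" for m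
    unfolding g_def
  proof (rule fragment_count[where a = a])
    fix \<chi> i u assume "\<chi> \<in> ?C" "i \<in> D \<chi>" "u \<subseteq> f \<chi> i"
    \<comment> \<open>First-round fragments avoid class \<open>c0\<close>, so recolouring inside
      them leaves that class, and with it all first-round data, unchanged.\<close>
    then have "u \<inter> color_class E \<chi> c0 = {}" using fa[of i \<chi>] unfolding D_def by blast
    then show "f (recolor \<chi> u c1) = f \<chi> \<and> D (recolor \<chi> u c1) = D \<chi>"
      using color_class_recolor_other[OF c(3)[symmetric]] fdep by metis
  next
    show "f \<chi> i \<subseteq> a i" if "i \<in> D \<chi>" for \<chi> i using that fa' by (simp add: D_def)
  qed (use fin c a(1) \<rho> spread in \<open>simp_all add: D_def\<close>)
  define X where "X = {(\<chi>, i). \<chi> \<in> ?C \<and> i \<in> I \<and> mb \<le> card (f \<chi> i)}"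
  define Y where "Y = {(\<chi>, i). \<chi> \<in> ?C \<and> i \<in> D \<chi> \<and> g \<chi> i \<noteq> {}}"
  have finCI: "finite (?C \<times> I)" using finC fin by simp
  have gf: "g \<chi> i \<subseteq> f \<chi> i" if "i \<in> D \<chi>" for \<chi> i
    using fragment_subset[OF that, of "color_class E \<chi> c1" "f \<chi>"] unfolding g_def by blast
  have cX: "real (card X) \<le> 1/16 * (card ?C * card I)"
  proof -
    have "X \<subseteq> (\<Union>m\<in>{mb..n}. {(\<chi>, i). \<chi> \<in> ?C \<and> i \<in> I \<and> card (f \<chi> i) = m})"
      using cf by (auto simp: X_def)
    then have "card X \<le> card (\<Union>m\<in>{mb..n}. {(\<chi>, i). \<chi> \<in> ?C \<and> i \<in> I \<and> card (f \<chi> i) = m})"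
      by (rule card_mono[rotated]) (rule finite_subset[OF _ finCI], auto)
    also have "\<dots> \<le> (\<Sum>m\<in>{mb..n}. card {(\<chi>, i). \<chi> \<in> ?C \<and> i \<in> I \<and> card (f \<chi> i) = m})"
      by (rule card_UN_le) simp
    finally have "real (card X) \<le> (\<Sum>m\<in>{mb..n}. real (card {(\<chi>, i). \<chi> \<in> ?C \<and> i \<in> I \<and> card (f \<chi> i) = m}))"
      by (simp flip: of_nat_sum)
    also have "\<dots> \<le> (\<Sum>m\<in>{mb..n}. (n choose m) * (4 / \<rho>) ^ m * card ?C * card I)"
      by (rule sum_mono) (rule r1)
    also have "\<dots> = (\<Sum>m\<in>{mb..n}. (n choose m) * (4 / \<rho>) ^ m) * (card ?C * card I)"
      by (simp add: sum_distrib_right mult.assoc)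
    also have "\<dots> \<le> 1/16 * (card ?C * card I)" by (rule mult_right_mono[OF num1]) simp
    finally show ?thesis .
  qed
  have cY: "real (card Y) \<le> 1/16 * (card ?C * card I)"
  proof -
    have gm: "1 \<le> card (g \<chi> i) \<and> card (g \<chi> i) \<le> mb" if "i \<in> D \<chi>" "g \<chi> i \<noteq> {}" for \<chi> i
    proof -
      have "i \<in> I" using that by (simp add: D_def)
      then have ff: "finite (f \<chi> i)" using finite_subset[OF fa' fina] by blast
      then have "card (g \<chi> i) \<le> card (f \<chi> i)" "finite (g \<chi> i)"
        using card_mono[OF ff gf[OF that(1)]] finite_subset[OF gf[OF that(1)] ff] by simp_all
      moreover have "card (f \<chi> i) < mb" using that by (simp add: D_def)
      ultimately show ?thesis using that(2) by (simp add: Suc_le_eq card_gt_0_iff)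
    qed
    have "Y \<subseteq> (\<Union>m\<in>{1..mb}. {(\<chi>, i). \<chi> \<in> ?C \<and> i \<in> D \<chi> \<and> card (g \<chi> i) = m})"
    proof
      fix z assume "z \<in> Y"
      then obtain \<chi> i where "z = (\<chi>, i)" "\<chi> \<in> ?C" "i \<in> D \<chi>" "g \<chi> i \<noteq> {}" unfolding Y_def by blast
      with gm[of i \<chi>] show "z \<in> (\<Union>m\<in>{1..mb}. {(\<chi>, i). \<chi> \<in> ?C \<and> i \<in> D \<chi> \<and> card (g \<chi> i) = m})"
        by simp
    qed
    moreover have "(\<Union>m\<in>{1..mb}. {(\<chi>, i). \<chi> \<in> ?C \<and> i \<in> D \<chi> \<and> card (g \<chi> i) = m}) \<subseteq> ?C \<times> I"
      unfolding D_def by blast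
    ultimately have "card Y \<le> card (\<Union>m\<in>{1..mb}. {(\<chi>, i). \<chi> \<in> ?C \<and> i \<in> D \<chi> \<and> card (g \<chi> i) = m})"
      using card_mono finite_subset[OF _ finCI] by blast
    also have "\<dots> \<le> (\<Sum>m\<in>{1..mb}. card {(\<chi>, i). \<chi> \<in> ?C \<and> i \<in> D \<chi> \<and> card (g \<chi> i) = m})"
      by (rule card_UN_le) simp
    finally have "real (card Y) \<le> (\<Sum>m\<in>{1..mb}. real (card {(\<chi>, i). \<chi> \<in> ?C \<and> i \<in> D \<chi> \<and> card (g \<chi> i) = m}))"
      by (simp flip: of_nat_sum)
    also have "\<dots> \<le> (\<Sum>m\<in>{1..mb}. (mb choose m) * (4 / \<rho>) ^ m * card ?C * card I)"
      by (rule sum_mono) (rule r2)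
    also have "\<dots> = (\<Sum>m\<in>{1..mb}. (mb choose m) * (4 / \<rho>) ^ m) * (card ?C * card I)"
      by (simp add: sum_distrib_right mult.assoc)
    also have "\<dots> \<le> 1/16 * (card ?C * card I)" by (rule mult_right_mono[OF num2]) simp
    finally show ?thesis .
  qed
  \<comment> \<open>A bad colouring spoils all of its pairs: either the first-round fragment is
    large or the second-round fragment is nonempty. Hence at most 1/16 + 1/16 of the colourings are
    bad.\<close>
  define B where "B = {\<chi> \<in> ?C. \<not> (\<exists>i\<in>I. a i \<subseteq> color_class E \<chi> c0 \<union> color_class E \<chi> c1)}"
  have BXY: "B \<times> I \<subseteq> X \<union> Y"
  proof
    fix z assume "z \<in> B \<times> I"
    then obtain \<chi> i where z: "z = (\<chi>, i)" and \<chi>: "\<chi> \<in> B" and i: "i \<in> I" by blast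
    have \<chi>C: "\<chi> \<in> ?C" using \<chi> by (simp add: B_def)
    show "z \<in> X \<union> Y"
    proof (cases "i \<in> D \<chi>")
      case True
      have "g \<chi> i \<noteq> {}"
      proof
        assume e: "g \<chi> i = {}"
        obtain j where j: "j \<in> D \<chi>" "g \<chi> i = f \<chi> j - color_class E \<chi> c1"
          using fragmentE[OF True, where W = "color_class E \<chi> c1" and U = "f \<chi>"] unfolding g_def by metis
        then have "j \<in> I" by (simp add: D_def)
        then obtain l where l: "l \<in> I" "f \<chi> j = a l - color_class E \<chi> c0"
          using fragmentE[where W = "color_class E \<chi> c0" and U = a] unfolding f_def by metis
        then have "a l \<subseteq> color_class E \<chi> c0 \<union> color_class E \<chi> c1" using j e by blast
        then show False using \<chi> l by (auto simp: B_def)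
      qed
      then show ?thesis using z True \<chi>C by (simp add: Y_def)
    next
      case False
      then show ?thesis using z i \<chi>C by (simp add: X_def D_def)
    qed
  qed
  have finXY: "finite X" "finite Y"
    by (rule finite_subset[OF _ finCI], auto simp: X_def Y_def D_def)+
  have "card B * card I \<le> card (X \<union> Y)"
    using card_mono[OF _ BXY] finXY by (simp add: card_cartesian_product)
  also have "\<dots> \<le> card X + card Y" by (rule card_Un_le)
  finally have "real (card B * card I) \<le> real (card X + card Y)" by (simp only: of_nat_le_iff)
  then have "real (card B) * card I \<le> real (card X) + real (card Y)" by simp
  also have "\<dots> \<le> (1/8 * card ?C) * card I" using cX cY by simp
  finally have "real (card B) \<le> 1/8 * card ?C"
    using I0 fin by (simp add: card_gt_0_iff mult_le_cancel_right)
  then show ?thesis unfolding B_def[symmetric] using of_nat_0_le_iff[of "card ?C"] by linarith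
qed

text \<open>Four colours give each family its own two rounds: classes 0 and 1 for the first, 2 and 3
  for the second. At most half of the colourings fail for one of them, and a colouring good for both
  puts a member of each family into disjoint unions of classes.\<close>

lemma spread_families_disjoint:
  fixes E :: "'a set" and I :: "'i set" and J :: "'j set"
  assumes fin: "finite E" "finite I" "finite J" and ne: "I \<noteq> {}" "J \<noteq> {}"
    and a: "\<And>i. i \<in> I \<Longrightarrow> a i \<subseteq> E" "\<And>i. i \<in> I \<Longrightarrow> card (a i) \<le> n"
    and b: "\<And>i. i \<in> J \<Longrightarrow> b i \<subseteq> E" "\<And>i. i \<in> J \<Longrightarrow> card (b i) \<le> n"
    and \<rho>: "\<rho> > 0"
    and spreada: "\<And>u. u \<subseteq> E \<Longrightarrow> real (card {i \<in> I. u \<subseteq> a i}) \<le> card I / \<rho> ^ card u"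
    and spreadb: "\<And>u. u \<subseteq> E \<Longrightarrow> real (card {i \<in> J. u \<subseteq> b i}) \<le> card J / \<rho> ^ card u"
    and num1: "(\<Sum>m\<in>{mb..n}. real (n choose m) * (4 / \<rho>) ^ m) \<le> 1/16"
    and num2: "(\<Sum>m\<in>{1..mb}. real (mb choose m) * (4 / \<rho>) ^ m) \<le> 1/16"
  shows "\<exists>i\<in>I. \<exists>j\<in>J. a i \<inter> b j = {}"
proof -
  let ?C = "colorings E"
  define X where "X = {\<chi> \<in> ?C. \<not> (\<exists>i\<in>I. a i \<subseteq> color_class E \<chi> 0 \<union> color_class E \<chi> 1)}"
  define Y where "Y = {\<chi> \<in> ?C. \<not> (\<exists>i\<in>J. b i \<subseteq> color_class E \<chi> 2 \<union> color_class E \<chi> 3)}"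
  have "real (card X) \<le> 1/4 * real (card ?C)" unfolding X_def
    by (rule spread_family_hits[OF fin(1,2) ne(1) _ _ _ a \<rho> spreada num1 num2]) simp_all
  moreover have "real (card Y) \<le> 1/4 * real (card ?C)" unfolding Y_def
    by (rule spread_family_hits[OF fin(1,3) ne(2) _ _ _ b \<rho> spreadb num1 num2]) simp_all
  ultimately have "real (card X + card Y) \<le> 1/2 * real (card ?C)" by simp
  moreover have "card (X \<union> Y) \<le> card X + card Y" by (rule card_Un_le)
  ultimately have le: "real (card (X \<union> Y)) \<le> 1/2 * real (card ?C)" by linarith
  have "?C \<noteq> {}" using fin by (auto simp: colorings_def PiE_eq_empty_iff lessThan_empty_iff)
  then have "card ?C > 0" using finite_colorings[OF fin(1)] by (simp add: card_gt_0_iff)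
  then have "card (X \<union> Y) < card ?C" by (intro real_card_le_imp[OF le]) simp_all
  then have "X \<union> Y \<noteq> ?C" by auto
  then obtain \<chi> where "\<chi> \<in> ?C" "\<chi> \<notin> X" "\<chi> \<notin> Y" by (auto simp: X_def Y_def)
  then obtain i j where ij: "i \<in> I" "j \<in> J" "a i \<subseteq> color_class E \<chi> 0 \<union> color_class E \<chi> 1"
    "b j \<subseteq> color_class E \<chi> 2 \<union> color_class E \<chi> 3" by (auto simp: X_def Y_def)
  have "(color_class E \<chi> 0 \<union> color_class E \<chi> 1) \<inter> (color_class E \<chi> 2 \<union> color_class E \<chi> 3) = {}"
    by (auto simp: color_class_def)
  then show ?thesis using ij by blast
qed

lemma binomial_le_pow_div_fact: "real (n choose m) \<le> real n ^ m / fact m"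
proof -
  have "real (n choose m) * fact m \<le> real n ^ m"
    using binomial_fact_pow[of n m] by (metis of_nat_fact of_nat_le_iff of_nat_mult of_nat_power)
  then show ?thesis by (simp add: field_simps)
qed

text \<open>At spreadness \<open>n / 256\<close> the ratio in both sums is \<open>1024 / n\<close>.
  The first sum is then dominated by a tail of the exponential series at 1024, so an absolute
  \<open>mb\<close> suffices; the second has boundedly many terms, each of order
  \<open>1 / n\<close>.\<close>

lemma spread_numerics:
  "\<exists>mb n1. \<forall>n\<ge>n1. (\<Sum>m\<in>{mb..n}. real (n choose m) * (4 / (real n / 256)) ^ m) \<le> 1/16 \<and>
     (\<Sum>m\<in>{1..mb}. real (mb choose m) * (4 / (real n / 256)) ^ m) \<le> 1/16"
proof -
  have "summable (\<lambda>m. (1024::real) ^ m / fact m)"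
    using summable_exp[of "1024::real"] by (simp add: field_simps)
  then obtain mb where mb: "\<And>n. n \<ge> mb \<Longrightarrow> norm (\<Sum>m=mb..<n. (1024::real) ^ m / fact m) < 1/16"
    using summable_Cauchy[of "\<lambda>m. (1024::real) ^ m / fact m"] by (metis divide_pos_pos le_refl zero_less_numeral zero_less_one)
  define n1 where "n1 = 1024 * 16 * (mb + 1) * 2 ^ mb"
  have "(\<Sum>m\<in>{mb..n}. real (n choose m) * (4 / (real n / 256)) ^ m) \<le> 1/16 \<and>
     (\<Sum>m\<in>{1..mb}. real (mb choose m) * (4 / (real n / 256)) ^ m) \<le> 1/16" if n: "n \<ge> n1" for n
  proof
    have "n1 \<ge> 1024 * 16 * 1 * 1" unfolding n1_def by (intro mult_le_mono) auto
    then have npos: "real n \<ge> 1024" using n by simp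
    have "(\<Sum>m\<in>{mb..n}. real (n choose m) * (4 / (real n / 256)) ^ m) \<le> (\<Sum>m\<in>{mb..n}. 1024 ^ m / fact m)"
    proof (rule sum_mono)
      fix m
      have "real (n choose m) * (4 / (real n / 256)) ^ m \<le> real n ^ m / fact m * (1024 / real n) ^ m"
        using binomial_le_pow_div_fact[of n m] by (intro mult_mono) auto
      also have "\<dots> = 1024 ^ m / fact m" using npos by (simp add: power_divide)
      finally show "real (n choose m) * (4 / (real n / 256)) ^ m \<le> 1024 ^ m / fact m" .
    qed
    also have "\<dots> \<le> 1/16"
    proof (cases "mb \<le> n")
      case True
      then show ?thesis using mb[of "Suc n"] by (simp add: atLeastLessThanSuc_atLeastAtMost)
    qed simp
    finally show "(\<Sum>m\<in>{mb..n}. real (n choose m) * (4 / (real n / 256)) ^ m) \<le> 1/16" .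
    have "(\<Sum>m\<in>{1..mb}. real (mb choose m) * (4 / (real n / 256)) ^ m) \<le> (\<Sum>m\<in>{1..mb}. 2 ^ mb * (1024 / n))"
    proof (intro sum_mono mult_mono)
      fix m assume m: "m \<in> {1..mb}"
      show "real (mb choose m) \<le> 2 ^ mb" using binomial_le_pow2[of mb m] by (metis of_nat_le_iff of_nat_numeral of_nat_power)
      have "(1024 / real n) ^ m \<le> (1024 / real n) ^ 1" using npos m by (intro power_decreasing) auto
      then show "(4 / (real n / 256)) ^ m \<le> 1024 / n" by simp
    qed auto
    also have "\<dots> = mb * 2 ^ mb * 1024 / n" by simp
    also have "\<dots> \<le> 1/16"
    proof -
      have "real mb * 2 ^ mb * 1024 * 16 \<le> real n1" unfolding n1_def by simp
      also have "\<dots> \<le> n" using n by simp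
      finally show ?thesis using npos by (simp add: field_simps)
    qed
    finally show "(\<Sum>m\<in>{1..mb}. real (mb choose m) * (4 / (real n / 256)) ^ m) \<le> 1/16" .
  qed
  then show ?thesis by blast
qed

section \<open>Families spread over a common core\<close>

definition spread_over :: "'a set \<Rightarrow> real \<Rightarrow> 'a set set \<Rightarrow> 'a set \<Rightarrow> bool" where
  "spread_over E r G S \<longleftrightarrow> G \<noteq> {} \<and> (\<forall>T\<in>G. S \<subseteq> T \<and> T \<subseteq> E) \<and>
     (\<forall>X\<subseteq>E - S. real (card {T \<in> G. S \<union> X \<subseteq> T}) \<le> card G / r ^ card X)"

lemma spread_overD:
  assumes "spread_over E r G S"
  shows "G \<noteq> {}" "\<And>T. T \<in> G \<Longrightarrow> S \<subseteq> T" "\<And>T. T \<in> G \<Longrightarrow> T \<subseteq> E" "G \<subseteq> Pow E" "S \<subseteq> E"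
    "\<And>X. X \<subseteq> E - S \<Longrightarrow> real (card {T \<in> G. S \<union> X \<subseteq> T}) \<le> card G / r ^ card X"
  using assms unfolding spread_over_def by blast+

text \<open>Union bound: each element of \<open>Y\<close> lies in at most a fraction
  \<open>1 / r\<close> of the members, so at most half of them meet \<open>Y\<close>.\<close>

lemma spread_over_avoid:
  assumes fin: "finite E" and sp: "spread_over E r G S" and r: "r > 0"
    and Y: "Y \<subseteq> E - S" "real (card Y) \<le> r / 2"
  shows "real (card G) \<le> 2 * real (card {T \<in> G. T \<inter> Y = {}})"
proof -
  have finG: "finite G" using spread_overD(4)[OF sp] fin by (simp add: finite_subset)
  have finY: "finite Y" using Y fin finite_subset by blast
  have "G \<subseteq> {T \<in> G. T \<inter> Y = {}} \<union> (\<Union>y\<in>Y. {T \<in> G. S \<union> {y} \<subseteq> T})"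
    using spread_overD(2)[OF sp] by blast
  then have "card G \<le> card ({T \<in> G. T \<inter> Y = {}} \<union> (\<Union>y\<in>Y. {T \<in> G. S \<union> {y} \<subseteq> T}))"
    by (rule card_mono[rotated]) (use finG finY in auto)
  also have "\<dots> \<le> card {T \<in> G. T \<inter> Y = {}} + card (\<Union>y\<in>Y. {T \<in> G. S \<union> {y} \<subseteq> T})"
    by (rule card_Un_le)
  also have "\<dots> \<le> card {T \<in> G. T \<inter> Y = {}} + (\<Sum>y\<in>Y. card {T \<in> G. S \<union> {y} \<subseteq> T})"
    using card_UN_le[OF finY] by simp
  finally have "real (card G) \<le> real (card {T \<in> G. T \<inter> Y = {}}) + (\<Sum>y\<in>Y. real (card {T \<in> G. S \<union> {y} \<subseteq> T}))"
    by (simp flip: of_nat_sum of_nat_add)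
  also have "(\<Sum>y\<in>Y. real (card {T \<in> G. S \<union> {y} \<subseteq> T})) \<le> (\<Sum>y\<in>Y. card G / r)"
  proof (rule sum_mono)
    fix y assume "y \<in> Y"
    then have "{y} \<subseteq> E - S" using Y by blast
    then have "real (card {T \<in> G. S \<union> {y} \<subseteq> T}) \<le> card G / r ^ card {y}"
      by (rule spread_overD(6)[OF sp])
    then show "real (card {T \<in> G. S \<union> {y} \<subseteq> T}) \<le> card G / r" by simp
  qed
  also have "(\<Sum>y\<in>Y. card G / r) = card Y / r * card G" by simp
  also have "\<dots> \<le> 1/2 * card G"
    by (rule mult_right_mono) (use Y r in \<open>auto simp: field_simps\<close>)
  finally show ?thesis by simp
qed

text \<open>Before the links are made disjoint, each family is restricted to the members that avoid
  the other core outside their own. This halves the family at worst, which the spreadness absorbs by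
  dropping from \<open>n / 128\<close> to \<open>n / 256\<close>. A common element of the two final
  members must then lie in both cores.\<close>

lemma spread_over_links_meet:
  "\<exists>n1. \<forall>n\<ge>n1. \<forall>(E::'a set) G1 G2 S1 S2. finite E \<longrightarrow>
     (\<forall>T\<in>G1 \<union> G2. card T \<le> n) \<longrightarrow>
     spread_over E (real n / 128) G1 S1 \<longrightarrow> spread_over E (real n / 128) G2 S2 \<longrightarrow>
     real (card (S1 - S2)) \<le> real n / 256 \<longrightarrow> real (card (S2 - S1)) \<le> real n / 256 \<longrightarrow>
     (\<exists>T1\<in>G1. \<exists>T2\<in>G2. T1 \<inter> T2 \<subseteq> S1 \<inter> S2)"
proof -
  obtain mb n1 where num: "\<And>n. n \<ge> n1 \<Longrightarrow> (\<Sum>m\<in>{mb..n}. real (n choose m) * (4 / (real n / 256)) ^ m) \<le> 1/16"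
     "\<And>n. n \<ge> n1 \<Longrightarrow> (\<Sum>m\<in>{1..mb}. real (mb choose m) * (4 / (real n / 256)) ^ m) \<le> 1/16"
    using spread_numerics by blast
  have main: "\<exists>T1\<in>G1. \<exists>T2\<in>G2. T1 \<inter> T2 \<subseteq> S1 \<inter> S2"
    if n: "n \<ge> max n1 1" and fin: "finite E" and c: "\<forall>T\<in>G1 \<union> G2. card T \<le> n"
      and sp1: "spread_over E (real n / 128) G1 S1" and sp2: "spread_over E (real n / 128) G2 S2"
      and d1: "real (card (S1 - S2)) \<le> real n / 256" and d2: "real (card (S2 - S1)) \<le> real n / 256"
    for n and E :: "'a set" and G1 G2 S1 S2
  proof -
    define avoid where "avoid G Y = {T \<in> G. T \<inter> Y = {}}" for G and Y :: "'a set"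
    have key: "finite (avoid G (S' - S)) \<and> avoid G (S' - S) \<noteq> {} \<and>
       (\<forall>u\<subseteq>E. real (card {T \<in> avoid G (S' - S). u \<subseteq> T - S}) \<le> card (avoid G (S' - S)) / (real n / 256) ^ card u)"
      if sp: "spread_over E (real n / 128) G S" and d: "real (card (S' - S)) \<le> real n / 256"
        and S': "S' \<subseteq> E" for G S S'
    proof -
      have finG: "finite G" using spread_overD(4)[OF sp] fin by (simp add: finite_subset)
      have G0: "G \<noteq> {}" using spread_overD(1)[OF sp] .
      have half: "real (card G) \<le> 2 * real (card (avoid G (S' - S)))"
        unfolding avoid_def by (rule spread_over_avoid[OF fin sp]) (use n d S' in auto)
      have ne: "avoid G (S' - S) \<noteq> {}" using half G0 finG by (auto simp: card_gt_0_iff)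
      have "real (card {T \<in> avoid G (S' - S). u \<subseteq> T - S}) \<le> card (avoid G (S' - S)) / (real n / 256) ^ card u"
        if u: "u \<subseteq> E" for u
      proof (cases "u = {} \<or> u \<inter> S \<noteq> {}")
        case True
        then show ?thesis
        proof
          assume "u \<inter> S \<noteq> {}"
          then have "{T \<in> avoid G (S' - S). u \<subseteq> T - S} = {}" by blast
          then show ?thesis by (simp only: card.empty) simp
        qed simp
      next
        case False
        have finu: "finite u" using u fin finite_subset by blast
        then have cu: "card u \<ge> 1" using False by (simp add: Suc_le_eq card_gt_0_iff)
        have "card {T \<in> avoid G (S' - S). u \<subseteq> T - S} \<le> card {T \<in> G. S \<union> u \<subseteq> T}"
          by (rule card_mono) (use finG spread_overD(2)[OF sp] in \<open>auto simp: avoid_def\<close>)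
        then have "real (card {T \<in> avoid G (S' - S). u \<subseteq> T - S}) \<le> card {T \<in> G. S \<union> u \<subseteq> T}" by simp
        also have "\<dots> \<le> card G / (real n / 128) ^ card u"
          by (rule spread_overD(6)[OF sp]) (use u False in blast)
        also have "\<dots> \<le> 2 * real (card (avoid G (S' - S))) / (real n / 128) ^ card u"
          using half by (intro divide_right_mono) auto
        \<comment> \<open>The factor 2 is charged to the elements of \<open>u\<close>, of which
          there is at least one.\<close>
        also have "\<dots> \<le> 2 ^ card u * real (card (avoid G (S' - S))) / (real n / 128) ^ card u"
        proof (intro divide_right_mono mult_right_mono)
          show "(2::real) \<le> 2 ^ card u" using power_increasing[OF cu, of "2::real"] by simp
        qed auto
        also have "\<dots> = card (avoid G (S' - S)) / (real n / 256) ^ card u"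
          by (simp add: power_divide field_simps flip: power_mult_distrib)
        finally show ?thesis .
      qed
      then show ?thesis using finG ne by (auto simp: avoid_def)
    qed
    have SE: "S1 \<subseteq> E" "S2 \<subseteq> E" using spread_overD(5)[OF sp1] spread_overD(5)[OF sp2] .
    have TE: "T \<subseteq> E" if "T \<in> G1 \<union> G2" for T using that spread_overD(3)[OF sp1] spread_overD(3)[OF sp2] by blast
    have cd: "card (T - S) \<le> n" if "T \<in> G1 \<union> G2" for T S
    proof -
      have "card (T - S) \<le> card T" by (rule card_mono) (use TE[OF that] fin finite_subset in auto)
      then show ?thesis using bspec[OF c that] by simp
    qed
    note k1 = key[OF sp1 d2 SE(2)] and k2 = key[OF sp2 d1 SE(1)]
    have "\<exists>T1\<in>avoid G1 (S2 - S1). \<exists>T2\<in>avoid G2 (S1 - S2). (T1 - S1) \<inter> (T2 - S2) = {}"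
    proof (rule spread_families_disjoint[OF fin _ _ _ _ _ _ _ _ _ _ _ num])
      show "finite (avoid G1 (S2 - S1))" "finite (avoid G2 (S1 - S2))"
        "avoid G1 (S2 - S1) \<noteq> {}" "avoid G2 (S1 - S2) \<noteq> {}" using k1 k2 by blast+
      show "T - S1 \<subseteq> E" "card (T - S1) \<le> n" if "T \<in> avoid G1 (S2 - S1)" for T
        using that TE[of T] cd[of T S1] by (auto simp: avoid_def)
      show "T - S2 \<subseteq> E" "card (T - S2) \<le> n" if "T \<in> avoid G2 (S1 - S2)" for T
        using that TE[of T] cd[of T S2] by (auto simp: avoid_def)
      show "real (card {T \<in> avoid G1 (S2 - S1). u \<subseteq> T - S1}) \<le> card (avoid G1 (S2 - S1)) / (real n / 256) ^ card u"
        if "u \<subseteq> E" for u using k1 that by blast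
      show "real (card {T \<in> avoid G2 (S1 - S2). u \<subseteq> T - S2}) \<le> card (avoid G2 (S1 - S2)) / (real n / 256) ^ card u"
        if "u \<subseteq> E" for u using k2 that by blast
      show "n1 \<le> n" "n1 \<le> n" "real n / 256 > 0" using n by simp_all
    qed
    then obtain T1 T2 where T: "T1 \<in> avoid G1 (S2 - S1)" "T2 \<in> avoid G2 (S1 - S2)"
      "(T1 - S1) \<inter> (T2 - S2) = {}" by blast
    then have "T1 \<inter> T2 \<subseteq> S1 \<inter> S2" by (auto simp: avoid_def)
    then show ?thesis using T by (auto simp: avoid_def)
  qed
  show ?thesis by (intro exI[of _ "max n1 1"] allI impI) (rule main; assumption)
qed

section \<open>Exchanges\<close>

text \<open>The possible ways for a set to deviate from \<open>F\<close>: it misses the elements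
  \<open>J\<close>, and contains equally many elements \<open>K\<close> of \<open>A\<close> and
  \<open>L\<close> of \<open>B\<close> in return.\<close>

definition exchanges :: "'a set \<Rightarrow> 'a set \<Rightarrow> 'a set \<Rightarrow> nat \<Rightarrow> ('a set \<times> 'a set \<times> 'a set) set" where
  "exchanges F A B j = {(J, K, L). J \<subseteq> F \<and> card J = j \<and> K \<subseteq> A \<and> card K = j \<and> L \<subseteq> B \<and> card L = j}"

definition exchange :: "'a set \<Rightarrow> 'a set \<times> 'a set \<times> 'a set \<Rightarrow> 'a set" where
  "exchange F x = (case x of (J, K, L) \<Rightarrow> (F - J) \<union> K \<union> L)"

lemma exchanges_eq_times:
  "exchanges F A B j = {J. J \<subseteq> F \<and> card J = j} \<times> {K. K \<subseteq> A \<and> card K = j} \<times> {L. L \<subseteq> B \<and> card L = j}"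
  by (auto simp: exchanges_def)

lemma card_exchanges:
  assumes "finite F" "finite A" "finite B"
  shows "card (exchanges F A B j) = (card F choose j) * ((card A choose j) * (card B choose j))"
  using assms by (simp add: exchanges_eq_times card_cartesian_product n_subsets)

lemma finite_exchanges:
  assumes "finite F" "finite A" "finite B" shows "finite (exchanges F A B j)"
  by (rule finite_subset[of _ "Pow F \<times> Pow A \<times> Pow B"]) (use assms in \<open>auto simp: exchanges_def\<close>)

lemma card_exchange:
  assumes fin: "finite F" "finite A" "finite B" and dis: "F \<inter> A = {}" "F \<inter> B = {}" "A \<inter> B = {}"
    and x: "x \<in> exchanges F A B j"
  shows "card (exchange F x) = card F + j"
proof -
  obtain J K L where e: "x = (J, K, L)" "J \<subseteq> F" "card J = j" "K \<subseteq> A" "card K = j" "L \<subseteq> B" "card L = j"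
    using x by (auto simp: exchanges_def)
  have f: "finite J" "finite K" "finite L" using e fin finite_subset by blast+
  have jF: "j \<le> card F" using e fin card_mono by blast
  have "card ((F - J) \<union> K \<union> L) = card ((F - J) \<union> K) + card L"
    by (rule card_Un_disjoint) (use e f fin dis in auto)
  also have "card ((F - J) \<union> K) = card (F - J) + card K"
    by (rule card_Un_disjoint) (use e f fin dis in auto)
  also have "card (F - J) = card F - j" using e f by (simp add: card_Diff_subset)
  finally show ?thesis using e jF by (simp add: exchange_def)
qed

text \<open>Reaching \<open>card F\<close> elements inside \<open>F \<union> A\<close> while missing
  \<open>F - T\<close> takes at least \<open>card (F - T)\<close> elements of \<open>A\<close>, and
  likewise for \<open>B\<close>.\<close>

lemma exchange_exists:
  assumes fin: "finite F" "finite A" "finite B" and dis: "F \<inter> A = {}" "F \<inter> B = {}"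
    and T: "card F \<le> card (T \<inter> (F \<union> A))" "card F \<le> card (T \<inter> (F \<union> B))"
  shows "\<exists>x\<in>exchanges F A B (card (F - T)). exchange F x \<subseteq> T \<and> fst x = F - T"
proof -
  have *: "\<exists>K. K \<subseteq> T \<inter> A \<and> card K = card (F - T)"
    if "finite A" "F \<inter> A = {}" "card F \<le> card (T \<inter> (F \<union> A))" for A
  proof -
    have "card (T \<inter> (F \<union> A)) = card (F \<inter> T) + card (T \<inter> A)"
      unfolding Int_Un_distrib using that fin
      by (subst card_Un_disjoint) (auto simp: Int_commute)
    moreover have "card F = card (F - T) + card (F \<inter> T)"
      using fin by (metis add.commute card_Int_Diff)
    ultimately have "card (F - T) \<le> card (T \<inter> A)" using that by linarith
    then show ?thesis by (metis obtain_subset_with_card_n)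
  qed
  obtain K L where "K \<subseteq> T \<inter> A" "card K = card (F - T)" "L \<subseteq> T \<inter> B" "card L = card (F - T)"
    using *[OF fin(2) dis(1) T(1)] *[OF fin(3) dis(2) T(2)] by blast
  then have "(F - T, K, L) \<in> exchanges F A B (card (F - T))" "exchange F (F - T, K, L) \<subseteq> T"
    by (auto simp: exchanges_def exchange_def)
  then show ?thesis by force
qed

section \<open>Numerical estimates\<close>

lemma sum_exp_le: "finite A \<Longrightarrow> (y::real) \<ge> 0 \<Longrightarrow> (\<Sum>j\<in>A. y ^ j / fact j) \<le> exp y"
proof -
  assume A: "finite A" and y: "y \<ge> 0"
  have "(\<Sum>j\<in>A. y ^ j /\<^sub>R fact j) \<le> (\<Sum>j. y ^ j /\<^sub>R fact j)"
    by (rule sum_le_suminf) (use A y summable_exp_generic[of y] in auto)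
  then show ?thesis by (simp add: exp_def field_simps)
qed

lemma sum_cubes_le:
  fixes f :: "'b \<Rightarrow> real"
  assumes "finite A" "\<And>j. j \<in> A \<Longrightarrow> f j \<ge> 0"
  shows "(\<Sum>j\<in>A. f j ^ 3) \<le> (\<Sum>j\<in>A. f j) ^ 3"
proof -
  have "(\<Sum>j\<in>A. f j ^ 3) \<le> (\<Sum>j\<in>A. f j * (\<Sum>j\<in>A. f j) ^ 2)"
  proof (rule sum_mono)
    fix i assume i: "i \<in> A"
    then have "f i \<le> (\<Sum>j\<in>A. f j)" using assms by (intro member_le_sum) auto
    then have "f i ^ 2 \<le> (\<Sum>j\<in>A. f j) ^ 2" using assms i by (intro power_mono) auto
    then have "f i * f i ^ 2 \<le> f i * (\<Sum>j\<in>A. f j) ^ 2" using assms i by (intro mult_left_mono) auto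
    then show "f i ^ 3 \<le> f i * (\<Sum>j\<in>A. f j) ^ 2" by (simp add: power3_eq_cube power2_eq_square)
  qed
  also have "\<dots> = (\<Sum>j\<in>A. f j) ^ 3"
    by (simp add: power3_eq_cube power2_eq_square flip: sum_distrib_right)
  finally show ?thesis .
qed

text \<open>The summand bounds the number of exchanges of level \<open>j\<close> times their loss.
  The threshold on \<open>q\<close> is what \<open>2 * q ^ 2 \<le> y ^ 3\<close> requires for
  \<open>y = q / 102400\<close>, which is about \<open>h / 100\<close>; each summand is then at most
  \<open>(y ^ j / fact j) ^ 3\<close>. Levels above \<open>h\<close> are small because of the
  factorials. The levels up to \<open>h\<close> add up to at most \<open>exp (3 * y)\<close> and are
  paid for by \<open>(1/64) ^ Suc h\<close>.\<close>

lemma exchange_numerics: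
  fixes q :: nat
  defines "h \<equiv> q div 1024"
  assumes q: "q \<ge> 2 * 102400 ^ 3"
  shows "(\<Sum>j\<in>{h<..N}. (2 * real q ^ 2) ^ j / fact j ^ 3) \<le> 1/4 * exp (- 2 * real h)"
    and "(\<Sum>j\<le>h. (2 * real q ^ 2) ^ j / fact j ^ 3) * (1/64) ^ Suc h \<le> 1/4 * exp (- 2 * real h)"
proof -
  define y where "y = real q / 102400"
  have y0: "y \<ge> 0" by (simp add: y_def)
  have "(2 * 102400 ^ 3) * real q ^ 2 \<le> real q * real q ^ 2"
    by (rule mult_right_mono) (use q in \<open>simp_all del: of_nat_power add: of_nat_le_iff[symmetric]\<close>)
  then have y3: "2 * real q ^ 2 \<le> y ^ 3" by (simp add: y_def power_divide power3_eq_cube power2_eq_square)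
  have term_le: "(2 * real q ^ 2) ^ j / fact j ^ 3 \<le> (y ^ j / fact j) ^ 3" for j
  proof -
    have "(2 * real q ^ 2) ^ j \<le> (y ^ 3) ^ j" using y3 by (intro power_mono) auto
    also have "\<dots> = (y ^ j) ^ 3" by (metis power_mult mult.commute)
    finally show ?thesis by (simp add: power_divide divide_right_mono)
  qed
  have "q < 1024 * (h + 1)" unfolding h_def by (metis add.commute plus_1_eq_Suc dividend_less_times_div zero_less_numeral mult_Suc_right)
  then have yh: "y \<le> 0.01 * (real h + 1)" unfolding y_def by simp
  have e3: "exp 1 \<le> (3::real)" by (rule exp_le)
  have e2: "exp (- 2) \<le> (1/4::real)"
  proof -
    have "(2::real) * 2 \<le> exp 1 * exp 1" using exp_ge_add_one_self[of "1::real"] by (intro mult_mono) auto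
    then have "4 \<le> exp (2::real)" by (simp flip: exp_add)
    then show ?thesis by (simp add: exp_minus field_simps)
  qed
  have fin: "exp x \<le> 1/4 * exp (- 2 * real h)" if "x \<le> - 2 * (real h + 1)" for x
  proof -
    have "exp x \<le> exp (- 2 + - 2 * real h)" using that by simp
    also have "\<dots> = exp (- 2) * exp (- 2 * real h)" by (rule exp_add)
    also have "\<dots> \<le> 1/4 * exp (- 2 * real h)" using e2 by (intro mult_right_mono) auto
    finally show ?thesis .
  qed
  show "(\<Sum>j\<in>{h<..N}. (2 * real q ^ 2) ^ j / fact j ^ 3) \<le> 1/4 * exp (- 2 * real h)"
  proof -
    have "(\<Sum>j\<in>{h<..N}. (2 * real q ^ 2) ^ j / fact j ^ 3) \<le> (\<Sum>j\<in>{h<..N}. ((3 * y) ^ j / fact j) ^ 3 * exp (- 3 * (real h + 1)))"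
    proof (rule sum_mono)
      fix j assume j: "j \<in> {h<..N}"
      \<comment> \<open>Trading \<open>y\<close> for \<open>3 * y\<close> extracts exponential decay
        in \<open>j\<close>, since 3 exceeds \<open>exp 1\<close>; the sum that remains is still the
        exponential of a small multiple of \<open>h\<close>.\<close>
      have "y ^ j \<le> (3 * y) ^ j * exp (- real j)"
      proof -
        have "exp (real j) \<le> 3 ^ j" using power_mono[OF e3, of j] by (simp add: exp_of_nat_mult[symmetric])
        then have "1 \<le> 3 ^ j * exp (- real j)" by (simp add: exp_minus field_simps)
        then have "y ^ j * 1 \<le> y ^ j * (3 ^ j * exp (- real j))" using y0 by (intro mult_left_mono) auto
        then show ?thesis by (simp add: power_mult_distrib mult_ac)
      qed
      then have "(y ^ j / fact j) ^ 3 \<le> ((3 * y) ^ j * exp (- real j) / fact j) ^ 3"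
        using y0 by (intro power_mono divide_right_mono) auto
      also have "\<dots> = ((3 * y) ^ j / fact j) ^ 3 * exp (- real j) ^ 3"
        by (simp add: power_mult_distrib power_divide)
      also have "exp (- real j) ^ 3 = exp (- 3 * real j)" by (simp flip: exp_of_nat_mult)
      also have "exp (- 3 * real j) \<le> exp (- 3 * (real h + 1))" using j by simp
      finally have "(y ^ j / fact j) ^ 3 \<le> ((3 * y) ^ j / fact j) ^ 3 * exp (- 3 * (real h + 1))"
        using y0 by (simp add: mult_left_mono)
      then show "(2 * real q ^ 2) ^ j / fact j ^ 3 \<le> ((3 * y) ^ j / fact j) ^ 3 * exp (- 3 * (real h + 1))"
        using term_le[of j] by linarith
    qed
    also have "\<dots> = (\<Sum>j\<in>{h<..N}. ((3 * y) ^ j / fact j) ^ 3) * exp (- 3 * (real h + 1))"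
      by (simp add: sum_distrib_right)
    also have "\<dots> \<le> (\<Sum>j\<in>{h<..N}. (3 * y) ^ j / fact j) ^ 3 * exp (- 3 * (real h + 1))"
      using y0 by (intro mult_right_mono sum_cubes_le) auto
    also have "\<dots> \<le> exp (3 * y) ^ 3 * exp (- 3 * (real h + 1))"
      using y0 by (intro mult_right_mono power_mono sum_exp_le sum_nonneg) auto
    also have "\<dots> = exp (9 * y + - 3 * (real h + 1))" by (simp add: exp_add flip: exp_of_nat_mult)
    also have "\<dots> \<le> 1/4 * exp (- 2 * real h)" by (rule fin) (use yh in simp)
    finally show ?thesis .
  qed
  show "(\<Sum>j\<le>h. (2 * real q ^ 2) ^ j / fact j ^ 3) * (1/64) ^ Suc h \<le> 1/4 * exp (- 2 * real h)"
  proof -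
    have "(\<Sum>j\<le>h. (2 * real q ^ 2) ^ j / fact j ^ 3) \<le> (\<Sum>j\<le>h. (y ^ j / fact j) ^ 3)"
      by (rule sum_mono) (rule term_le)
    also have "\<dots> \<le> (\<Sum>j\<le>h. y ^ j / fact j) ^ 3" using y0 by (intro sum_cubes_le) auto
    also have "\<dots> \<le> exp y ^ 3" using y0 by (intro power_mono sum_exp_le sum_nonneg) auto
    finally have "(\<Sum>j\<le>h. (2 * real q ^ 2) ^ j / fact j ^ 3) \<le> exp (3 * y)" by (simp flip: exp_of_nat_mult)
    moreover have "(1/64) ^ Suc h \<le> exp (- 3 * (real h + 1))"
    proof -
      have "exp (3::real) \<le> 3 ^ 3" using power_mono[OF e3, of 3] by (simp flip: exp_of_nat_mult)
      then have "1/64 \<le> exp (- 3 :: real)" by (simp add: exp_minus field_simps)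
      then have "(1/64) ^ Suc h \<le> exp (- 3 :: real) ^ Suc h" by (intro power_mono) auto
      also have "\<dots> = exp (- 3 * (real h + 1))" by (simp add: algebra_simps flip: exp_of_nat_mult exp_add)
      finally show ?thesis .
    qed
    ultimately have "(\<Sum>j\<le>h. (2 * real q ^ 2) ^ j / fact j ^ 3) * (1/64) ^ Suc h \<le> exp (3 * y) * exp (- 3 * (real h + 1))"
      by (intro mult_mono) auto
    also have "\<dots> = exp (3 * y + - 3 * (real h + 1))" by (rule exp_add[symmetric])
    also have "\<dots> \<le> 1/4 * exp (- 2 * real h)" by (rule fin) (use yh in simp)
    finally show ?thesis .
  qed
qed

section \<open>The structure of t-intersecting families\<close>

definition intersecting :: "nat \<Rightarrow> 'a set set \<Rightarrow> bool" where
  "intersecting t F \<longleftrightarrow> (\<forall>A\<in>F. \<forall>B\<in>F. t \<le> card (A \<inter> B))"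

text \<open>The structural part sees spanning trees only as sets of at most \<open>n\<close> edges,
  with a bound \<open>M s\<close> for the number of trees above an s-set that decreases by
  \<open>2 / n\<close> per element.\<close>

locale edge_family =
  fixes E :: "'a set" and \<T> :: "'a set set" and M :: "nat \<Rightarrow> real" and n :: nat
  assumes finE: "finite E"
    and T_sub: "T \<in> \<T> \<Longrightarrow> T \<subseteq> E"
    and T_card: "T \<in> \<T> \<Longrightarrow> card T \<le> n"
    and n_pos: "n > 0"
    and M_nonneg: "M s \<ge> 0"
    and M_step: "M (Suc s) \<le> 2 / n * M s"
    and M_bound: "S \<subseteq> E \<Longrightarrow> real (card {T \<in> \<T>. S \<subseteq> T}) \<le> M (card S)"
begin

abbreviation above :: "'a set set \<Rightarrow> 'a set \<Rightarrow> 'a set set" where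
  "above G S \<equiv> {T \<in> G. S \<subseteq> T}"

lemma finite_T: "finite \<T>"
  by (rule finite_subset[of _ "Pow E"]) (use finE T_sub in auto)

lemma finite_sub: "S \<subseteq> E \<Longrightarrow> finite S"
  using finE finite_subset by blast

lemma finite_fam: "G \<subseteq> \<T> \<Longrightarrow> finite G"
  using finite_T finite_subset by blast

lemma M_pow: "M (s + i) \<le> (2 / n) ^ i * M s"
proof (induction i)
  case (Suc i)
  have "M (s + Suc i) \<le> 2 / n * M (s + i)" using M_step[of "s + i"] by simp
  also have "\<dots> \<le> 2 / n * ((2 / n) ^ i * M s)" using Suc by (intro mult_left_mono) auto
  finally show ?case by simp
qed simp

lemma card_above: "G \<subseteq> \<T> \<Longrightarrow> S \<subseteq> E \<Longrightarrow> real (card (above G S)) \<le> M (card S)"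
proof -
  assume "G \<subseteq> \<T>" "S \<subseteq> E"
  then have "card (above G S) \<le> card (above \<T> S)" by (intro card_mono) (use finite_T in auto)
  then show ?thesis using M_bound[OF \<open>S \<subseteq> E\<close>] by linarith
qed

text \<open>The rate \<open>n / 128\<close> lies below the rate \<open>n / 2\<close> of
  \<open>M_step\<close> by a factor 64, which becomes the decay per element in
  \<open>card_without_heavy\<close>.\<close>

definition heavy :: "'a set set \<Rightarrow> 'a set \<Rightarrow> bool" where
  "heavy G S \<longleftrightarrow> (\<exists>G'\<subseteq>G. spread_over E (real n / 128) G' S)"

lemma heavy_mono: "heavy G S \<Longrightarrow> G \<subseteq> G' \<Longrightarrow> heavy G' S"
  unfolding heavy_def by blast

lemma heavy_sub: "heavy G S \<Longrightarrow> S \<subseteq> E"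
  unfolding heavy_def using spread_overD(5) by blast

text \<open>
  If no heavy set close to \<open>V\<close> lies below the members of \<open>R\<close>, then a set that is maximal among
  those of large degree in \<open>R\<close> must be far from \<open>V\<close>, so its degree bounds \<open>R\<close>.
\<close>

lemma card_without_heavy:
  assumes R: "R \<subseteq> \<T>" and V: "\<And>T. T \<in> R \<Longrightarrow> V \<subseteq> T" "V \<subseteq> E"
    and no: "\<And>S T. T \<in> R \<Longrightarrow> V \<subseteq> S \<Longrightarrow> S \<subseteq> T \<Longrightarrow> card (S - V) \<le> z \<Longrightarrow> \<not> heavy R S"
  shows "real (card R) \<le> (1/64) ^ Suc z * M (card V)"
proof (cases "R = {}")
  case True
  then show ?thesis using M_nonneg by simp
next
  case False
  define r where "r = real n / 128"
  have r: "r > 0" using n_pos by (simp add: r_def)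
  have finR: "finite R" using finite_fam[OF R] .
  have cR: "card R > 0" using False finR by (simp add: card_gt_0_iff)
  \<comment> \<open>\<open>big S\<close> says that \<open>S\<close> is at least as popular in
    \<open>R\<close> as spreadness over \<open>V\<close> would allow. Over a \<open>big\<close> set
    farthest from \<open>V\<close> the members are spread, because a violation would produce a
    farther \<open>big\<close> set.\<close>
  define big where "big S \<longleftrightarrow> V \<subseteq> S \<and> S \<subseteq> E \<and> real (card R) \<le> card (above R S) * r ^ card (S - V)" for S
  have "above R V = R" using V(1) by blast
  then have bV: "big V" unfolding big_def using V(2) by simp
  have "\<exists>S. big S \<and> (\<forall>S'. big S' \<longrightarrow> card (S' - V) \<le> card (S - V))"
  proof (rule ex_has_greatest_nat[where b = "Suc (card E)" and P = big and k = V])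
    show "\<forall>S. big S \<longrightarrow> card (S - V) < Suc (card E)"
    proof (intro allI impI)
      fix S assume "big S"
      then have "S - V \<subseteq> E" unfolding big_def by blast
      then show "card (S - V) < Suc (card E)" using card_mono[OF finE] by (simp add: less_Suc_eq_le)
    qed
  qed (rule bV)
  then obtain S where S: "big S" and max: "\<And>S'. big S' \<Longrightarrow> card (S' - V) \<le> card (S - V)" by blast
  have SE: "V \<subseteq> S" "S \<subseteq> E" and cS: "real (card R) \<le> card (above R S) * r ^ card (S - V)"
    using S by (auto simp: big_def)
  have ne: "above R S \<noteq> {}"
  proof
    assume "above R S = {}"
    then have "card (above R S) = 0" by (simp only: card.empty)
    then show False using cS cR by simp
  qed
  have "spread_over E r (above R S) S"
    unfolding spread_over_def
  proof (intro conjI ballI allI impI)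
    fix X assume X: "X \<subseteq> E - S"
    have finX: "finite X" using X finE finite_subset by blast
    have eq: "{T \<in> above R S. S \<union> X \<subseteq> T} = above R (S \<union> X)" by blast
    show "real (card {T \<in> above R S. S \<union> X \<subseteq> T}) \<le> card (above R S) / r ^ card X"
    proof (rule ccontr)
      assume "\<not> ?thesis"
      then have gt: "card (above R S) / r ^ card X < card (above R (S \<union> X))" unfolding eq by simp
      then have X0: "X \<noteq> {}" by auto
      have dj: "card ((S \<union> X) - V) = card (S - V) + card X"
      proof -
        have "(S \<union> X) - V = (S - V) \<union> X" using X SE by blast
        then show ?thesis using card_Un_disjoint[of "S - V" X] X finX finite_sub[OF SE(2)] by auto
      qed
      have "card (above R S) < card (above R (S \<union> X)) * r ^ card X" using gt r by (simp add: field_simps)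
      then have "card (above R S) * r ^ card (S - V) \<le> (card (above R (S \<union> X)) * r ^ card X) * r ^ card (S - V)"
        using r by (intro mult_right_mono) auto
      then have "big (S \<union> X)" using cS SE X unfolding big_def dj by (auto simp: power_add mult_ac)
      from max[OF this] have "card X = 0" unfolding dj by simp
      then show False using X0 finX by simp
    qed
  next
    show "above R S \<noteq> {}" by (rule ne)
    show "S \<subseteq> T" "T \<subseteq> E" if "T \<in> above R S" for T using that R T_sub by blast+
  qed
  then have hv: "heavy R S" unfolding heavy_def r_def
    by (intro exI[of _ "above R S"] conjI) (blast, assumption)
  obtain T where T: "T \<in> R" "S \<subseteq> T" using ne by blast
  define d where "d = card (S - V)"
  have d: "Suc z \<le> d" using no[OF T(1) SE(1) T(2)] hv by (force simp: d_def)
  have cSV: "card S = card V + d"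
    using SE finite_sub[OF V(2)] finite_sub[OF SE(2)] by (simp add: d_def card_Diff_subset card_mono)
  have "real (card R) \<le> card (above R S) * r ^ d" using cS by (simp add: d_def)
  also have "\<dots> \<le> M (card V + d) * r ^ d"
    using card_above[OF R SE(2)] r unfolding cSV by (intro mult_right_mono) auto
  also have "\<dots> \<le> ((2 / n) ^ d * M (card V)) * r ^ d"
    using M_pow r by (intro mult_right_mono) auto
  also have "\<dots> = (2 / n * r) ^ d * M (card V)" by (simp only: power_mult_distrib mult_ac)
  also have "2 / n * r = 1/64" using n_pos by (simp add: r_def)
  also have "(1/64::real) ^ d * M (card V) \<le> (1/64) ^ Suc z * M (card V)"
    using d M_nonneg by (intro mult_right_mono power_decreasing) auto
  finally show ?thesis .
qed

text \<open>Choosing \<open>J\<close> contributes up to \<open>n ^ j / fact j\<close>, which cancels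
  the power of \<open>n\<close> in the loss \<open>(2 / n) ^ j\<close>; what remains depends on
  \<open>q\<close> and \<open>j\<close> alone.\<close>

lemma card_exchanges_M:
  assumes "finite F" "finite A" "finite B" "card F \<le> n" "card A \<le> q" "card B \<le> q"
  shows "real (card (exchanges F A B j)) * M (card F + j) \<le> (2 * real q ^ 2) ^ j / fact j ^ 3 * M (card F)"
proof -
  have b: "real (m choose j) \<le> real k ^ j / fact j" if "m \<le> k" for m k
  proof -
    have "real (m choose j) \<le> real m ^ j / fact j" by (rule binomial_le_pow_div_fact)
    also have "\<dots> \<le> real k ^ j / fact j" using that by (intro divide_right_mono power_mono) auto
    finally show ?thesis .
  qed
  have "real (card (exchanges F A B j)) \<le> real n ^ j / fact j * (real q ^ j / fact j * (real q ^ j / fact j))"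
    unfolding card_exchanges[OF assms(1-3)] of_nat_mult
    by (intro mult_mono b assms) auto
  then have "real (card (exchanges F A B j)) * M (card F + j)
     \<le> (real n ^ j / fact j * (real q ^ j / fact j * (real q ^ j / fact j))) * ((2 / n) ^ j * M (card F))"
    using M_nonneg by (intro mult_mono M_pow) auto
  also have "\<dots> = (2 * real q ^ 2) ^ j / fact j ^ 3 * M (card F)"
    using n_pos by (simp add: power_divide power_mult_distrib power3_eq_cube power2_eq_square mult_ac)
  finally show ?thesis .
qed

text \<open>Each member of \<open>R\<close> lies above an exchange whose level \<open>j\<close>
  counts what the member misses of the core \<open>Sa \<inter> Sb\<close>. For
  \<open>j \<le> h\<close>, a superset of the exchange with at most \<open>h\<close> more elements
  has size at most \<open>t + 2 * h\<close> and is not heavy, which gains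
  \<open>(1/64) ^ Suc h\<close>. For larger \<open>j\<close> the degree bound and the factorials
  suffice.\<close>

lemma card_without_close_heavy:
  assumes G: "G \<subseteq> \<T>" and S: "Sa \<subseteq> E" "Sb \<subseteq> E" "card (Sa \<inter> Sb) = t" "card Sa \<le> t + q" "card Sb \<le> t + q"
    and meet: "\<And>T. T \<in> G \<Longrightarrow> t \<le> card (T \<inter> Sa)" "\<And>T. T \<in> G \<Longrightarrow> t \<le> card (T \<inter> Sb)"
    and q: "q \<ge> 2 * 102400 ^ 3" and h: "h = q div 1024" and tn: "t \<le> n"
    and R: "R \<subseteq> G"
    and no: "\<And>S T. T \<in> R \<Longrightarrow> S \<subseteq> T \<Longrightarrow> card S \<le> t + 2 * h \<Longrightarrow> card (Sa \<inter> Sb - S) \<le> h \<Longrightarrow> \<not> heavy R S"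
  shows "real (card R) \<le> 1/2 * exp (- 2 * real h) * M t"
proof -
  let ?F = "Sa \<inter> Sb" and ?A = "Sa - Sb" and ?B = "Sb - Sa"
  have fin: "finite ?F" "finite ?A" "finite ?B" using S finite_sub by auto
  have RT: "R \<subseteq> \<T>" using R G by blast
  have cA: "card ?A \<le> q" "card ?B \<le> q"
  proof -
    have "card Sa = t + card ?A" "card Sb = t + card ?B"
      using S finite_sub card_Int_Diff[of Sa Sb] card_Int_Diff[of Sb Sa] by (auto simp: Int_commute)
    then show "card ?A \<le> q" "card ?B \<le> q" using S by auto
  qed
  define ex where "ex = exchanges ?F ?A ?B"
  define vs where "vs x = exchange ?F x" for x
  have finex: "finite (ex j)" for j unfolding ex_def by (rule finite_exchanges[OF fin])
  have exE: "vs x \<subseteq> E" if "x \<in> ex j" for x j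
    using that S by (auto simp: vs_def exchange_def ex_def exchanges_def)
  have cvs: "card (vs x) = t + j" if "x \<in> ex j" for x j
    unfolding vs_def using card_exchange[OF fin _ _ _ that[unfolded ex_def]] S(3) by auto
  define Rj where "Rj x = {T \<in> R. vs x \<subseteq> T}" for x
  have cover: "R \<subseteq> (\<Union>j\<in>{..n}. \<Union>x\<in>{x \<in> ex j. card (?F - (vs x)) \<le> j}. Rj x)"
  proof
    fix T assume T: "T \<in> R"
    have F: "?F \<union> ?A = Sa" "?F \<union> ?B = Sb" by auto
    have "\<exists>x\<in>exchanges ?F ?A ?B (card (?F - T)). exchange ?F x \<subseteq> T \<and> fst x = ?F - T"
      by (rule exchange_exists[OF fin]) (use meet R T S(3) in \<open>auto simp: F\<close>)
    then obtain x where x: "x \<in> ex (card (?F - T))" "vs x \<subseteq> T" "fst x = ?F - T"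
      unfolding ex_def vs_def by blast
    have "?F - vs x \<subseteq> ?F - T"
      using x(3) by (cases x) (simp add: vs_def exchange_def, blast)
    then have "card (?F - vs x) \<le> card (?F - T)" by (intro card_mono) (use fin in auto)
    moreover have "card (?F - T) \<le> n" using card_mono[OF fin(1) Diff_subset, of T] S(3) tn by linarith
    ultimately show "T \<in> (\<Union>j\<in>{..n}. \<Union>x\<in>{x \<in> ex j. card (?F - (vs x)) \<le> j}. Rj x)"
      using x T by (intro UN_I[of "card (?F - T)"] UN_I[of x]) (simp_all add: Rj_def)
  qed
  define X where "X j = {x \<in> ex j. card (?F - (vs x)) \<le> j}" for j
  have finX: "finite (X j)" and X_ex: "X j \<subseteq> ex j" for j using finex by (auto simp: X_def)
  have finR: "finite R" using finite_fam[OF RT] .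
  have finRj: "finite (Rj x)" for x using finR by (simp add: Rj_def)
  have "card R \<le> card (\<Union>j\<in>{..n}. \<Union>x\<in>X j. Rj x)"
    using cover finX finRj unfolding X_def[symmetric] by (intro card_mono) auto
  also have "\<dots> \<le> (\<Sum>j\<le>n. card (\<Union>x\<in>X j. Rj x))" by (rule card_UN_le) simp
  also have "\<dots> \<le> (\<Sum>j\<le>n. \<Sum>x\<in>X j. card (Rj x))" by (intro sum_mono card_UN_le finX)
  finally have "real (card R) \<le> (\<Sum>j\<le>n. \<Sum>x\<in>X j. real (card (Rj x)))" by (simp flip: of_nat_sum)
  also have "\<dots> \<le> (\<Sum>j\<le>n. (if j \<le> h then (1/64) ^ Suc h else 1) * ((2 * real q ^ 2) ^ j / fact j ^ 3 * M t))"
  proof (rule sum_mono)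
    fix j assume "j \<in> {..n}"
    define w :: real where "w = (if j \<le> h then (1/64) ^ Suc h else 1)"
    have w: "w \<ge> 0" by (simp add: w_def)
    have "real (card (Rj x)) \<le> w * M (t + j)" if x: "x \<in> X j" for x
    proof (cases "j \<le> h")
      case True
      have xe: "x \<in> ex j" and xj: "card (?F - vs x) \<le> j" using x by (auto simp: X_def)
      have "real (card (Rj x)) \<le> (1/64) ^ Suc h * M (card (vs x))"
      proof (rule card_without_heavy)
        show "Rj x \<subseteq> \<T>" "vs x \<subseteq> E" using RT exE[OF xe] by (auto simp: Rj_def)
        show "vs x \<subseteq> T" if "T \<in> Rj x" for T using that by (simp add: Rj_def)
        fix S T assume ST: "T \<in> Rj x" "vs x \<subseteq> S" "S \<subseteq> T" "card (S - vs x) \<le> h"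
        have TR: "T \<in> R" using ST by (simp add: Rj_def)
        have "T \<subseteq> E" using TR RT T_sub by blast
        then have "finite S" using ST(3) finite_sub by simp
        then have "card S = card (vs x) + card (S - vs x)"
          using card_Int_Diff[of S "vs x"] ST(2) by (simp add: Int_absorb1)
        then have "card S \<le> t + 2 * h" using cvs[OF xe] True ST by simp
        moreover have "card (?F - S) \<le> h"
          using card_mono[of "?F - vs x" "?F - S"] ST fin xj True by fastforce
        ultimately have "\<not> heavy R S" using no[OF TR ST(3)] by blast
        then show "\<not> heavy (Rj x) S" using heavy_mono by (metis (no_types, lifting) Rj_def mem_Collect_eq subsetI)
      qed
      then show ?thesis using True cvs[OF xe] by (simp add: w_def)
    next
      case False
      have xe: "x \<in> ex j" using x by (auto simp: X_def)
      show ?thesis using False card_above[OF RT exE[OF xe]] cvs[OF xe] by (simp add: w_def Rj_def)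
    qed
    then have "(\<Sum>x\<in>X j. real (card (Rj x))) \<le> card (X j) * (w * M (t + j))" by (rule sum_bounded_above)
    also have "\<dots> \<le> card (ex j) * (w * M (t + j))"
      using w M_nonneg card_mono[OF finex X_ex] by (intro mult_right_mono) auto
    also have "\<dots> = w * (card (ex j) * M (t + j))" by simp
    also have "\<dots> \<le> w * ((2 * real q ^ 2) ^ j / fact j ^ 3 * M t)"
      using card_exchanges_M[OF fin _ cA, of j] S(3) tn w unfolding ex_def by (intro mult_left_mono) auto
    finally show "(\<Sum>x\<in>X j. real (card (Rj x))) \<le>
       (if j \<le> h then (1/64) ^ Suc h else 1) * ((2 * real q ^ 2) ^ j / fact j ^ 3 * M t)"
      unfolding w_def .
  qed
  also have "\<dots> \<le> (\<Sum>j\<in>{..h} \<union> {h<..n}. (if j \<le> h then (1/64) ^ Suc h else 1) * ((2 * real q ^ 2) ^ j / fact j ^ 3 * M t))"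
    by (rule sum_mono2) (use M_nonneg in auto)
  also have "\<dots> = (\<Sum>j\<le>h. (1/64) ^ Suc h * ((2 * real q ^ 2) ^ j / fact j ^ 3 * M t)) +
      (\<Sum>j\<in>{h<..n}. (2 * real q ^ 2) ^ j / fact j ^ 3 * M t)"
    by (subst sum.union_disjoint) (auto intro!: arg_cong2[of _ _ _ _ "(+)"] sum.cong)
  also have "\<dots> = (\<Sum>j\<le>h. (2 * real q ^ 2) ^ j / fact j ^ 3) * (1/64) ^ Suc h * M t +
      (\<Sum>j\<in>{h<..n}. (2 * real q ^ 2) ^ j / fact j ^ 3) * M t"
    by (simp add: sum_distrib_left sum_distrib_right mult_ac)
  also have "\<dots> \<le> 1/4 * exp (- 2 * real h) * M t + 1/4 * exp (- 2 * real h) * M t"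
    using exchange_numerics[OF q] M_nonneg unfolding h by (intro add_mono mult_right_mono) auto
  finally show ?thesis by (simp add: mult_ac)
qed

end

section \<open>Shrinking the covering sets, and the case of a centre\<close>

context edge_family
begin

text \<open>A family of largest cardinality will do. If all its intersections had more than
  \<open>t\<close> elements, a smallest member could lose an element and still meet every member in
  \<open>t\<close> elements, so the smaller set would belong to the family as well.\<close>

lemma maximal_intersecting:
  assumes SS: "intersecting t SS" "\<And>S. S \<in> SS \<Longrightarrow> S \<subseteq> E \<and> card S \<le> t + q" and tE: "t \<le> card E"
  obtains SS' S1 S2 where "SS \<subseteq> SS'" "intersecting t SS'" "\<And>S. S \<in> SS' \<Longrightarrow> S \<subseteq> E \<and> card S \<le> t + q"
    "\<And>V. V \<subseteq> E \<Longrightarrow> t \<le> card V \<Longrightarrow> card V \<le> t + q \<Longrightarrow> (\<And>S. S \<in> SS' \<Longrightarrow> t \<le> card (V \<inter> S)) \<Longrightarrow> V \<in> SS'"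
    "S1 \<in> SS'" "S2 \<in> SS'" "card (S1 \<inter> S2) = t"
proof -
  define P where "P X \<longleftrightarrow> SS \<subseteq> X \<and> intersecting t X \<and> X \<subseteq> {S. S \<subseteq> E \<and> card S \<le> t + q}" for X
  have fin: "finite {S. S \<subseteq> E \<and> card S \<le> t + q}"
    by (rule finite_subset[of _ "Pow E"]) (use finE in auto)
  have finP: "finite X" if "P X" for X using that fin finite_subset unfolding P_def by blast
  have "\<exists>X. P X \<and> (\<forall>Y. P Y \<longrightarrow> card Y \<le> card X)"
  proof (rule ex_has_greatest_nat[where b = "Suc (card {S. S \<subseteq> E \<and> card S \<le> t + q})" and P = P and k = SS])
    show "P SS" using SS unfolding P_def by blast
    show "\<forall>X. P X \<longrightarrow> card X < Suc (card {S. S \<subseteq> E \<and> card S \<le> t + q})"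
      using card_mono[OF fin] unfolding P_def by (simp add: less_Suc_eq_le)
  qed
  then obtain X where X: "P X" and max: "\<And>Y. P Y \<Longrightarrow> card Y \<le> card X" by blast
  have XE: "S \<subseteq> E \<and> card S \<le> t + q" if "S \<in> X" for S using X that unfolding P_def by blast
  have Xi: "intersecting t X" using X unfolding P_def by blast
  have closed: "V \<in> X" if V: "V \<subseteq> E" "t \<le> card V" "card V \<le> t + q" and m: "\<And>S. S \<in> X \<Longrightarrow> t \<le> card (V \<inter> S)" for V
  proof (rule ccontr)
    assume n: "V \<notin> X"
    have "intersecting t (insert V X)"
      unfolding intersecting_def
    proof (intro ballI)
      fix A B assume "A \<in> insert V X" "B \<in> insert V X"
      then show "t \<le> card (A \<inter> B)"
        using Xi m[of A] m[of B] V(2) unfolding intersecting_def by (auto simp: Int_commute)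
    qed
    then have "P (insert V X)" using X V unfolding P_def by blast
    from max[OF this] show False using n finP[OF X] by simp
  qed
  have "\<exists>S1\<in>X. \<exists>S2\<in>X. card (S1 \<inter> S2) = t"
  proof (rule ccontr)
    assume no: "\<not> ?thesis"
    have gt: "t < card (A \<inter> B)" if "A \<in> X" "B \<in> X" for A B
    proof -
      have "t \<le> card (A \<inter> B)" using Xi that unfolding intersecting_def by blast
      moreover have "card (A \<inter> B) \<noteq> t" using no that by blast
      ultimately show ?thesis by simp
    qed
    obtain V0 where V0: "V0 \<subseteq> E" "card V0 = t" using obtain_subset_with_card_n[OF tE] by blast
    have "X \<noteq> {}"
    proof
      assume "X = {}"
      then have "V0 \<in> X" using closed[of V0] V0 by simp
      then show False using \<open>X = {}\<close> by simp
    qed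
    then obtain S where S: "S \<in> X" and min: "\<And>S'. S' \<in> X \<Longrightarrow> card S \<le> card S'"
      using ex_has_least_nat[of "\<lambda>S. S \<in> X" _ card] by blast
    have finS: "finite S" using XE[OF S] finite_sub by blast
    have cS: "t < card S" using gt[OF S S] by simp
    then obtain e where e: "e \<in> S" by (metis card.empty equals0I not_less_zero)
    have "S - {e} \<in> X"
    proof (rule closed)
      show "S - {e} \<subseteq> E" using XE[OF S] by blast
      show "t \<le> card (S - {e})" "card (S - {e}) \<le> t + q" using cS e finS XE[OF S] by auto
      fix S' assume S': "S' \<in> X"
      have "S \<inter> S' \<subseteq> insert e ((S - {e}) \<inter> S')" by blast
      then have "card (S \<inter> S') \<le> card (insert e ((S - {e}) \<inter> S'))" by (intro card_mono) (use finS in auto)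
      also have "\<dots> \<le> Suc (card ((S - {e}) \<inter> S'))" using finS by (simp add: card_insert_if)
      finally show "t \<le> card ((S - {e}) \<inter> S')" using gt[OF S S'] by simp
    qed
    from min[OF this] show False using e finS cS by simp
  qed
  then obtain S1 S2 where S: "S1 \<in> X" "S2 \<in> X" "card (S1 \<inter> S2) = t" by blast
  have "SS \<subseteq> X" using X unfolding P_def by blast
  from that[OF this Xi XE closed S] show ?thesis .
qed

text \<open>The conclusion of \<open>spread_over_links_meet\<close> for subfamilies of
  \<open>\<T>\<close>, carried as an assumption because the threshold on \<open>n\<close> that
  yields it is fixed only in \<open>intersecting_structure\<close>.\<close>

definition links_meet :: bool where
  "links_meet \<longleftrightarrow> (\<forall>G1 G2 S1 S2. G1 \<subseteq> \<T> \<longrightarrow> G2 \<subseteq> \<T> \<longrightarrow>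
     spread_over E (real n / 128) G1 S1 \<longrightarrow> spread_over E (real n / 128) G2 S2 \<longrightarrow>
     real (card (S1 - S2)) \<le> real n / 256 \<longrightarrow> real (card (S2 - S1)) \<le> real n / 256 \<longrightarrow>
     (\<exists>T1\<in>G1. \<exists>T2\<in>G2. T1 \<inter> T2 \<subseteq> S1 \<inter> S2))"

lemma links_meetD:
  assumes "links_meet" "G1 \<subseteq> \<T>" "G2 \<subseteq> \<T>"
     "spread_over E (real n / 128) G1 S1" "spread_over E (real n / 128) G2 S2"
     "256 * card (S1 - S2) \<le> n" "256 * card (S2 - S1) \<le> n"
  obtains T1 T2 where "T1 \<in> G1" "T2 \<in> G2" "T1 \<inter> T2 \<subseteq> S1 \<inter> S2"
proof -
  have "real (256 * card (S1 - S2)) \<le> real n" "real (256 * card (S2 - S1)) \<le> real n"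
    using assms by (simp_all only: of_nat_le_iff)
  then have "real (card (S1 - S2)) \<le> real n / 256" "real (card (S2 - S1)) \<le> real n / 256" by simp_all
  then show ?thesis using assms that unfolding links_meet_def by meson
qed

lemma heavy_meet:
  assumes "links_meet" "F \<subseteq> \<T>" "intersecting t F" "heavy F S1" "heavy F S2"
     "256 * card (S1 - S2) \<le> n" "256 * card (S2 - S1) \<le> n"
  shows "t \<le> card (S1 \<inter> S2)"
proof -
  obtain G1 G2 where G: "G1 \<subseteq> F" "spread_over E (real n / 128) G1 S1" "G2 \<subseteq> F" "spread_over E (real n / 128) G2 S2"
    using assms(4,5) unfolding heavy_def by blast
  have GT: "G1 \<subseteq> \<T>" "G2 \<subseteq> \<T>" using G assms(2) by blast+
  obtain T1 T2 where T: "T1 \<in> G1" "T2 \<in> G2" "T1 \<inter> T2 \<subseteq> S1 \<inter> S2"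
    by (rule links_meetD[OF assms(1) GT G(2,4) assms(6,7)])
  have "t \<le> card (T1 \<inter> T2)" using assms(3) T G unfolding intersecting_def by blast
  also have "\<dots> \<le> card (S1 \<inter> S2)"
    by (rule card_mono[OF _ T(3)]) (use spread_overD(5)[OF G(2)] finite_sub in blast)
  finally show ?thesis .
qed

text \<open>The tolerated error grows as \<open>q\<close> shrinks: a step to \<open>2 * h\<close>
  adds at most half of \<open>exp (- 2 * h)\<close>, and the old error \<open>exp (- q)\<close> fits
  into the other half.\<close>

definition covered_up_to :: "nat \<Rightarrow> 'a set set \<Rightarrow> nat \<Rightarrow> bool" where
  "covered_up_to t F q \<longleftrightarrow> (\<exists>SS. intersecting t SS \<and> (\<forall>S\<in>SS. S \<subseteq> E \<and> card S \<le> t + q) \<and>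
     real (card {T \<in> F. \<not> (\<exists>S\<in>SS. S \<subseteq> T)}) \<le> exp (- real q) * M t)"

lemma card_diff_le:
  assumes "finite F" "finite S" "finite S'" "card S \<le> card F + 2 * h" "card (F - S) \<le> h" "card (F - S') \<le> h"
  shows "card (S - S') \<le> 4 * h"
proof -
  have "F \<subseteq> (F - S) \<union> (F - S') \<union> (S \<inter> S')" by blast
  then have "card F \<le> card ((F - S) \<union> (F - S') \<union> (S \<inter> S'))" by (intro card_mono) (use assms in auto)
  also have "\<dots> \<le> card ((F - S) \<union> (F - S')) + card (S \<inter> S')" by (rule card_Un_le)
  also have "\<dots> \<le> card (F - S) + card (F - S') + card (S \<inter> S')" using card_Un_le[of "F - S" "F - S'"] by simp
  finally have "card F \<le> 2 * h + card (S \<inter> S')" using assms by simp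
  moreover have "card S = card (S \<inter> S') + card (S - S')" by (rule card_Int_Diff[OF assms(2)])
  ultimately show ?thesis using assms by simp
qed

text \<open>The new covering family consists of the heavy sets of size at most
  \<open>t + 2 * h\<close> that miss at most \<open>h\<close> elements of a core
  \<open>S1 \<inter> S2\<close> of size exactly \<open>t\<close>. Being close to one core, they are
  close to each other, so \<open>heavy_meet\<close> shows that they are t-intersecting.\<close>

lemma covered_step:
  assumes L: "links_meet" and F: "F \<subseteq> \<T>" "intersecting t F" and tE: "t \<le> card E" and tn: "t \<le> n"
    and q: "q \<ge> 2 * 102400 ^ 3" "q \<le> n" and cov: "covered_up_to t F q"
  shows "covered_up_to t F (2 * (q div 1024))"
proof -
  obtain SS where SS: "intersecting t SS" "\<And>S. S \<in> SS \<Longrightarrow> S \<subseteq> E \<and> card S \<le> t + q"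
     "real (card {T \<in> F. \<not> (\<exists>S\<in>SS. S \<subseteq> T)}) \<le> exp (- real q) * M t"
    using cov unfolding covered_up_to_def by blast
  obtain X S1 S2 where X: "SS \<subseteq> X" "intersecting t X" "\<And>S. S \<in> X \<Longrightarrow> S \<subseteq> E \<and> card S \<le> t + q"
    and S12: "S1 \<in> X" "S2 \<in> X" "card (S1 \<inter> S2) = t"
    by (rule maximal_intersecting[OF SS(1,2) tE]) blast+
  define h where "h = q div 1024"
  define H where "H = {S. heavy F S \<and> card S \<le> t + 2 * h \<and> card (S1 \<inter> S2 - S) \<le> h}"
  have finX: "finite S" if "S \<in> X" for S using X(3)[OF that] finite_sub by blast
  have HE: "S \<subseteq> E" if "S \<in> H" for S using that heavy_sub unfolding H_def by blast
  \<comment> \<open>Origin of the divisor 1024: two sets of \<open>H\<close> differ by at most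
    \<open>4 * h\<close> elements on either side, and \<open>heavy_meet\<close> tolerates
    \<open>n / 256\<close>.\<close>
  have hn: "1024 * h \<le> n" unfolding h_def using q by simp
  have Hint: "intersecting t H"
    unfolding intersecting_def
  proof (intro ballI)
    fix A B assume AB: "A \<in> H" "B \<in> H"
    have f: "finite (S1 \<inter> S2)" "finite A" "finite B" using HE AB finite_sub finX S12 by auto
    have "card (A - B) \<le> 4 * h"
      by (rule card_diff_le[OF f]) (use AB S12 in \<open>simp_all add: H_def\<close>)
    moreover have "card (B - A) \<le> 4 * h"
      by (rule card_diff_le[OF f(1,3,2)]) (use AB S12 in \<open>simp_all add: H_def\<close>)
    ultimately show "t \<le> card (A \<inter> B)"
      using AB hn by (intro heavy_meet[OF L F]) (simp_all add: H_def)
  qed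
  define G where "G = {T \<in> F. \<exists>S\<in>X. S \<subseteq> T}"
  define R where "R = {T \<in> G. \<not> (\<exists>S\<in>H. S \<subseteq> T)}"
  define U where "U = {T \<in> F. \<not> (\<exists>S\<in>SS. S \<subseteq> T)}"
  have GF: "G \<subseteq> F" and RF: "R \<subseteq> F" by (auto simp: G_def R_def)
  have meet: "t \<le> card (T \<inter> S')" if T: "T \<in> G" and S': "S' \<in> X" for T S'
  proof -
    obtain S where S: "S \<in> X" "S \<subseteq> T" using T unfolding G_def by blast
    have "t \<le> card (S \<inter> S')" using X(2) S S' unfolding intersecting_def by blast
    also have "\<dots> \<le> card (T \<inter> S')" by (rule card_mono) (use finX[OF S'] S in auto)
    finally show ?thesis .
  qed
  have "real (card R) \<le> 1/2 * exp (- 2 * real h) * M t"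
  proof (rule card_without_close_heavy[where G = G and Sa = S1 and Sb = S2 and q = q])
    show "G \<subseteq> \<T>" using GF F by blast
    show "S1 \<subseteq> E" "S2 \<subseteq> E" "card S1 \<le> t + q" "card S2 \<le> t + q" using X(3) S12 by blast+
    show "t \<le> card (T \<inter> S1)" "t \<le> card (T \<inter> S2)" if "T \<in> G" for T using meet[OF that] S12 by blast+
    show "R \<subseteq> G" by (auto simp: R_def)
    fix S T assume ST: "T \<in> R" "S \<subseteq> T" "card S \<le> t + 2 * h" "card (S1 \<inter> S2 - S) \<le> h"
    show "\<not> heavy R S"
    proof
      assume "heavy R S"
      then have "S \<in> H" using heavy_mono[OF _ RF] ST unfolding H_def by simp
      then show False using ST unfolding R_def by blast
    qed
  qed (use q S12 tn in \<open>simp_all add: h_def\<close>)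
  moreover have "real (card {T \<in> F. \<not> (\<exists>S\<in>H. S \<subseteq> T)}) \<le> real (card U) + real (card R)"
  proof -
    have "{T \<in> F. \<not> (\<exists>S\<in>H. S \<subseteq> T)} \<subseteq> U \<union> R" using X(1) unfolding U_def R_def G_def by blast
    then have "card {T \<in> F. \<not> (\<exists>S\<in>H. S \<subseteq> T)} \<le> card (U \<union> R)"
      by (rule card_mono[rotated]) (use finite_fam[OF F(1)] in \<open>simp add: U_def R_def G_def\<close>)
    also have "\<dots> \<le> card U + card R" by (rule card_Un_le)
    finally show ?thesis by (simp flip: of_nat_add)
  qed
  moreover have "exp (- real q) * M t \<le> 1/2 * exp (- 2 * real h) * M t"
  proof (rule mult_right_mono)
    have "2 * h + 1 \<le> q" using q(1) unfolding h_def by simp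
    then have "real (2 * h + 1) \<le> real q" by (simp only: of_nat_le_iff)
    then have "exp (- real q) \<le> exp (- 1 + - 2 * real h)" by simp
    also have "\<dots> = exp (- 1) * exp (- 2 * real h)" by (rule exp_add)
    also have "exp (- 1) \<le> (1/2::real)"
      using exp_ge_add_one_self[of "1::real"] by (simp add: exp_minus field_simps)
    finally show "exp (- real q) \<le> 1/2 * exp (- 2 * real h)" by simp
  qed (rule M_nonneg)
  ultimately have "real (card {T \<in> F. \<not> (\<exists>S\<in>H. S \<subseteq> T)}) \<le> exp (- 2 * real h) * M t"
    using SS(3) unfolding U_def by linarith
  moreover have "\<forall>S\<in>H. S \<subseteq> E \<and> card S \<le> t + 2 * h" using HE unfolding H_def by blast
  ultimately show ?thesis
    unfolding covered_up_to_def h_def[symmetric] using Hint by (intro exI[of _ H]) simp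
qed

text \<open>The members themselves cover the family with \<open>q = n\<close>. The least admissible
  \<open>q\<close> cannot be large, since a step would replace it by
  \<open>2 * (q div 1024)\<close>, which is smaller and still at least \<open>Q1\<close>.\<close>

lemma covered_bounded:
  assumes L: "links_meet" and F: "F \<subseteq> \<T>" "intersecting t F" and tE: "t \<le> card E" and tn: "t \<le> n"
    and n: "Q1 \<le> n"
  obtains q where "Q1 \<le> q" "q \<le> 2 * 102400 ^ 3 + 1024 * Q1 + 1024" "covered_up_to t F q"
proof -
  have "covered_up_to t F n"
    unfolding covered_up_to_def
  proof (intro exI[of _ F] conjI ballI)
    fix S assume "S \<in> F"
    then show "S \<subseteq> E" "card S \<le> t + n" using F T_sub T_card by (auto simp: trans_le_add2)
  next
    have "{T \<in> F. \<not> (\<exists>S\<in>F. S \<subseteq> T)} = {}" by blast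
    then show "real (card {T \<in> F. \<not> (\<exists>S\<in>F. S \<subseteq> T)}) \<le> exp (- real n) * M t"
      using M_nonneg by (simp only: card.empty) simp
  qed (rule F)
  then have ex: "Q1 \<le> n \<and> covered_up_to t F n" using n by simp
  define q where "q = (LEAST q. Q1 \<le> q \<and> covered_up_to t F q)"
  have q: "Q1 \<le> q" "covered_up_to t F q" using LeastI[of "\<lambda>q. Q1 \<le> q \<and> covered_up_to t F q", OF ex] by (auto simp: q_def)
  have qn: "q \<le> n" unfolding q_def by (rule Least_le) (rule ex)
  have "q \<le> 2 * 102400 ^ 3 + 1024 * Q1 + 1024"
  proof (rule ccontr)
    assume "\<not> ?thesis"
    then have big: "q \<ge> 2 * 102400 ^ 3" "q \<ge> 1024 * Q1" "q > 0" by simp_all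
    have "covered_up_to t F (2 * (q div 1024))"
      by (rule covered_step[OF L F tE tn big(1) qn q(2)])
    moreover have "Q1 \<le> 2 * (q div 1024)" using big(2) by simp
    moreover have "2 * (q div 1024) < q" using big(3) by simp
    ultimately show False using not_less_Least[of "2 * (q div 1024)" "\<lambda>q. Q1 \<le> q \<and> covered_up_to t F q"]
      unfolding q_def[symmetric] by blast
  qed
  then show ?thesis using that q by blast
qed

text \<open>More than half of the maximal degree makes the members above \<open>F0\<close> spread
  over \<open>F0\<close>, so two of them meet exactly in \<open>F0\<close>. With these as
  \<open>Sa\<close> and \<open>Sb\<close>, the core is \<open>F0\<close> and \<open>q\<close> can be
  \<open>n\<close>. A heavy set near \<open>F0\<close> for the members missing \<open>F0\<close>
  would have to contain \<open>F0\<close>: its spread family and the one over \<open>F0\<close> have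
  members whose intersection, of size at least \<open>t\<close>, lies in both cores.\<close>

lemma center_case:
  assumes L: "links_meet" and F: "F \<subseteq> \<T>" "intersecting t F" and tn: "t \<le> n"
    and n: "n \<ge> 2 * 102400 ^ 3" and F0: "F0 \<subseteq> E" "card F0 = t"
    and half: "real (card (above F F0)) > 1/2 * M t"
  shows "real (card {T \<in> F. \<not> F0 \<subseteq> T}) \<le> 1/2 * exp (- 2 * real (n div 1024)) * M t"
proof -
  define G where "G = above F F0"
  have GF: "G \<subseteq> F" and GT: "G \<subseteq> \<T>" using F by (auto simp: G_def)
  have finF0: "finite F0" using F0 finite_sub by blast
  have cG: "M t \<le> 2 * real (card G)" and c0: "card G > 0"
    using half M_nonneg[of t] by (auto simp: G_def intro: gr0I)
  have sp: "spread_over E (real n / 128) G F0"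
    unfolding spread_over_def
  proof (intro conjI ballI allI impI)
    show "G \<noteq> {}" using c0 by auto
    show "F0 \<subseteq> T" "T \<subseteq> E" if "T \<in> G" for T using that GT T_sub by (auto simp: G_def)
    fix X assume X: "X \<subseteq> E - F0"
    show "real (card {T \<in> G. F0 \<union> X \<subseteq> T}) \<le> card G / (real n / 128) ^ card X"
    proof (cases "X = {}")
      case False
      have finX: "finite X" using X finE finite_subset by blast
      then have cX: "card X \<ge> 1" using False by (simp add: Suc_le_eq card_gt_0_iff)
      have cFX: "card (F0 \<union> X) = t + card X" using card_Un_disjoint[OF finF0 finX] X F0 by auto
      have "F0 \<union> X \<subseteq> E" using X F0 by blast
      from card_above[OF GT this] have "real (card {T \<in> G. F0 \<union> X \<subseteq> T}) \<le> M (t + card X)" unfolding cFX .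
      also have "\<dots> \<le> (2 / n) ^ card X * M t" by (rule M_pow)
      also have "\<dots> \<le> (2 / n) ^ card X * (2 * real (card G))" using cG by (intro mult_left_mono) auto
      \<comment> \<open>The factor 2 lost by comparing with half of \<open>M t\<close> is absorbed
        per element; \<open>2 * 64 = 128\<close> is the constant of the spreadness.\<close>
      also have "\<dots> \<le> (2 / n) ^ card X * (64 ^ card X * real (card G))"
      proof (intro mult_left_mono mult_right_mono)
        show "(2::real) \<le> 64 ^ card X" using power_increasing[OF cX, of "64::real"] by simp
      qed auto
      also have "\<dots> = card G / (real n / 128) ^ card X"
        using n by (simp add: power_divide field_simps flip: power_mult_distrib)
      finally show ?thesis .
    qed (auto intro!: card_mono simp: finite_fam[OF GT])
  qed
  have "256 * card (F0 - F0) \<le> n" by simp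
  then obtain A B where AB: "A \<in> G" "B \<in> G" "A \<inter> B \<subseteq> F0 \<inter> F0"
    using links_meetD[OF L GT GT sp sp] by metis
  have ABF: "A \<inter> B = F0" using AB unfolding G_def by blast
  have AF: "A \<in> F" "B \<in> F" using AB GF by auto
  have AE: "A \<subseteq> E" "B \<subseteq> E" "card A \<le> t + n" "card B \<le> t + n"
    using AF F T_sub T_card by (auto simp: trans_le_add2)
  show ?thesis
  proof (rule card_without_close_heavy[where G = F and Sa = A and Sb = B and q = n])
    show "t \<le> card (T \<inter> A)" "t \<le> card (T \<inter> B)" if "T \<in> F" for T
      using F(2) that AF unfolding intersecting_def by blast+
    show "card (A \<inter> B) = t" using ABF F0 by simp
    fix S T assume ST: "T \<in> {T \<in> F. \<not> F0 \<subseteq> T}" "S \<subseteq> T" "card S \<le> t + 2 * (n div 1024)"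
      "card (A \<inter> B - S) \<le> n div 1024"
    show "\<not> heavy {T \<in> F. \<not> F0 \<subseteq> T} S"
    proof
      assume "heavy {T \<in> F. \<not> F0 \<subseteq> T} S"
      then obtain G' where G': "G' \<subseteq> {T \<in> F. \<not> F0 \<subseteq> T}" "spread_over E (real n / 128) G' S"
        unfolding heavy_def by blast
      have G'T: "G' \<subseteq> \<T>" using G' F by blast
      have finS: "finite S" using spread_overD(5)[OF G'(2)] finite_sub by blast
      have d: "card (F0 - S) \<le> n div 1024" using ST(4) ABF by simp
      have "card (S - F0) \<le> 4 * (n div 1024)"
        by (rule card_diff_le[OF finF0 finS finF0]) (use ST d F0 in simp_all)
      then have "256 * card (S - F0) \<le> n" by simp
      moreover have "256 * card (F0 - S) \<le> n" using d by simp
      ultimately obtain T1 T2 where T: "T1 \<in> G'" "T2 \<in> G" "T1 \<inter> T2 \<subseteq> S \<inter> F0"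
        by (rule links_meetD[OF L G'T GT G'(2) sp])
      have "t \<le> card (T1 \<inter> T2)" using F(2) T G' GF unfolding intersecting_def by blast
      also have "\<dots> \<le> card (S \<inter> F0)" by (rule card_mono[OF _ T(3)]) (use finF0 in simp)
      finally have "card F0 \<le> card (S \<inter> F0)" using F0 by simp
      then have "S \<inter> F0 = F0" using card_seteq[OF finF0, of "S \<inter> F0"] by simp
      then have "F0 \<subseteq> T1" using spread_overD(2)[OF G'(2) T(1)] by blast
      then show False using T(1) G'(1) by blast
    qed
  qed (use F n tn AE in auto)
qed

end

section \<open>Popular exchanges, and the case without a centre\<close>

lemma exchangesE:
  assumes "x \<in> exchanges F A B j"
  obtains J K L where "x = (J, K, L)" "J \<subseteq> F" "card J = j" "K \<subseteq> A" "card K = j" "L \<subseteq> B" "card L = j"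
  using assms unfolding exchanges_def by auto

text \<open>A prescribed common element leaves only order \<open>n ^ (k - 1)\<close> choices, one
  power of \<open>n\<close> below the number of sets \<open>J\<close> that a popular pair
  has.\<close>

lemma card_subsets_meeting_le:
  assumes finF: "finite F" and cF: "card F \<le> n" and k: "k > 0" and J': "finite J'"
  shows "card {J. J \<subseteq> F \<and> card J = k \<and> J \<inter> J' \<noteq> {}} \<le> card J' * n ^ (k - 1)"
proof -
  have one: "card {J. J \<subseteq> F \<and> card J = k \<and> v \<in> J} \<le> n ^ (k - 1)" for v
  proof -
    have inj: "inj_on (\<lambda>J. J - {v}) {J. J \<subseteq> F \<and> card J = k \<and> v \<in> J}"
      by (rule inj_onI) blast
    have "(\<lambda>J. J - {v}) ` {J. J \<subseteq> F \<and> card J = k \<and> v \<in> J} \<subseteq> {J. J \<subseteq> F \<and> card J = k - 1}"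
      using finF finite_subset by fastforce
    then have "card {J. J \<subseteq> F \<and> card J = k \<and> v \<in> J} \<le> card {J. J \<subseteq> F \<and> card J = k - 1}"
      by (rule card_inj_on_le[OF inj]) (use finF in simp)
    also have "\<dots> = card F choose (k - 1)" using finF by (rule n_subsets)
    also have "\<dots> \<le> (card F choose (k - 1)) * fact (k - 1)" by simp
    also have "\<dots> \<le> card F ^ (k - 1)" by (rule binomial_fact_pow)
    also have "\<dots> \<le> n ^ (k - 1)" using cF by (rule power_mono) simp
    finally show ?thesis .
  qed
  have "{J. J \<subseteq> F \<and> card J = k \<and> J \<inter> J' \<noteq> {}} \<subseteq> (\<Union>v\<in>J'. {J. J \<subseteq> F \<and> card J = k \<and> v \<in> J})" by blast
  then have "card {J. J \<subseteq> F \<and> card J = k \<and> J \<inter> J' \<noteq> {}} \<le> card (\<Union>v\<in>J'. {J. J \<subseteq> F \<and> card J = k \<and> v \<in> J})"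
    by (rule card_mono[rotated]) (use finF J' in auto)
  also have "\<dots> \<le> (\<Sum>v\<in>J'. card {J. J \<subseteq> F \<and> card J = k \<and> v \<in> J})" by (rule card_UN_le[OF J'])
  also have "\<dots> \<le> (\<Sum>v\<in>J'. n ^ (k - 1))" by (rule sum_mono) (rule one)
  finally show ?thesis by simp
qed

text \<open>
  A popular pair \<open>(K, L)\<close> occurs with so many sets \<open>J\<close> that one of them avoids any given \<open>J'\<close>;
  comparing the two exchanges then determines the level and the pair.
\<close>

lemma popular_exchange:
  fixes q n :: nat
  assumes fin: "finite F" "finite A" "finite B" and dis: "F \<inter> A = {}" "F \<inter> B = {}" "A \<inter> B = {}"
    and c: "card F = t" "t \<le> n" "card A \<le> q" "card B \<le> q" and n0: "n > 0"
    and Y: "\<And>j. Y j \<subseteq> exchanges F A B j"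
    and int: "\<And>j j' x y. x \<in> Y j \<Longrightarrow> y \<in> Y j' \<Longrightarrow> t \<le> card (exchange F x \<inter> exchange F y)"
    and k: "0 < k" "k \<le> q" and big: "real (card (Y k)) > \<gamma> * (n / 2) ^ k" and \<gamma>: "\<gamma> > 0"
    and nq: "real n \<ge> real q * 8 ^ q / \<gamma>"
  shows "\<exists>K L. K \<subseteq> A \<and> L \<subseteq> B \<and> card K = k \<and> card L = k \<and>
    (\<forall>j. \<forall>x\<in>Y j. \<exists>J. J \<subseteq> F \<and> card J = k \<and> x = (J, K, L))"
proof -
  define sl where "sl p = {x \<in> Y k. snd x = p}" for p
  have finY: "finite (Y k)" using Y finite_exchanges[OF fin] finite_subset by blast
  \<comment> \<open>Pigeonhole: there are at most \<open>4 ^ q\<close> pairs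
    \<open>(K, L)\<close>.\<close>
  have "\<exists>p. real (card (sl p)) > \<gamma> * (n / 2) ^ k / 4 ^ q"
  proof (rule ccontr)
    assume "\<not> ?thesis"
    then have le: "real (card (sl p)) \<le> \<gamma> * (n / 2) ^ k / 4 ^ q" for p
      unfolding not_ex not_less by (rule spec)
    have "Y k \<subseteq> (\<Union>p\<in>Pow A \<times> Pow B. sl p)"
    proof
      fix x assume x: "x \<in> Y k"
      then have "x \<in> exchanges F A B k" using Y by blast
      then have "snd x \<in> Pow A \<times> Pow B" by (auto simp: exchanges_def)
      then show "x \<in> (\<Union>p\<in>Pow A \<times> Pow B. sl p)" using x unfolding sl_def by blast
    qed
    then have "card (Y k) \<le> card (\<Union>p\<in>Pow A \<times> Pow B. sl p)"
      by (rule card_mono[rotated]) (use fin finY in \<open>simp add: sl_def\<close>)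
    also have "\<dots> \<le> (\<Sum>p\<in>Pow A \<times> Pow B. card (sl p))" by (rule card_UN_le) (use fin in simp)
    finally have "real (card (Y k)) \<le> (\<Sum>p\<in>Pow A \<times> Pow B. real (card (sl p)))" by (simp flip: of_nat_sum)
    also have "\<dots> \<le> card (Pow A \<times> Pow B) * (\<gamma> * (n / 2) ^ k / 4 ^ q)"
      by (rule sum_bounded_above) (rule le)
    also have "\<dots> \<le> 4 ^ q * (\<gamma> * (n / 2) ^ k / 4 ^ q)"
    proof (rule mult_right_mono)
      have "card (Pow A \<times> Pow B) = 2 ^ card A * 2 ^ card B" using fin by (simp add: card_cartesian_product card_Pow)
      also have "\<dots> \<le> 2 ^ q * 2 ^ q" using c by (intro mult_le_mono power_increasing) auto
      also have "\<dots> = 4 ^ q" by (simp flip: power_mult_distrib)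
      finally show "real (card (Pow A \<times> Pow B)) \<le> 4 ^ q" by (metis of_nat_le_iff of_nat_numeral of_nat_power)
    qed (use \<gamma> in simp)
    finally show False using big by simp
  qed
  then obtain p where p: "real (card (sl p)) > \<gamma> * (n / 2) ^ k / 4 ^ q" by blast
  obtain K L where KL: "p = (K, L)" by force
  have pos: "\<gamma> * (n / 2) ^ k / 4 ^ q \<ge> 0" using \<gamma> by simp
  then have "sl p \<noteq> {}" using p by auto
  then obtain x0 where "x0 \<in> Y k" "snd x0 = (K, L)" unfolding sl_def KL by blast
  then have "x0 \<in> exchanges F A B k" "snd x0 = (K, L)" using Y by blast+
  then have cK: "K \<subseteq> A" "L \<subseteq> B" "card K = k" "card L = k"
    by (auto simp: exchanges_def)
  have finKL: "finite K" "finite L" using cK fin finite_subset by blast+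
  have main: "j = k \<and> J' \<subseteq> F \<and> card J' = k \<and> K' = K \<and> L' = L" if y: "(J', K', L') \<in> Y j" for j J' K' L'
  proof -
    have y': "J' \<subseteq> F" "card J' = j" "K' \<subseteq> A" "card K' = j" "L' \<subseteq> B" "card L' = j"
      using Y y unfolding exchanges_def by blast+
    have fy: "finite J'" "finite K'" "finite L'" using y' fin finite_subset by blast+
    have jq: "j \<le> q" using card_mono[OF fin(2) y'(3)] y' c by simp
    define Js where "Js = {J. (J, K, L) \<in> Y k}"
    have "sl p = (\<lambda>J. (J, K, L)) ` Js" unfolding sl_def Js_def KL by force
    then have cJs: "card (sl p) = card Js" by (simp add: card_image inj_on_def)
    have JsF: "Js \<subseteq> {J. J \<subseteq> F \<and> card J = k}" using Y unfolding Js_def exchanges_def by blast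
    have "\<exists>J\<in>Js. J \<inter> J' = {}"
    proof (rule ccontr)
      assume "\<not> ?thesis"
      then have "Js \<subseteq> {J. J \<subseteq> F \<and> card J = k \<and> J \<inter> J' \<noteq> {}}" using JsF by blast
      then have "card Js \<le> card {J. J \<subseteq> F \<and> card J = k \<and> J \<inter> J' \<noteq> {}}"
        by (rule card_mono[rotated]) (use fin in simp)
      also have "\<dots> \<le> card J' * n ^ (k - 1)"
        by (rule card_subsets_meeting_le[OF fin(1) _ k(1) fy(1)]) (use c in simp)
      also have "\<dots> \<le> q * n ^ (k - 1)" using jq y' by simp
      finally have le: "real (card Js) \<le> real q * real n ^ (k - 1)"
        by (metis of_nat_le_iff of_nat_mult of_nat_power)
      have "real q * real n ^ (k - 1) * (8 ^ q / \<gamma>) \<le> real n ^ k"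
      proof -
        have "(real q * 8 ^ q / \<gamma>) * real n ^ (k - 1) \<le> real n * real n ^ (k - 1)"
          by (rule mult_right_mono[OF nq]) simp
        also have "\<dots> = real n ^ k" using k(1) by (simp flip: power_Suc)
        finally show ?thesis by (simp add: mult_ac)
      qed
      then have "real q * real n ^ (k - 1) \<le> \<gamma> * real n ^ k / 8 ^ q" using \<gamma> by (simp add: field_simps)
      \<comment> \<open>The \<open>8 ^ q\<close> in the lower bound on \<open>n\<close> combines
        \<open>4 ^ q\<close> from the pigeonhole with \<open>2 ^ k\<close> from the scale
        \<open>n / 2\<close>.\<close>
      also have "\<dots> \<le> \<gamma> * (n / 2) ^ k / 4 ^ q"
      proof -
        have "(2::real) ^ k \<le> 2 ^ q" using k by (intro power_increasing) auto
        then have "(2::real) ^ k * 4 ^ q \<le> 2 ^ q * 4 ^ q" by (intro mult_right_mono) auto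
        then have "(2::real) ^ k * 4 ^ q \<le> 8 ^ q" by (simp flip: power_mult_distrib)
        then have "\<gamma> * real n ^ k / 8 ^ q \<le> \<gamma> * real n ^ k / (2 ^ k * 4 ^ q)"
          using \<gamma> by (intro divide_left_mono) auto
        then show ?thesis by (simp add: power_divide field_simps)
      qed
      finally show False using le p cJs by simp
    qed
    then obtain J where J: "(J, K, L) \<in> Y k" "J \<inter> J' = {}" unfolding Js_def by blast
    have J': "J \<subseteq> F" "card J = k" using JsF J unfolding Js_def by blast+
    have fJ: "finite J" using J' fin finite_subset by blast
    have "exchange F (J, K, L) \<inter> exchange F (J', K', L') \<subseteq> (F - (J \<union> J')) \<union> ((K \<inter> K') \<union> (L \<inter> L'))"
      using cK y' dis unfolding exchange_def by auto
    then have "card (exchange F (J, K, L) \<inter> exchange F (J', K', L')) \<le> card ((F - (J \<union> J')) \<union> ((K \<inter> K') \<union> (L \<inter> L')))"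
      by (rule card_mono[rotated]) (use fin finKL in simp)
    also have "\<dots> \<le> card (F - (J \<union> J')) + (card (K \<inter> K') + card (L \<inter> L'))"
      using card_Un_le[of "F - (J \<union> J')" "(K \<inter> K') \<union> (L \<inter> L')"] card_Un_le[of "K \<inter> K'" "L \<inter> L'"] by linarith
    finally have t1: "t \<le> card (F - (J \<union> J')) + (card (K \<inter> K') + card (L \<inter> L'))"
      using int[OF J(1) y] by linarith
    have "card (J \<union> J') = k + j" using J J' y' fJ fy by (simp add: card_Un_disjoint)
    moreover have "card (J \<union> J') \<le> t" using card_mono[OF fin(1), of "J \<union> J'"] J' y' c by simp
    moreover have "card (F - (J \<union> J')) = card F - card (J \<union> J')"
      using fJ fy J' y' by (intro card_Diff_subset) auto
    \<comment> \<open>Disjoint \<open>J\<close> and \<open>J'\<close> remove \<open>k + j\<close>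
      elements of \<open>F\<close>, which only common elements of the replacing sets can make up
      for. There are at most \<open>2 * min k j\<close> of these, so equality holds
      throughout.\<close>
    ultimately have t2: "k + j \<le> card (K \<inter> K') + card (L \<inter> L')" using t1 c by simp
    have b: "card (K \<inter> K') \<le> k" "card (K \<inter> K') \<le> j" "card (L \<inter> L') \<le> k" "card (L \<inter> L') \<le> j"
      using card_mono[OF finKL(1) Int_lower1, of K'] card_mono[OF fy(2) Int_lower2, of K]
        card_mono[OF finKL(2) Int_lower1, of L'] card_mono[OF fy(3) Int_lower2, of L] cK y' by simp_all
    have jk: "j = k" and e: "card (K \<inter> K') = k" "card (L \<inter> L') = k" using t2 b by linarith+
    have "K \<inter> K' = K" "K \<inter> K' = K'" "L \<inter> L' = L" "L \<inter> L' = L'"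
      using card_subset_eq[OF finKL(1) Int_lower1, of K'] card_subset_eq[OF fy(2) Int_lower2, of K]
        card_subset_eq[OF finKL(2) Int_lower1, of L'] card_subset_eq[OF fy(3) Int_lower2, of L]
        e jk cK y' by simp_all
    then show ?thesis using jk y' by simp
  qed
  have "\<exists>J. J \<subseteq> F \<and> card J = k \<and> x = (J, K, L)" if "x \<in> Y j" for j x
    using main[of "fst x" "fst (snd x)" "snd (snd x)" j] that by (cases x) auto
  with cK show ?thesis by (intro exI[of _ K] exI[of _ L]) simp
qed

context edge_family
begin

lemma level_sum_le:
  assumes "q \<le> Q" "Q \<ge> 1"
  shows "(\<Sum>j\<le>q. (2 * real q ^ 2) ^ j / fact j ^ 3) \<le> real (Q + 1) * (2 * real Q ^ 2) ^ Q"
proof -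
  have "1 \<le> real Q" using assms(2) by simp
  then have "1 \<le> real Q ^ 2" by (rule one_le_power)
  then have Q1: "1 \<le> 2 * real Q ^ 2" by linarith
  have "(\<Sum>j\<le>q. (2 * real q ^ 2) ^ j / fact j ^ 3) \<le> (\<Sum>j\<le>q. (2 * real Q ^ 2) ^ Q)"
  proof (rule sum_mono)
    fix j assume j: "j \<in> {..q}"
    have "(2 * real q ^ 2) ^ j / fact j ^ 3 \<le> (2 * real q ^ 2) ^ j / 1"
      by (intro divide_left_mono) (auto simp: one_le_power fact_ge_1)
    also have "\<dots> \<le> (2 * real Q ^ 2) ^ j" using assms by (simp add: power_mono)
    also have "\<dots> \<le> (2 * real Q ^ 2) ^ Q" using j assms by (intro power_increasing Q1) auto
    finally show "(2 * real q ^ 2) ^ j / fact j ^ 3 \<le> (2 * real Q ^ 2) ^ Q" .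
  qed
  also have "\<dots> = real (q + 1) * (2 * real Q ^ 2) ^ Q" by simp
  also have "\<dots> \<le> real (Q + 1) * (2 * real Q ^ 2) ^ Q" using assms by (intro mult_right_mono) auto
  finally show ?thesis .
qed

text \<open>A member above a set of \<open>X\<close> lies above an exchange. If this exchange is not
  in \<open>X\<close>, maximality supplies a set of \<open>X\<close> meeting it in fewer than
  \<open>t\<close> elements, so the member contains one of at most \<open>3 * q\<close> further
  elements; such members amount to a fraction of order \<open>1 / n\<close>. If the exchanges in
  \<open>X\<close> are few on every level, the family is small. Otherwise some level is popular, it
  is positive because \<open>X\<close> has no t-set, and \<open>popular_exchange\<close> fixes
  \<open>K\<close> and \<open>L\<close>.\<close>

lemma no_center_case:
  assumes F: "F \<subseteq> \<T>" and tn: "t \<le> n" and Mt: "M t > 0"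
    and X: "intersecting t X" "\<And>S. S \<in> X \<Longrightarrow> S \<subseteq> E \<and> card S \<le> t + q"
    and closed: "\<And>V. V \<subseteq> E \<Longrightarrow> t \<le> card V \<Longrightarrow> card V \<le> t + q \<Longrightarrow> (\<And>S. S \<in> X \<Longrightarrow> t \<le> card (V \<inter> S)) \<Longrightarrow> V \<in> X"
    and S12: "Sa \<in> X" "Sb \<in> X" "card (Sa \<inter> Sb) = t"
    and none: "\<And>S. S \<in> X \<Longrightarrow> card S \<noteq> t"
    and unc: "real (card {T \<in> F. \<not> (\<exists>S\<in>X. S \<subseteq> T)}) \<le> 1/1000 * M t"
    and q: "q \<ge> 1"
    and n1: "real n \<ge> 6000 * real q * (real (q + 1) * (2 * real q ^ 2) ^ q)"
    and n2: "real n \<ge> 1000 * real (q + 1) * real q * 8 ^ q"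
  shows "real (card F) \<le> 3/1000 * M t \<or>
    (\<exists>F0 K L k. 0 < k \<and> F0 \<subseteq> E \<and> K \<subseteq> E \<and> L \<subseteq> E \<and> card F0 = t \<and> card K = k \<and> card L = k \<and>
       F0 \<inter> K = {} \<and> F0 \<inter> L = {} \<and> K \<inter> L = {} \<and>
       real (card {T \<in> F. \<not> (\<exists>J\<subseteq>F0. card J = k \<and> (F0 - J) \<union> K \<union> L \<subseteq> T)}) \<le> 3/1000 * M t)"
proof -
  define F0 where "F0 = Sa \<inter> Sb"
  define A where "A = Sa - Sb"
  define B where "B = Sb - Sa"
  have SE: "Sa \<subseteq> E" "Sb \<subseteq> E" using X(2) S12 by blast+
  have fin: "finite F0" "finite A" "finite B" using SE finite_sub unfolding F0_def A_def B_def by blast+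
  have dis: "F0 \<inter> A = {}" "F0 \<inter> B = {}" "A \<inter> B = {}" unfolding F0_def A_def B_def by blast+
  have U: "F0 \<union> A = Sa" "F0 \<union> B = Sb" unfolding F0_def A_def B_def by blast+
  have E3: "F0 \<subseteq> E" "A \<subseteq> E" "B \<subseteq> E" using SE unfolding F0_def A_def B_def by blast+
  have cF0: "card F0 = t" using S12 by (simp add: F0_def)
  have cA: "card A \<le> q"
  proof -
    have "card Sa = t + card A" using card_Un_disjoint[OF fin(1,2) dis(1)] U cF0 by simp
    then show ?thesis using X(2)[OF S12(1)] by simp
  qed
  have cB: "card B \<le> q"
  proof -
    have "card Sb = t + card B" using card_Un_disjoint[OF fin(1,3) dis(2)] U cF0 by simp
    then show ?thesis using X(2)[OF S12(2)] by simp
  qed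
  define ex where "ex = exchanges F0 A B"
  define vs where "vs = exchange F0"
  define Y where "Y j = {x \<in> ex j. vs x \<in> X}" for j
  define wit where "wit x = (SOME S. S \<in> X \<and> card (vs x \<inter> S) < t)" for x
  have finex: "finite (ex j)" for j unfolding ex_def by (rule finite_exchanges[OF fin])
  have vsE: "vs x \<subseteq> E" if "x \<in> ex j" for x j
  proof -
    have "x \<in> exchanges F0 A B j" using that unfolding ex_def .
    then obtain J K L where "x = (J, K, L)" "J \<subseteq> F0" "card J = j" "K \<subseteq> A" "card K = j" "L \<subseteq> B" "card L = j"
      by (rule exchangesE)
    then show ?thesis using E3 unfolding vs_def exchange_def by auto
  qed
  have cvs: "card (vs x) = t + j" if "x \<in> ex j" for x j
    using card_exchange[OF fin dis, of x j] that cF0 unfolding ex_def vs_def by simp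
  have jq: "j \<le> q" if "x \<in> ex j" for x j
  proof -
    have "x \<in> exchanges F0 A B j" using that unfolding ex_def .
    then obtain J K L where "x = (J, K, L)" "J \<subseteq> F0" "card J = j" "K \<subseteq> A" "card K = j" "L \<subseteq> B" "card L = j"
      by (rule exchangesE)
    then show ?thesis using card_mono[OF fin(2), of K] cA by simp
  qed
  have wit: "wit x \<in> X \<and> card (vs x \<inter> wit x) < t" if x: "x \<in> ex j" "vs x \<notin> X" for x j
  proof -
    have "\<exists>S. S \<in> X \<and> card (vs x \<inter> S) < t"
    proof (rule ccontr)
      assume "\<not> ?thesis"
      then have "vs x \<in> X"
        by (intro closed) (use vsE[OF x(1)] cvs[OF x(1)] jq[OF x(1)] in \<open>auto simp: not_less\<close>)
      then show False using x by simp
    qed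
    then show ?thesis unfolding wit_def by (rule someI_ex)
  qed
  have cwit: "card (wit x - vs x) \<le> 3 * q" if x: "x \<in> ex j" "vs x \<notin> X" for x j
  proof -
    note w = wit[OF x]
    have finw: "finite (wit x)" using X(2) w finite_sub by blast
    have "t \<le> card (wit x \<inter> Sa)" using X(1) w S12 unfolding intersecting_def by blast
    also have "wit x \<inter> Sa \<subseteq> (wit x \<inter> vs x) \<union> ((F0 - vs x) \<union> A)" using U by blast
    then have "card (wit x \<inter> Sa) \<le> card ((wit x \<inter> vs x) \<union> ((F0 - vs x) \<union> A))"
      by (rule card_mono[rotated]) (use finw fin in simp)
    also have "\<dots> \<le> card (wit x \<inter> vs x) + (card (F0 - vs x) + card A)"
      using card_Un_le[of "wit x \<inter> vs x" "(F0 - vs x) \<union> A"] card_Un_le[of "F0 - vs x" A] by linarith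
    also have "card (F0 - vs x) \<le> q"
    proof -
      have "x \<in> exchanges F0 A B j" using x(1) unfolding ex_def .
      then obtain J K L where xe: "x = (J, K, L)" "J \<subseteq> F0" "card J = j" "K \<subseteq> A" "card K = j" "L \<subseteq> B" "card L = j"
        by (rule exchangesE)
      have "F0 - vs x \<subseteq> J" unfolding vs_def exchange_def xe by auto
      then have "card (F0 - vs x) \<le> card J" by (rule card_mono[rotated]) (use xe fin finite_subset in blast)
      then show ?thesis using xe jq[OF x(1)] by simp
    qed
    \<comment> \<open>The elements of \<open>F0\<close> dropped by the exchange and the set
      \<open>A\<close> cost \<open>q\<close> each; a witness has at most \<open>t + q\<close>
      elements, hence at most \<open>3 * q\<close> outside the exchange.\<close>
    finally have "t \<le> card (wit x \<inter> vs x) + 2 * q" using cA by simp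
    moreover have "card (wit x) = card (wit x \<inter> vs x) + card (wit x - vs x)" by (rule card_Int_Diff[OF finw])
    moreover have "card (wit x) \<le> t + q" using X(2) w by blast
    ultimately show ?thesis by linarith
  qed
  define bad where "bad = (\<Union>j\<in>{..q}. \<Union>x\<in>{x \<in> ex j. vs x \<notin> X}. \<Union>e\<in>wit x - vs x. above F (insert e (vs x)))"
  define good where "good = (\<Union>j\<in>{..q}. \<Union>x\<in>Y j. above F (vs x))"
  define un where "un = {T \<in> F. \<not> (\<exists>S\<in>X. S \<subseteq> T)}"
  have finF: "finite F" using finite_fam[OF F] .
  have cover: "F \<subseteq> un \<union> bad \<union> good"
  proof
    fix T assume T: "T \<in> F"
    show "T \<in> un \<union> bad \<union> good"
    proof (cases "T \<in> un")
      case False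
      then obtain S where S: "S \<in> X" "S \<subseteq> T" using T unfolding un_def by blast
      have "card F0 \<le> card (S \<inter> Sa)" "card F0 \<le> card (S \<inter> Sb)"
        using X(1) S S12 cF0 unfolding intersecting_def by simp_all
      then obtain x where x: "x \<in> ex (card (F0 - S))" "vs x \<subseteq> S"
        using exchange_exists[OF fin dis(1,2), of S] unfolding ex_def vs_def U by blast
      note j = jq[OF x(1)]
      show ?thesis
      proof (cases "vs x \<in> X")
        case True
        then have "T \<in> good" using x S T j unfolding good_def Y_def by blast
        then show ?thesis by blast
      next
        case nX: False
        note w = wit[OF x(1) nX]
        have "t \<le> card (S \<inter> wit x)" using X(1) S w unfolding intersecting_def by blast
        then have "\<not> S \<inter> wit x \<subseteq> vs x \<inter> wit x"
          using w card_mono[of "vs x \<inter> wit x" "S \<inter> wit x"] finite_sub[OF vsE[OF x(1)]] by auto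
        then obtain e where e: "e \<in> S" "e \<in> wit x - vs x" by blast
        have "T \<in> above F (insert e (vs x))" using e x S T by blast
        moreover have "x \<in> {x \<in> ex (card (F0 - S)). vs x \<notin> X}" using x nX by simp
        moreover have "card (F0 - S) \<in> {..q}" using j by simp
        ultimately have "T \<in> bad" using e unfolding bad_def by blast
        then show ?thesis by blast
      qed
    qed simp
  qed
  have cbad: "real (card bad) \<le> 1/1000 * M t"
  proof -
    define N where "N j = {x \<in> ex j. vs x \<notin> X}" for j
    have finN: "finite (N j)" for j using finex by (simp add: N_def)
    have finw: "finite (wit x - vs x)" if "x \<in> N j" for x j
      using wit[of x j] that X(2) finite_sub unfolding N_def by blast
    have "card bad \<le> (\<Sum>j\<le>q. card (\<Union>x\<in>N j. \<Union>e\<in>wit x - vs x. above F (insert e (vs x))))"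
      unfolding bad_def N_def[symmetric] by (rule card_UN_le) simp
    also have "\<dots> \<le> (\<Sum>j\<le>q. \<Sum>x\<in>N j. card (\<Union>e\<in>wit x - vs x. above F (insert e (vs x))))"
      by (intro sum_mono card_UN_le finN)
    also have "\<dots> \<le> (\<Sum>j\<le>q. \<Sum>x\<in>N j. \<Sum>e\<in>wit x - vs x. card (above F (insert e (vs x))))"
      by (intro sum_mono card_UN_le finw)
    finally have "real (card bad) \<le> (\<Sum>j\<le>q. \<Sum>x\<in>N j. \<Sum>e\<in>wit x - vs x. real (card (above F (insert e (vs x)))))"
      by (simp flip: of_nat_sum)
    also have "\<dots> \<le> (\<Sum>j\<le>q. 6 * real q / n * ((2 * real q ^ 2) ^ j / fact j ^ 3 * M t))"
    proof (rule sum_mono)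
      fix j
      have "(\<Sum>e\<in>wit x - vs x. real (card (above F (insert e (vs x))))) \<le> 3 * real q * (2 / n * M (t + j))" if x: "x \<in> N j" for x
      proof -
        have xe: "x \<in> ex j" "vs x \<notin> X" using x by (simp_all add: N_def)
        have "(\<Sum>e\<in>wit x - vs x. real (card (above F (insert e (vs x))))) \<le> card (wit x - vs x) * (2 / n * M (t + j))"
        proof (rule sum_bounded_above)
          fix e assume e: "e \<in> wit x - vs x"
          have "e \<in> E" using wit[OF xe] X(2) e by blast
          then have "insert e (vs x) \<subseteq> E" using vsE[OF xe(1)] by simp
          from card_above[OF F this] have "real (card (above F (insert e (vs x)))) \<le> M (Suc (t + j))"
            using e cvs[OF xe(1)] finite_sub[OF vsE[OF xe(1)]] by simp
          also have "\<dots> \<le> 2 / n * M (t + j)" by (rule M_step)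
          finally show "real (card (above F (insert e (vs x)))) \<le> 2 / n * M (t + j)" .
        qed
        also have "\<dots> \<le> 3 * real q * (2 / n * M (t + j))"
        proof (rule mult_right_mono)
          have "real (card (wit x - vs x)) \<le> real (3 * q)" using cwit[OF xe] by (simp only: of_nat_le_iff)
          then show "real (card (wit x - vs x)) \<le> 3 * real q" by simp
        qed (use M_nonneg in simp)
        finally show ?thesis .
      qed
      then have "(\<Sum>x\<in>N j. \<Sum>e\<in>wit x - vs x. real (card (above F (insert e (vs x))))) \<le> card (N j) * (3 * real q * (2 / n * M (t + j)))"
        by (rule sum_bounded_above)
      also have "\<dots> \<le> card (ex j) * (3 * real q * (2 / n * M (t + j)))"
      proof (rule mult_right_mono)
        show "real (card (N j)) \<le> real (card (ex j))" using card_mono[OF finex, of "N j" j] by (simp add: N_def)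
      qed (use M_nonneg in simp)
      also have "\<dots> = 6 * real q / n * (card (ex j) * M (card F0 + j))" by (simp add: cF0)
      also have "\<dots> \<le> 6 * real q / n * ((2 * real q ^ 2) ^ j / fact j ^ 3 * M (card F0))"
        unfolding ex_def by (intro mult_left_mono card_exchanges_M fin cA cB) (use cF0 tn in auto)
      finally show "(\<Sum>x\<in>N j. \<Sum>e\<in>wit x - vs x. real (card (above F (insert e (vs x))))) \<le>
          6 * real q / n * ((2 * real q ^ 2) ^ j / fact j ^ 3 * M t)" by (simp add: cF0)
    qed
    also have "\<dots> = 6 * real q / n * ((\<Sum>j\<le>q. (2 * real q ^ 2) ^ j / fact j ^ 3) * M t)"
      by (simp only: sum_distrib_left sum_distrib_right)
    also have "\<dots> \<le> 6 * real q / n * ((real (q + 1) * (2 * real q ^ 2) ^ q) * M t)"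
      using level_sum_le[of q q] q M_nonneg by (intro mult_left_mono mult_right_mono) auto
    also have "\<dots> = (6 * real q * (real (q + 1) * (2 * real q ^ 2) ^ q)) / n * M t" by simp
    also have "\<dots> \<le> 1/1000 * M t"
      using n1 n_pos M_nonneg by (intro mult_right_mono) (auto simp: field_simps)
    finally show ?thesis .
  qed
  have cun: "real (card un) \<le> 1/1000 * M t" using unc by (simp add: un_def)
  \<comment> \<open>Over all \<open>q + 1\<close> levels, light levels together contribute at most
    \<open>M t / 1000\<close>.\<close>
  define \<gamma> :: real where "\<gamma> = 1 / (1000 * (q + 1))"
  have \<gamma>: "\<gamma> > 0" by (simp add: \<gamma>_def)
  have finY: "finite (Y j)" for j using finex by (simp add: Y_def)
  have finbad: "finite bad" and finun: "finite un" and fingood: "finite good"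
    using finF by (auto intro: finite_subset[of _ F] simp: bad_def un_def good_def)
  show ?thesis
  proof (cases "\<forall>j\<le>q. card (Y j) * M (t + j) \<le> \<gamma> * M t")
    case True
    have "card good \<le> (\<Sum>j\<le>q. card (\<Union>x\<in>Y j. above F (vs x)))" unfolding good_def by (rule card_UN_le) simp
    also have "\<dots> \<le> (\<Sum>j\<le>q. \<Sum>x\<in>Y j. card (above F (vs x)))" by (intro sum_mono card_UN_le finY)
    finally have "real (card good) \<le> (\<Sum>j\<le>q. \<Sum>x\<in>Y j. real (card (above F (vs x))))" by (simp flip: of_nat_sum)
    also have "\<dots> \<le> (\<Sum>j\<le>q. \<gamma> * M t)"
    proof (rule sum_mono)
      fix j assume j: "j \<in> {..q}"
      have "(\<Sum>x\<in>Y j. real (card (above F (vs x)))) \<le> card (Y j) * M (t + j)"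
      proof (rule sum_bounded_above)
        fix x assume "x \<in> Y j"
        then have x: "x \<in> ex j" by (simp add: Y_def)
        show "real (card (above F (vs x))) \<le> M (t + j)" using card_above[OF F vsE[OF x]] cvs[OF x] by simp
      qed
      also have "\<dots> \<le> \<gamma> * M t" using True j by simp
      finally show "(\<Sum>x\<in>Y j. real (card (above F (vs x)))) \<le> \<gamma> * M t" .
    qed
    also have "\<dots> = 1/1000 * M t" by (simp add: \<gamma>_def field_simps)
    finally have cg: "real (card good) \<le> 1/1000 * M t" .
    have "card F \<le> card (un \<union> bad \<union> good)" by (rule card_mono[OF _ cover]) (use finbad finun fingood in simp)
    also have "\<dots> \<le> card un + card bad + card good"
      using card_Un_le[of "un \<union> bad" good] card_Un_le[of un bad] by linarith
    finally have "real (card F) \<le> real (card un) + real (card bad) + real (card good)" by (simp flip: of_nat_add)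
    then show ?thesis using cun cbad cg by simp
  next
    case False
    then obtain k where k: "k \<le> q" "\<gamma> * M t < card (Y k) * M (t + k)" by (auto simp: not_le)
    have ktrue: "k > 0"
    proof (rule ccontr)
      assume "\<not> k > 0"
      then have k0: "k = 0" by simp
      have "card (Y k) \<noteq> 0"
      proof
        assume "card (Y k) = 0"
        then show False using k(2) mult_pos_pos[OF \<gamma> Mt] by simp
      qed
      then obtain x where "x \<in> Y k" by (metis card.empty equals0I)
      then have "vs x \<in> X" "card (vs x) = t" using cvs[of x k] k0 by (simp_all add: Y_def)
      then show False using none by blast
    qed
    have "\<gamma> * M t < card (Y k) * ((2 / n) ^ k * M t)"
      using k(2) mult_left_mono[OF M_pow[of t k], of "real (card (Y k))"] by simp
    then have "\<gamma> * M t < (card (Y k) * (2 / n) ^ k) * M t" by (simp add: mult.assoc)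
    then have "\<gamma> < card (Y k) * (2 / n) ^ k" using Mt by (simp add: mult_less_cancel_right)
    then have big: "\<gamma> * (n / 2) ^ k < card (Y k)"
      using n_pos by (simp add: power_divide field_simps)
    have "\<exists>K L. K \<subseteq> A \<and> L \<subseteq> B \<and> card K = k \<and> card L = k \<and>
      (\<forall>j. \<forall>x\<in>Y j. \<exists>J. J \<subseteq> F0 \<and> card J = k \<and> x = (J, K, L))"
    proof (rule popular_exchange[where Y = Y and q = q, OF fin dis cF0 tn cA cB n_pos _ _ ktrue k(1) big \<gamma>])
      show "Y j \<subseteq> exchanges F0 A B j" for j by (auto simp: Y_def ex_def)
      show "t \<le> card (exchange F0 x \<inter> exchange F0 y)" if "x \<in> Y j" "y \<in> Y j'" for x y j j'
        using that X(1) unfolding Y_def vs_def intersecting_def by blast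
      show "real q * 8 ^ q / \<gamma> \<le> real n" using n2 by (simp add: \<gamma>_def mult_ac)
    qed
    then obtain K L where KL: "K \<subseteq> A" "L \<subseteq> B" "card K = k" "card L = k"
      "\<forall>j. \<forall>x\<in>Y j. \<exists>J. J \<subseteq> F0 \<and> card J = k \<and> x = (J, K, L)" by blast
    define rest where "rest = {T \<in> F. \<not> (\<exists>J\<subseteq>F0. card J = k \<and> (F0 - J) \<union> K \<union> L \<subseteq> T)}"
    have "good \<inter> rest = {}"
    proof (rule ccontr)
      assume "good \<inter> rest \<noteq> {}"
      then obtain T j x where T: "T \<in> rest" "x \<in> Y j" "vs x \<subseteq> T" unfolding good_def by blast
      obtain J where "J \<subseteq> F0" "card J = k" "x = (J, K, L)" using KL(5)[rule_format, OF T(2)] by blast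
      then show False using T unfolding rest_def vs_def exchange_def by auto
    qed
    then have "rest \<subseteq> un \<union> bad" using cover unfolding rest_def by blast
    then have "card rest \<le> card (un \<union> bad)" by (rule card_mono[rotated]) (use finbad finun in simp)
    also have "\<dots> \<le> card un + card bad" by (rule card_Un_le)
    finally have "real (card rest) \<le> real (card un) + real (card bad)" by (simp flip: of_nat_add)
    then have cr: "real (card rest) \<le> 3/1000 * M t" using cun cbad Mt by simp
    have "K \<subseteq> E" "L \<subseteq> E" "F0 \<inter> K = {}" "F0 \<inter> L = {}" "K \<inter> L = {}" using KL dis E3 by blast+
    then show ?thesis using ktrue cF0 E3 KL cr unfolding rest_def by blast
  qed
qed

end

section \<open>The three possible structures\<close>

lemma exp_minus_ten_le: "exp (- 10) \<le> (1/1000 :: real)"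
proof -
  have "(2::real) ^ 10 \<le> exp 1 ^ 10" using exp_ge_add_one_self[of "1::real"] by (intro power_mono) auto
  then have "1000 \<le> exp (10::real)" by (simp flip: exp_of_nat_mult)
  then show ?thesis by (simp add: exp_minus field_simps)
qed

text \<open>Once \<open>q\<close> is bounded, the maximal family \<open>X\<close> may contain a
  t-set, which then lies in every set of \<open>X\<close>. It is a centre if it carries more than
  half of \<open>M t\<close>; otherwise half plus the uncovered members stays below 51/100. Without
  a t-set in \<open>X\<close>, \<open>no_center_case\<close> applies.\<close>

theorem intersecting_structure:
  "\<exists>n0. \<forall>n\<ge>n0. \<forall>(E :: 'a set) \<T> M t F. edge_family E \<T> M n \<longrightarrow> F \<subseteq> \<T> \<longrightarrow> intersecting t F \<longrightarrow>
     t \<le> n \<longrightarrow> M t > 0 \<longrightarrow>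
     real (card F) \<le> 51/100 * M t \<or>
     (\<exists>F0\<subseteq>E. card F0 = t \<and> real (card {T \<in> F. \<not> F0 \<subseteq> T}) \<le> 1/2 * exp (- 2 * real (n div 1024)) * M t) \<or>
     (\<exists>F0 K L k. 0 < k \<and> F0 \<subseteq> E \<and> K \<subseteq> E \<and> L \<subseteq> E \<and> card F0 = t \<and> card K = k \<and> card L = k \<and>
       F0 \<inter> K = {} \<and> F0 \<inter> L = {} \<and> K \<inter> L = {} \<and>
       real (card {T \<in> F. \<not> (\<exists>J\<subseteq>F0. card J = k \<and> (F0 - J) \<union> K \<union> L \<subseteq> T)}) \<le> 3/1000 * M t)"
proof -
  obtain n1 where n1: "\<forall>n\<ge>n1. \<forall>(E::'a set) G1 G2 S1 S2. finite E \<longrightarrow>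
     (\<forall>T\<in>G1 \<union> G2. card T \<le> n) \<longrightarrow>
     spread_over E (real n / 128) G1 S1 \<longrightarrow> spread_over E (real n / 128) G2 S2 \<longrightarrow>
     real (card (S1 - S2)) \<le> real n / 256 \<longrightarrow> real (card (S2 - S1)) \<le> real n / 256 \<longrightarrow>
     (\<exists>T1\<in>G1. \<exists>T2\<in>G2. T1 \<inter> T2 \<subseteq> S1 \<inter> S2)"
    using spread_over_links_meet by blast
  \<comment> \<open>The bound of \<open>covered_bounded\<close> for \<open>Q1 = 10\<close>, a value
    chosen because \<open>exp (- 10)\<close> is at most 1/1000.\<close>
  define Q :: nat where "Q = 2 * 102400 ^ 3 + 1024 * 10 + 1024"
  define N where "N = 6000 * Q * ((Q + 1) * (2 * Q ^ 2) ^ Q) + 1000 * (Q + 1) * Q * 8 ^ Q + Q + n1"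
  show ?thesis
  proof (intro exI[of _ N] allI impI)
    fix n :: nat and E :: "'a set" and \<T> M t F
    assume nN: "N \<le> n" and ef: "edge_family E \<T> M n" and F: "F \<subseteq> \<T>" "intersecting t F"
      and tn: "t \<le> n" and Mt: "M t > 0"
    interpret edge_family E \<T> M n by (rule ef)
    have nn: "n1 \<le> n" "Q \<le> n" using nN unfolding N_def by linarith+
    have n10: "10 \<le> n" "2 * 102400 ^ 3 \<le> n" using nn(2) unfolding Q_def by linarith+
    have L: "links_meet"
      unfolding links_meet_def
    proof (intro allI impI)
      fix G1 G2 S1 S2
      assume a: "G1 \<subseteq> \<T>" "G2 \<subseteq> \<T>" "spread_over E (real n / 128) G1 S1" "spread_over E (real n / 128) G2 S2"
        "real (card (S1 - S2)) \<le> real n / 256" "real (card (S2 - S1)) \<le> real n / 256"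
      have "\<forall>T\<in>G1 \<union> G2. card T \<le> n" using a T_card by blast
      then show "\<exists>T1\<in>G1. \<exists>T2\<in>G2. T1 \<inter> T2 \<subseteq> S1 \<inter> S2"
        using n1[rule_format, OF nn(1) finE, of G1 G2 S1 S2] a by blast
    qed
    show "real (card F) \<le> 51/100 * M t \<or>
     (\<exists>F0\<subseteq>E. card F0 = t \<and> real (card {T \<in> F. \<not> F0 \<subseteq> T}) \<le> 1/2 * exp (- 2 * real (n div 1024)) * M t) \<or>
     (\<exists>F0 K L k. 0 < k \<and> F0 \<subseteq> E \<and> K \<subseteq> E \<and> L \<subseteq> E \<and> card F0 = t \<and> card K = k \<and> card L = k \<and>
       F0 \<inter> K = {} \<and> F0 \<inter> L = {} \<and> K \<inter> L = {} \<and>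
       real (card {T \<in> F. \<not> (\<exists>J\<subseteq>F0. card J = k \<and> (F0 - J) \<union> K \<union> L \<subseteq> T)}) \<le> 3/1000 * M t)"
      (is "?small \<or> ?center \<or> ?exch")
    proof (cases "F = {}")
      case True
      then show ?thesis using Mt by simp
    next
      case False
      then obtain T0 where T0: "T0 \<in> F" by blast
      have "t \<le> card (T0 \<inter> T0)" using F(2) T0 unfolding intersecting_def by blast
      also have "\<dots> \<le> card E" using T0 F T_sub by (intro card_mono finE) blast
      finally have tE: "t \<le> card E" .
      obtain q where q: "10 \<le> q" "q \<le> Q" "covered_up_to t F q"
        using covered_bounded[OF L F tE tn n10(1)] unfolding Q_def by blast
      obtain SS where SS: "intersecting t SS" "\<And>S. S \<in> SS \<Longrightarrow> S \<subseteq> E \<and> card S \<le> t + q"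
         "real (card {T \<in> F. \<not> (\<exists>S\<in>SS. S \<subseteq> T)}) \<le> exp (- real q) * M t"
        using q(3) unfolding covered_up_to_def by blast
      obtain X S1 S2 where X: "SS \<subseteq> X" "intersecting t X" "\<And>S. S \<in> X \<Longrightarrow> S \<subseteq> E \<and> card S \<le> t + q"
        and closed: "\<And>V. V \<subseteq> E \<Longrightarrow> t \<le> card V \<Longrightarrow> card V \<le> t + q \<Longrightarrow> (\<And>S. S \<in> X \<Longrightarrow> t \<le> card (V \<inter> S)) \<Longrightarrow> V \<in> X"
        and S12: "S1 \<in> X" "S2 \<in> X" "card (S1 \<inter> S2) = t"
        by (rule maximal_intersecting[OF SS(1,2) tE]) blast+
      have finF: "finite F" using finite_fam[OF F(1)] .
      have unc: "real (card {T \<in> F. \<not> (\<exists>S\<in>X. S \<subseteq> T)}) \<le> 1/1000 * M t"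
      proof -
        have "card {T \<in> F. \<not> (\<exists>S\<in>X. S \<subseteq> T)} \<le> card {T \<in> F. \<not> (\<exists>S\<in>SS. S \<subseteq> T)}"
          by (rule card_mono) (use finF X(1) in auto)
        then have "real (card {T \<in> F. \<not> (\<exists>S\<in>X. S \<subseteq> T)}) \<le> exp (- real q) * M t" using SS(3) by linarith
        also have "\<dots> \<le> exp (- 10) * M t" using q(1) M_nonneg by (intro mult_right_mono) auto
        also have "\<dots> \<le> 1/1000 * M t" using exp_minus_ten_le M_nonneg by (intro mult_right_mono) auto
        finally show ?thesis .
      qed
      show ?thesis
      proof (cases "\<exists>S\<in>X. card S = t")
        case True
        then obtain F0 where F0: "F0 \<in> X" "card F0 = t" by blast
        have F0E: "F0 \<subseteq> E" using X(3)[OF F0(1)] by blast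
        have sub: "F0 \<subseteq> S" if S: "S \<in> X" for S
        proof -
          have "card F0 \<le> card (F0 \<inter> S)" using X(2) F0 S unfolding intersecting_def by blast
          then have "F0 \<inter> S = F0" using card_seteq[OF finite_sub[OF F0E] Int_lower1] by blast
          then show ?thesis by blast
        qed
        show ?thesis
        proof (cases "real (card (above F F0)) > 1/2 * M t")
          case True
          then have ?center using center_case[OF L F tn n10(2) F0E F0(2)] F0E F0(2) by blast
          then show ?thesis by blast
        next
          case False
          have "F \<subseteq> above F F0 \<union> {T \<in> F. \<not> (\<exists>S\<in>X. S \<subseteq> T)}" using sub by blast
          then have "card F \<le> card (above F F0 \<union> {T \<in> F. \<not> (\<exists>S\<in>X. S \<subseteq> T)})"
            by (rule card_mono[rotated]) (use finF in simp)
          also have "\<dots> \<le> card (above F F0) + card {T \<in> F. \<not> (\<exists>S\<in>X. S \<subseteq> T)}" by (rule card_Un_le)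
          finally have "real (card F) \<le> real (card (above F F0)) + real (card {T \<in> F. \<not> (\<exists>S\<in>X. S \<subseteq> T)})"
            by (simp flip: of_nat_add)
          then have ?small using False unc Mt by simp
          then show ?thesis by blast
        qed
      next
        case False
        have q1: "1 \<le> q" using q by simp
        have m1: "6000 * q * ((q + 1) * (2 * q ^ 2) ^ q) \<le> 6000 * Q * ((Q + 1) * (2 * Q ^ 2) ^ Q)"
        proof (intro mult_le_mono)
          have "(2 * q ^ 2) ^ q \<le> (2 * Q ^ 2) ^ q" using q by (intro power_mono mult_le_mono) auto
          also have "\<dots> \<le> (2 * Q ^ 2) ^ Q" by (rule power_increasing[OF q(2)]) (simp add: Q_def)
          finally show "(2 * q ^ 2) ^ q \<le> (2 * Q ^ 2) ^ Q" .
        qed (use q in auto)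
        have m2: "1000 * (q + 1) * q * 8 ^ q \<le> 1000 * (Q + 1) * Q * 8 ^ Q"
          using q by (intro mult_le_mono power_increasing) auto
        have "6000 * q * ((q + 1) * (2 * q ^ 2) ^ q) \<le> n" using m1 nN unfolding N_def by linarith
        then have "real (6000 * q * ((q + 1) * (2 * q ^ 2) ^ q)) \<le> real n" by (simp only: of_nat_le_iff)
        then have b1: "6000 * real q * (real (q + 1) * (2 * real q ^ 2) ^ q) \<le> real n"
          by (simp only: of_nat_mult of_nat_power of_nat_numeral)
        have "1000 * (q + 1) * q * 8 ^ q \<le> n" using m2 nN unfolding N_def by linarith
        then have "real (1000 * (q + 1) * q * 8 ^ q) \<le> real n" by (simp only: of_nat_le_iff)
        then have b2: "1000 * real (q + 1) * real q * 8 ^ q \<le> real n"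
          by (simp only: of_nat_mult of_nat_power of_nat_numeral)
        have none: "card S \<noteq> t" if "S \<in> X" for S using False that by blast
        have "real (card F) \<le> 3/1000 * M t \<or> ?exch"
          by (rule no_center_case[where X = X and q = q and Sa = S1 and Sb = S2])
            (fact F(1) tn Mt X(2,3) closed S12 none unc q1 b1 b2)+
        then show ?thesis
        proof
          assume "real (card F) \<le> 3/1000 * M t"
          then have ?small using Mt by linarith
          then show ?thesis by (rule disjI1)
        next
          assume ?exch
          then show ?thesis by (intro disjI2)
        qed
      qed
    qed
  qed
qed

section \<open>Forests and components\<close>

definition component :: "nat \<Rightarrow> nat set set \<Rightarrow> nat \<Rightarrow> nat set" where
  "component n E v = {u \<in> {1..n}. (v, u) \<in> (adj_rel E)\<^sup>*}"

lemma graph_components_eq: "graph_components n E = component n E ` {1..n}"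
  by (simp add: graph_components_def component_def)

lemma conn_sym: "(u, v) \<in> (adj_rel E)\<^sup>* \<Longrightarrow> (v, u) \<in> (adj_rel E)\<^sup>*"
proof -
  have "sym (adj_rel E)" by (auto simp: sym_def adj_rel_def insert_commute)
  then show "(u, v) \<in> (adj_rel E)\<^sup>* \<Longrightarrow> (v, u) \<in> (adj_rel E)\<^sup>*" by (metis sym_rtrancl symD)
qed

lemma conn_mono: "E \<subseteq> E' \<Longrightarrow> (u, v) \<in> (adj_rel E)\<^sup>* \<Longrightarrow> (u, v) \<in> (adj_rel E')\<^sup>*"
proof -
  assume "E \<subseteq> E'"
  then have "adj_rel E \<subseteq> adj_rel E'" by (auto simp: adj_rel_def)
  then show "(u, v) \<in> (adj_rel E)\<^sup>* \<Longrightarrow> (u, v) \<in> (adj_rel E')\<^sup>*" by (meson rtrancl_mono subsetD)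
qed

lemma conn_edge: "{u, v} \<in> E \<Longrightarrow> (u, v) \<in> (adj_rel E)\<^sup>*"
  by (rule r_into_rtrancl) (simp add: adj_rel_def)

lemma adj_rel_insert: "adj_rel (insert {u, v} E) = insert (u, v) (insert (v, u) (adj_rel E))"
  by (auto simp: adj_rel_def doubleton_eq_iff)

text \<open>An undirected edge is inserted as two directed ones; the alternatives that use both
  directions collapse by symmetry and transitivity.\<close>

lemma conn_insert:
  "(x, y) \<in> (adj_rel (insert {u, v} E))\<^sup>* \<longleftrightarrow> (x, y) \<in> (adj_rel E)\<^sup>* \<or>
     (x, u) \<in> (adj_rel E)\<^sup>* \<and> (v, y) \<in> (adj_rel E)\<^sup>* \<or> (x, v) \<in> (adj_rel E)\<^sup>* \<and> (u, y) \<in> (adj_rel E)\<^sup>*"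
proof -
  let ?c = "\<lambda>x y. (x, y) \<in> (adj_rel E)\<^sup>*"
  have 1: "(x, y) \<in> (insert (v, u) (adj_rel E))\<^sup>* \<longleftrightarrow> ?c x y \<or> ?c x v \<and> ?c u y" for x y
    by (simp add: rtrancl_insert)
  have "(x, y) \<in> (adj_rel (insert {u, v} E))\<^sup>* \<longleftrightarrow>
     (x, y) \<in> (insert (v, u) (adj_rel E))\<^sup>* \<or>
     (x, u) \<in> (insert (v, u) (adj_rel E))\<^sup>* \<and> (v, y) \<in> (insert (v, u) (adj_rel E))\<^sup>*"
    unfolding adj_rel_insert by (subst rtrancl_insert) simp
  also have "\<dots> \<longleftrightarrow> ?c x y \<or> ?c x u \<and> ?c v y \<or> ?c x v \<and> ?c u y"
    unfolding 1 by (meson rtrancl_trans conn_sym rtrancl.rtrancl_refl)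
  finally show ?thesis .
qed

lemma component_self: "v \<in> {1..n} \<Longrightarrow> v \<in> component n E v"
  by (simp add: component_def)

lemma component_eq: "(u, v) \<in> (adj_rel E)\<^sup>* \<Longrightarrow> component n E u = component n E v"
  unfolding component_def by (auto intro: rtrancl_trans conn_sym)

lemma component_eq_iff:
  "u \<in> {1..n} \<Longrightarrow> component n E u = component n E v \<longleftrightarrow> (u, v) \<in> (adj_rel E)\<^sup>*"
proof
  assume "u \<in> {1..n}" "component n E u = component n E v"
  then have "u \<in> component n E v" using component_self by blast
  then show "(u, v) \<in> (adj_rel E)\<^sup>*" using conn_sym unfolding component_def by blast
qed (rule component_eq)

lemma component_subset: "component n E v \<subseteq> {1..n}"
  by (auto simp: component_def)

lemma finite_component [simp]: "finite (component n E v)"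
  by (rule finite_subset[OF component_subset]) simp

lemma finite_graph_components [simp]: "finite (graph_components n E)"
  by (simp add: graph_components_eq)

lemma component_insert_conn:
  assumes "(u, v) \<in> (adj_rel E)\<^sup>*"
  shows "component n (insert {u, v} E) = component n E"
proof -
  have "(x, y) \<in> (adj_rel (insert {u, v} E))\<^sup>* \<longleftrightarrow> (x, y) \<in> (adj_rel E)\<^sup>*" for x y
    unfolding conn_insert using assms conn_sym rtrancl_trans by metis
  then show ?thesis unfolding component_def fun_eq_iff by simp
qed

lemma component_insert:
  assumes "w \<in> {1..n}"
  shows "component n (insert {u, v} E) w =
    (if w \<in> component n E u \<union> component n E v then component n E u \<union> component n E v else component n E w)"
proof -
  have mem: "w \<in> component n E x \<longleftrightarrow> (w, x) \<in> (adj_rel E)\<^sup>*" for x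
    using assms conn_sym unfolding component_def by blast
  show ?thesis
  proof (cases "w \<in> component n E u \<union> component n E v")
    case True
    then have w: "(w, u) \<in> (adj_rel E)\<^sup>* \<or> (w, v) \<in> (adj_rel E)\<^sup>*" unfolding Un_iff mem .
    have "(w, y) \<in> (adj_rel (insert {u, v} E))\<^sup>* \<longleftrightarrow> (u, y) \<in> (adj_rel E)\<^sup>* \<or> (v, y) \<in> (adj_rel E)\<^sup>*" for y
      unfolding conn_insert using w conn_sym rtrancl_trans by metis
    then show ?thesis using True by (auto simp: component_def)
  next
    case False
    then have w: "(w, u) \<notin> (adj_rel E)\<^sup>*" "(w, v) \<notin> (adj_rel E)\<^sup>*" unfolding Un_iff mem by blast+
    then have "(w, y) \<in> (adj_rel (insert {u, v} E))\<^sup>* \<longleftrightarrow> (w, y) \<in> (adj_rel E)\<^sup>*" for y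
      unfolding conn_insert by blast
    then have "component n (insert {u, v} E) w = component n E w" by (simp add: component_def)
    then show ?thesis using False by simp
  qed
qed

lemma graph_componentE:
  assumes "C \<in> graph_components n E"
  obtains w where "w \<in> {1..n}" "C = component n E w"
  using assms unfolding graph_components_eq by blast

lemma graph_components_insert:
  assumes uv: "u \<in> {1..n}" "v \<in> {1..n}"
  shows "graph_components n (insert {u, v} E) =
    insert (component n E u \<union> component n E v) (graph_components n E - {component n E u, component n E v})"
proof -
  let ?U = "component n E u \<union> component n E v"
  have out: "w \<in> ?U \<longleftrightarrow> component n E w = component n E u \<or> component n E w = component n E v" if "w \<in> {1..n}" for w
    using component_eq_iff[OF that] that conn_sym unfolding component_def by blast
  show ?thesis
  proof (intro set_eqI iffI)
    fix C assume "C \<in> graph_components n (insert {u, v} E)"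
    then obtain w where w: "w \<in> {1..n}" "C = component n (insert {u, v} E) w" by (rule graph_componentE)
    then show "C \<in> insert ?U (graph_components n E - {component n E u, component n E v})"
      using component_insert[OF w(1), of u v E] out[OF w(1)] by (auto simp: graph_components_eq)
  next
    fix C assume C: "C \<in> insert ?U (graph_components n E - {component n E u, component n E v})"
    show "C \<in> graph_components n (insert {u, v} E)"
    proof (cases "C = ?U")
      case True
      have "u \<in> ?U" using component_self[OF uv(1)] by blast
      then have "C = component n (insert {u, v} E) u" using component_insert[OF uv(1), of u v E] True by simp
      then show ?thesis using uv by (auto simp: graph_components_eq)
    next
      case False
      then have C': "C \<in> graph_components n E" "C \<noteq> component n E u" "C \<noteq> component n E v"
        using C by blast+
      obtain w where w: "w \<in> {1..n}" "C = component n E w" by (rule graph_componentE[OF C'(1)])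
      with C' have "C = component n (insert {u, v} E) w" using component_insert[OF w(1), of u v E] out[OF w(1)] by simp
      then show ?thesis using w by (auto simp: graph_components_eq)
    qed
  qed
qed

section \<open>The number of components, and acyclicity as a rank identity\<close>

definition ncomp :: "nat \<Rightarrow> nat set set \<Rightarrow> nat" where
  "ncomp n E = card (graph_components n E)"

lemma component_in: "v \<in> {1..n} \<Longrightarrow> component n E v \<in> graph_components n E"
  by (simp add: graph_components_eq)

lemma components_disjoint:
  assumes "C \<in> graph_components n E" "D \<in> graph_components n E" "C \<noteq> D"
  shows "C \<inter> D = {}"
proof (rule ccontr)
  assume "C \<inter> D \<noteq> {}"
  then obtain w where w: "w \<in> C" "w \<in> D" by blast
  obtain c where "C = component n E c" using assms(1) by (rule graph_componentE)
  moreover obtain d where "D = component n E d" using assms(2) by (rule graph_componentE)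
  ultimately have "C = component n E w" "D = component n E w" using w component_eq unfolding component_def by blast+
  then show False using assms by simp
qed

lemma Union_components: "\<Union> (graph_components n E) = {1..n}"
  using component_self component_subset unfolding graph_components_eq by blast

lemma component_nonempty: "C \<in> graph_components n E \<Longrightarrow> C \<noteq> {} \<and> finite C \<and> C \<subseteq> {1..n}"
  using component_self component_subset finite_component unfolding graph_components_eq by blast

lemma ncomp_insert_conn: "(u, v) \<in> (adj_rel E)\<^sup>* \<Longrightarrow> ncomp n (insert {u, v} E) = ncomp n E"
  by (simp add: ncomp_def graph_components_eq component_insert_conn)

lemma ncomp_insert:
  assumes uv: "u \<in> {1..n}" "v \<in> {1..n}" and nc: "(u, v) \<notin> (adj_rel E)\<^sup>*"
  shows "Suc (ncomp n (insert {u, v} E)) = ncomp n E"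
proof -
  let ?U = "component n E u" and ?V = "component n E v"
  have ne: "?U \<noteq> ?V" using component_eq_iff[OF uv(1)] nc by blast
  have inn: "?U \<in> graph_components n E" "?V \<in> graph_components n E" using uv component_in by blast+
  have dis: "?U \<inter> ?V = {}" by (rule components_disjoint[OF inn ne])
  have U0: "?U \<noteq> {}" "?V \<noteq> {}" using component_self uv by blast+
  have "?U \<union> ?V \<notin> graph_components n E"
  proof
    assume a: "?U \<union> ?V \<in> graph_components n E"
    have "?U \<union> ?V \<noteq> ?U" using dis U0 by blast
    from components_disjoint[OF a inn(1) this] show False using U0 by blast
  qed
  then have "card (graph_components n (insert {u, v} E)) = Suc (card (graph_components n E - {?U, ?V}))"
    unfolding graph_components_insert[OF uv] by simp
  also have "card (graph_components n E - {?U, ?V}) = card (graph_components n E) - 2"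
    using card_Diff_subset[of "{?U, ?V}" "graph_components n E"] inn ne by simp
  also have "card (graph_components n E) \<ge> card {?U, ?V}" by (rule card_mono) (use inn in auto)
  then have "card (graph_components n E) \<ge> 2" using ne by simp
  ultimately show ?thesis by (simp add: ncomp_def)
qed

lemma complete_edgeE:
  assumes "e \<in> complete_graph_edges n"
  obtains u v where "e = {u, v}" "u \<noteq> v" "u \<in> {1..n}" "v \<in> {1..n}"
proof -
  have e: "e \<subseteq> {1..n}" "card e = 2" using assms by (auto simp: complete_graph_edges_def)
  obtain u v where "e = {u, v}" "u \<noteq> v" using e(2) by (meson card_2_iff)
  then show ?thesis using that e(1) by simp
qed

lemma complete_edgeI: "u \<noteq> v \<Longrightarrow> u \<in> {1..n} \<Longrightarrow> v \<in> {1..n} \<Longrightarrow> {u, v} \<in> complete_graph_edges n"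
  by (simp add: complete_graph_edges_def)

lemma finite_complete [simp]: "finite (complete_graph_edges n)"
  by (rule finite_subset[of _ "Pow {1..n}"]) (auto simp: complete_graph_edges_def)

lemma finite_edges: "E \<subseteq> complete_graph_edges n \<Longrightarrow> finite E"
  using finite_complete finite_subset by blast

lemma conn_empty: "(u, v) \<in> (adj_rel {})\<^sup>* \<longleftrightarrow> u = v"
  by (simp add: adj_rel_def)

lemma ncomp_empty: "ncomp n {} = n"
proof -
  have "component n {} v = {v}" if "v \<in> {1..n}" for v
    using that by (auto simp: component_def conn_empty)
  then have "graph_components n {} = (\<lambda>v. {v}) ` {1..n}"
    unfolding graph_components_eq by (rule image_cong[OF refl])
  then show ?thesis by (simp add: ncomp_def card_image)
qed

lemma ncomp_lower: "E \<subseteq> complete_graph_edges n \<Longrightarrow> n \<le> ncomp n E + card E"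
proof -
  assume "E \<subseteq> complete_graph_edges n"
  then have "finite E" by (rule finite_edges)
  then show ?thesis using \<open>E \<subseteq> complete_graph_edges n\<close>
  proof (induction E rule: finite_induct)
    case empty
    then show ?case by (simp add: ncomp_empty)
  next
    case (insert e E)
    obtain u v where e: "e = {u, v}" "u \<noteq> v" "u \<in> {1..n}" "v \<in> {1..n}"
      by (rule complete_edgeE[of e n]) (use insert in auto)
    have IH: "n \<le> ncomp n E + card E" using insert by simp
    have "ncomp n E \<le> Suc (ncomp n (insert e E))"
      using ncomp_insert[OF e(3,4), of E] ncomp_insert_conn[of u v E n] e(1) by (cases "(u, v) \<in> (adj_rel E)\<^sup>*") auto
    then show ?case using IH insert(1,2) by simp
  qed
qed

text \<open>The link between two views of acyclicity: cycles as lists of vertices on one side, the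
  identity relating edges and components on the other.\<close>

definition bridges :: "nat set set \<Rightarrow> bool" where
  "bridges E \<longleftrightarrow> (\<forall>u v. {u, v} \<in> E \<longrightarrow> u \<noteq> v \<longrightarrow> (u, v) \<notin> (adj_rel (E - {{u, v}}))\<^sup>*)"

lemma bridges_mono: "bridges E \<Longrightarrow> E' \<subseteq> E \<Longrightarrow> bridges E'"
  unfolding bridges_def using conn_mono[of "E' - {{_, _}}" "E - {{_, _}}"] by (meson Diff_mono order_refl subsetD)

lemma bridges_imp_rank:
  assumes "E \<subseteq> complete_graph_edges n" "bridges E"
  shows "ncomp n E + card E = n"
  using finite_edges[OF assms(1)] assms
proof (induction E rule: finite_induct)
  case empty
  then show ?case by (simp add: ncomp_empty)
next
  case (insert e E)
  obtain u v where e: "e = {u, v}" "u \<noteq> v" "u \<in> {1..n}" "v \<in> {1..n}"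
    by (rule complete_edgeE[of e n]) (use insert in auto)
  have "bridges E" using bridges_mono[OF insert.prems(2)] by blast
  then have IH: "ncomp n E + card E = n" using insert by simp
  have "insert e E - {{u, v}} = E" using e insert.hyps by auto
  then have "(u, v) \<notin> (adj_rel E)\<^sup>*" using insert.prems(2) e unfolding bridges_def by (metis insertI1)
  from ncomp_insert[OF e(3,4) this] show ?case using IH insert.hyps e by simp
qed

text \<open>Dropping an edge whose ends remain connected would keep the number of components and
  contradict \<open>ncomp_lower\<close>.\<close>

lemma rank_imp_bridges:
  assumes E: "E \<subseteq> complete_graph_edges n" and r: "ncomp n E + card E = n"
  shows "bridges E"
  unfolding bridges_def
proof (intro allI impI notI)
  fix u v assume uv: "{u, v} \<in> E" "u \<noteq> v" "(u, v) \<in> (adj_rel (E - {{u, v}}))\<^sup>*"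
  have "n \<le> ncomp n (E - {{u, v}}) + card (E - {{u, v}})" using E by (intro ncomp_lower) auto
  moreover have "ncomp n (insert {u, v} (E - {{u, v}})) = ncomp n (E - {{u, v}})" by (rule ncomp_insert_conn[OF uv(3)])
  moreover have "insert {u, v} (E - {{u, v}}) = E" using uv by blast
  moreover have "Suc (card (E - {{u, v}})) = card E" using finite_edges[OF E] uv(1) by (rule card_Suc_Diff1)
  ultimately show False using r by simp
qed

text \<open>When the last step returns to a vertex already on the list, the list is cut there
  instead of being extended.\<close>

lemma path_list:
  assumes "(u, v) \<in> r\<^sup>*"
  shows "\<exists>xs. xs \<noteq> [] \<and> hd xs = u \<and> last xs = v \<and> distinct xs \<and> (\<forall>i. Suc i < length xs \<longrightarrow> (xs ! i, xs ! Suc i) \<in> r)"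
  using assms
proof (induction rule: rtrancl_induct)
  case base
  show ?case by (rule exI[of _ "[u]"]) simp
next
  case (step y z)
  then obtain xs where xs: "xs \<noteq> []" "hd xs = u" "last xs = y" "distinct xs"
    "\<And>i. Suc i < length xs \<Longrightarrow> (xs ! i, xs ! Suc i) \<in> r" by blast
  show ?case
  proof (cases "z \<in> set xs")
    case True
    then obtain k where k: "k < length xs" "xs ! k = z" by (auto simp: in_set_conv_nth)
    show ?thesis
    proof (intro exI conjI allI impI)
      show "take (Suc k) xs \<noteq> []" using xs by simp
      show "hd (take (Suc k) xs) = u" using xs by (simp add: hd_take)
      show "last (take (Suc k) xs) = z" using k by (simp add: take_Suc_conv_app_nth)
      show "distinct (take (Suc k) xs)" using xs by simp
      fix i assume "Suc i < length (take (Suc k) xs)"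
      then show "(take (Suc k) xs ! i, take (Suc k) xs ! Suc i) \<in> r" using xs(5)[of i] by simp
    qed
  next
    case False
    show ?thesis
    proof (intro exI conjI allI impI)
      show "xs @ [z] \<noteq> []" "hd (xs @ [z]) = u" "last (xs @ [z]) = z" "distinct (xs @ [z])" using xs False by simp_all
      fix i assume i: "Suc i < length (xs @ [z])"
      show "((xs @ [z]) ! i, (xs @ [z]) ! Suc i) \<in> r"
      proof (cases "Suc i < length xs")
        case True
        then show ?thesis using xs(5)[of i] by (simp add: nth_append)
      next
        case False
        then have "Suc i = length xs" using i by simp
        then have "xs ! i = y" using xs(1,3) by (simp add: last_conv_nth flip: \<open>Suc i = length xs\<close>)
        then show ?thesis using step(2) \<open>Suc i = length xs\<close> by (simp add: nth_append)
      qed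
    qed
  qed
qed

text \<open>A simple path that joins the ends of an edge without using it closes up to a cycle; it
  has a third vertex, since with two it would be the edge itself. Conversely, the rest of a cycle
  joins the ends of its closing edge.\<close>

lemma no_cycle_iff_bridges: "(\<nexists>vs. graph_cycle E vs) \<longleftrightarrow> bridges E"
proof
  assume no: "\<nexists>vs. graph_cycle E vs"
  show "bridges E"
    unfolding bridges_def
  proof (intro allI impI notI)
    fix u v assume uv: "{u, v} \<in> E" "u \<noteq> v" "(u, v) \<in> (adj_rel (E - {{u, v}}))\<^sup>*"
    obtain xs where xs: "xs \<noteq> []" "hd xs = u" "last xs = v" "distinct xs"
      "\<And>i. Suc i < length xs \<Longrightarrow> (xs ! i, xs ! Suc i) \<in> adj_rel (E - {{u, v}})"
      using path_list[OF uv(3)] by blast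
    have h: "xs ! 0 = u" "xs ! (length xs - 1) = v" using xs by (simp_all add: hd_conv_nth last_conv_nth)
    have len: "3 \<le> length xs"
    proof (rule ccontr)
      assume "\<not> 3 \<le> length xs"
      moreover have "0 < length xs" using xs(1) by simp
      ultimately have "length xs = 1 \<or> length xs = 2" by linarith
      then show False
      proof
        assume "length xs = 1"
        then show False using h uv(2) by simp
      next
        assume "length xs = 2"
        then have "(u, v) \<in> adj_rel (E - {{u, v}})" using xs(5)[of 0] h by (simp add: numeral_2_eq_2)
        then show False by (simp add: adj_rel_def)
      qed
    qed
    have "graph_cycle E xs"
      unfolding graph_cycle_def
    proof (intro conjI allI impI)
      fix i assume i: "i < length xs"
      show "{xs ! i, xs ! (Suc i mod length xs)} \<in> E"
      proof (cases "Suc i < length xs")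
        case True
        then show ?thesis using xs(5)[OF True] by (simp add: adj_rel_def)
      next
        case False
        then have "i = length xs - 1" "Suc i = length xs" using i by simp_all
        then show ?thesis using h uv(1) by (simp add: insert_commute)
      qed
    qed (use len xs in auto)
    then show False using no by blast
  qed
next
  assume br: "bridges E"
  show "\<nexists>vs. graph_cycle E vs"
  proof
    assume "\<exists>vs. graph_cycle E vs"
    then obtain vs where vs: "3 \<le> length vs" "distinct vs"
      "\<And>i. i < length vs \<Longrightarrow> {vs ! i, vs ! (Suc i mod length vs)} \<in> E"
      unfolding graph_cycle_def by blast
    define m where "m = length vs"
    let ?e = "{vs ! 0, vs ! (m - 1)}"
    have m3: "3 \<le> m" using vs(1) by (simp add: m_def)
    have "Suc (m - 1) = m" using m3 by simp
    then have eE: "?e \<in> E" using vs(3)[of "m - 1"] m3 by (simp add: insert_commute flip: m_def)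
    have inj: "vs ! i = vs ! j \<longleftrightarrow> i = j" if "i < m" "j < m" for i j
      using that vs(2) by (simp add: m_def nth_eq_iff_index_eq)
    have ne: "vs ! 0 \<noteq> vs ! (m - 1)" using inj[of 0 "m - 1"] m3 by simp
    have "i < m \<Longrightarrow> (vs ! 0, vs ! i) \<in> (adj_rel (E - {?e}))\<^sup>*" for i
    proof (induction i)
      case (Suc i)
      have "{vs ! i, vs ! Suc i} \<in> E" using vs(3)[of i] Suc.prems by (simp add: m_def)
      moreover have "{vs ! i, vs ! Suc i} \<noteq> ?e"
      proof
        assume "{vs ! i, vs ! Suc i} = ?e"
        then have "vs ! i = vs ! 0 \<and> vs ! Suc i = vs ! (m - 1) \<or> vs ! i = vs ! (m - 1) \<and> vs ! Suc i = vs ! 0"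
          by (simp add: doubleton_eq_iff)
        moreover have l: "i < m" "Suc i < m" "0 < m" "m - 1 < m" using Suc.prems m3 by simp_all
        ultimately show False
          unfolding inj[OF l(1,3)] inj[OF l(2,4)] inj[OF l(1,4)] inj[OF l(2,3)] using m3 l by linarith
      qed
      ultimately have "(vs ! i, vs ! Suc i) \<in> adj_rel (E - {?e})" by (simp add: adj_rel_def)
      then show ?case using Suc by (meson Suc_lessD rtrancl.rtrancl_into_rtrancl)
    qed simp
    then have "(vs ! 0, vs ! (m - 1)) \<in> (adj_rel (E - {?e}))\<^sup>*" using m3 by simp
    then show False using br eE ne unfolding bridges_def by blast
  qed
qed

lemma forest_iff_rank: "forest_on n E \<longleftrightarrow> E \<subseteq> complete_graph_edges n \<and> ncomp n E + card E = n"
  unfolding forest_on_def no_cycle_iff_bridges using bridges_imp_rank rank_imp_bridges by blast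

lemma forest_subset: "forest_on n E \<Longrightarrow> E' \<subseteq> E \<Longrightarrow> forest_on n E'"
  unfolding forest_on_def no_cycle_iff_bridges using bridges_mono by blast

lemma forest_insert:
  assumes "forest_on n F" "u \<in> {1..n}" "v \<in> {1..n}" "(u, v) \<notin> (adj_rel F)\<^sup>*"
  shows "forest_on n (insert {u, v} F)" "{u, v} \<notin> F"
proof -
  have F: "F \<subseteq> complete_graph_edges n" "ncomp n F + card F = n" using assms(1) by (auto simp: forest_iff_rank)
  show nin: "{u, v} \<notin> F" using conn_edge assms(4) by blast
  have "u \<noteq> v" using assms(4) by blast
  then have "{u, v} \<in> complete_graph_edges n" using assms complete_edgeI by blast
  moreover have "ncomp n (insert {u, v} F) + card (insert {u, v} F) = n"
    using ncomp_insert[OF assms(2-4)] F nin finite_edges[OF F(1)] by simp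
  ultimately show "forest_on n (insert {u, v} F)" using F by (simp add: forest_iff_rank)
qed

lemma forest_edge_not_conn:
  assumes "forest_on n F" "{u, v} \<in> F" "u \<noteq> v"
  shows "(u, v) \<notin> (adj_rel (F - {{u, v}}))\<^sup>*"
  using assms unfolding forest_on_def no_cycle_iff_bridges bridges_def by blast

lemma connected_iff_ncomp:
  assumes "n \<ge> 1" shows "connected_graph_on n E \<longleftrightarrow> ncomp n E = 1"
proof
  assume c: "connected_graph_on n E"
  have "component n E v = {1..n}" if "v \<in> {1..n}" for v
    using c that unfolding connected_graph_on_def component_def by blast
  then have "graph_components n E = (\<lambda>_. {1..n}) ` {1..n}"
    unfolding graph_components_eq by (rule image_cong[OF refl])
  also have "\<dots> = {{1..n}}" using assms by (simp add: image_constant_conv)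
  finally show "ncomp n E = 1" by (simp add: ncomp_def)
next
  assume "ncomp n E = 1"
  then obtain C where C: "graph_components n E = {C}" unfolding ncomp_def by (meson card_1_singletonE)
  show "connected_graph_on n E"
    unfolding connected_graph_on_def
  proof (intro ballI)
    fix u v assume uv: "u \<in> {1..n}" "v \<in> {1..n}"
    have "component n E u = component n E v"
      using component_in[OF uv(1), of E] component_in[OF uv(2), of E] C by simp
    then show "(u, v) \<in> (adj_rel E)\<^sup>*" unfolding component_eq_iff[OF uv(1)] .
  qed
qed

lemma spanning_tree_iff:
  assumes "n \<ge> 1"
  shows "T \<in> spanning_trees n \<longleftrightarrow> forest_on n T \<and> card T + 1 = n"
  using forest_iff_rank[of n T] connected_iff_ncomp[OF assms, of T] unfolding spanning_trees_def by auto

section \<open>Counting spanning trees\<close>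

definition trees_above :: "nat \<Rightarrow> nat set set \<Rightarrow> nat set set set" where
  "trees_above n F = {T \<in> spanning_trees n. F \<subseteq> T}"

definition comp_prod :: "nat \<Rightarrow> nat set set \<Rightarrow> nat" where
  "comp_prod n F = (\<Prod>C\<in>graph_components n F. card C)"

lemma spanning_tree_edges: "T \<in> spanning_trees n \<Longrightarrow> T \<subseteq> complete_graph_edges n"
  by (simp add: spanning_trees_def forest_on_def)

lemma finite_spanning_trees [simp]: "finite (spanning_trees n)"
  by (rule finite_subset[of _ "Pow (complete_graph_edges n)"]) (auto dest: spanning_tree_edges)

lemma finite_trees_above [simp]: "finite (trees_above n F)"
  by (simp add: trees_above_def)

lemma tree_forest: "T \<in> spanning_trees n \<Longrightarrow> forest_on n T"
  by (simp add: spanning_trees_def)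

lemma card_tree: "n \<ge> 1 \<Longrightarrow> T \<in> spanning_trees n \<Longrightarrow> card T = n - 1"
  using spanning_tree_iff[of n T] by linarith

lemma trees_above_nonforest: "\<not> forest_on n F \<Longrightarrow> trees_above n F = {}"
  unfolding trees_above_def using forest_subset tree_forest by blast

lemma not_conn_in_tree:
  assumes "forest_on n (insert {u, v} F)" "{u, v} \<notin> F" "u \<noteq> v"
  shows "(u, v) \<notin> (adj_rel F)\<^sup>*"
  using forest_edge_not_conn[OF assms(1) _ assms(3)] assms(2) by simp

lemma sum_inverse_component_size:
  "(\<Sum>u\<in>{1..n}. 1 / real (card (component n F u))) = real (ncomp n F)"
proof -
  have "(\<Sum>u\<in>\<Union>(graph_components n F). 1 / real (card (component n F u)))
      = (\<Sum>C\<in>graph_components n F. \<Sum>u\<in>C. 1 / real (card (component n F u)))"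
    using component_nonempty components_disjoint by (subst sum.Union_disjoint) auto
  also have "\<dots> = (\<Sum>C\<in>graph_components n F. 1)"
  proof (rule sum.cong[OF refl])
    fix C assume C: "C \<in> graph_components n F"
    obtain w where w: "w \<in> {1..n}" "C = component n F w" by (rule graph_componentE[OF C])
    have "component n F u = C" if "u \<in> C" for u
      using that component_eq[of w u F n] unfolding w(2) by (simp add: component_def)
    then have "(\<Sum>u\<in>C. 1 / real (card (component n F u))) = (\<Sum>u\<in>C. 1 / real (card C))"
      by (intro sum.cong) auto
    also have "\<dots> = 1" using component_nonempty[OF C] by simp
    finally show "(\<Sum>u\<in>C. 1 / real (card (component n F u))) = 1" .
  qed
  finally show ?thesis unfolding Union_components by (simp add: ncomp_def)
qed

text \<open>Merging components of sizes \<open>a\<close> and \<open>b\<close> replaces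
  \<open>a * b\<close> by \<open>a + b\<close>. Written with reciprocals, a sum over all joining
  edges separates into sums over single vertices.\<close>

lemma comp_prod_insert:
  assumes uv: "u \<in> {1..n}" "v \<in> {1..n}" and nc: "(u, v) \<notin> (adj_rel F)\<^sup>*"
  shows "real (comp_prod n (insert {u, v} F)) =
    real (comp_prod n F) * (1 / real (card (component n F u)) + 1 / real (card (component n F v)))"
proof -
  let ?U = "component n F u" and ?V = "component n F v" and ?G = "graph_components n F"
  have ne: "?U \<noteq> ?V" using component_eq_iff[OF uv(1)] nc by blast
  have inn: "?U \<in> ?G" "?V \<in> ?G" using uv component_in by blast+
  have dis: "?U \<inter> ?V = {}" by (rule components_disjoint[OF inn ne])
  have U0: "?U \<noteq> {}" "?V \<noteq> {}" using component_self uv by blast+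
  have nin: "?U \<union> ?V \<notin> ?G"
  proof
    assume a: "?U \<union> ?V \<in> ?G"
    have "?U \<union> ?V \<noteq> ?U" using dis U0 by blast
    from components_disjoint[OF a inn(1) this] show False using U0 by blast
  qed
  define r where "r = (\<Prod>C\<in>?G - {?U, ?V}. card C)"
  have "comp_prod n (insert {u, v} F) = card (?U \<union> ?V) * r"
    unfolding comp_prod_def graph_components_insert[OF uv] r_def
    by (subst prod.insert) (use nin in auto)
  also have "card (?U \<union> ?V) = card ?U + card ?V" using dis by (intro card_Un_disjoint) auto
  finally have 1: "real (comp_prod n (insert {u, v} F)) = (real (card ?U) + real (card ?V)) * real r" by simp
  have "?G = insert ?U (insert ?V (?G - {?U, ?V}))" using inn by blast
  then have "comp_prod n F = (\<Prod>C\<in>insert ?U (insert ?V (?G - {?U, ?V})). card C)"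
    unfolding comp_prod_def by (rule arg_cong)
  also have "\<dots> = card ?U * (card ?V * r)" using ne by (simp add: r_def)
  finally have 2: "real (comp_prod n F) = real (card ?U) * real (card ?V) * real r" by simp
  show ?thesis unfolding 1 2 using U0 by (simp add: field_simps)
qed

lemma sum_pairs_eq:
  fixes g :: "nat set \<Rightarrow> real"
  assumes "finite W" "\<And>u v. (u, v) \<in> W \<Longrightarrow> (v, u) \<in> W \<and> u \<noteq> v"
  shows "(\<Sum>(u, v)\<in>W. g {u, v}) = 2 * (\<Sum>e\<in>(\<lambda>(u, v). {u, v}) ` W. g e)"
proof -
  let ?f = "\<lambda>(u, v). {u, v}"
  have "(\<Sum>(u, v)\<in>W. g {u, v}) = (\<Sum>p\<in>W. g (?f p))" by (rule sum.cong) auto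
  also have "\<dots> = (\<Sum>e\<in>?f ` W. \<Sum>p\<in>{p \<in> W. ?f p = e}. g (?f p))"
    using sum.image_gen[OF assms(1), of "\<lambda>p. g (?f p)" ?f] by simp
  also have "\<dots> = (\<Sum>e\<in>?f ` W. 2 * g e)"
  proof (rule sum.cong[OF refl])
    fix e assume "e \<in> ?f ` W"
    then obtain u v where uv: "(u, v) \<in> W" "e = {u, v}" by auto
    have "{p \<in> W. ?f p = e} = {(u, v), (v, u)}"
      using uv assms(2)[OF uv(1)] by (auto simp: doubleton_eq_iff)
    moreover have "(\<Sum>p\<in>{(u, v), (v, u)}. g (?f p)) = 2 * g e"
      using assms(2)[OF uv(1)] uv(2) by (simp add: insert_commute)
    ultimately show "(\<Sum>p\<in>{p \<in> W. ?f p = e}. g (?f p)) = 2 * g e" by simp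
  qed
  finally show ?thesis by (simp add: sum_distrib_left)
qed

text \<open>Induction on the number \<open>k\<close> of components, double counting the pairs of a
  tree above \<open>F\<close> and one of its \<open>k - 1\<close> edges outside \<open>F\<close>.
  Over ordered pairs of vertices in different components, the reciprocals \<open>1 / c u\<close> add
  up to \<open>n * k - n\<close>, which reproduces the factor \<open>k - 1\<close>. The factor
  \<open>n ^ 2\<close> on the left avoids the exponent \<open>k - 2\<close>.\<close>

lemma card_trees_above:
  assumes n: "n \<ge> 1" and F: "forest_on n F"
  shows "real (card (trees_above n F)) * real n ^ 2 = real n ^ ncomp n F * real (comp_prod n F)"
  using F
proof (induction "ncomp n F" arbitrary: F rule: less_induct)
  case less
  have F: "F \<subseteq> complete_graph_edges n" "ncomp n F + card F = n" using less.prems by (simp_all add: forest_iff_rank)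
  have finF: "finite F" using finite_edges[OF F(1)] .
  define k where "k = ncomp n F"
  have k1: "k \<ge> 1"
  proof -
    have "component n F 1 \<in> graph_components n F" using n by (intro component_in) simp
    then have "card (graph_components n F) > 0" by (auto simp: card_gt_0_iff)
    then show ?thesis by (simp add: k_def ncomp_def)
  qed
  show ?case
  proof (cases "k = 1")
    case True
    then have k: "ncomp n F = 1" by (simp add: k_def)
    then have FT: "F \<in> spanning_trees n" using spanning_tree_iff[OF n] less.prems F(2) by simp
    have "trees_above n F = {F}"
    proof (intro set_eqI iffI)
      fix T assume "T \<in> trees_above n F"
      then have T: "T \<in> spanning_trees n" "F \<subseteq> T" by (simp_all add: trees_above_def)
      then have "card T = card F" using card_tree[OF n] FT by simp
      then have "F = T" using T(2) finite_edges[OF spanning_tree_edges[OF T(1)]] by (metis card_subset_eq)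
      then show "T \<in> {F}" by simp
    qed (use FT in \<open>simp add: trees_above_def\<close>)
    moreover obtain C where C: "graph_components n F = {C}"
      using k unfolding ncomp_def by (meson card_1_singletonE)
    then have "C = {1..n}" using Union_components[of n F] by simp
    then have "comp_prod n F = n" using C by (simp add: comp_prod_def)
    ultimately show ?thesis using k by (simp add: power2_eq_square)
  next
    case False
    then have k2: "k \<ge> 2" using k1 by simp
    define V where "V = {1..n}"
    define c where "c u = card (component n F u)" for u
    define W where "W = (SIGMA u : V. V - component n F u)"
    have W: "(u, v) \<in> W \<longleftrightarrow> u \<in> V \<and> v \<in> V \<and> (u, v) \<notin> (adj_rel F)\<^sup>*" for u v
      by (auto simp: W_def V_def component_def)
    have finW: "finite W" by (simp add: W_def V_def)
    have Wsym: "(v, u) \<in> W \<and> u \<noteq> v" if "(u, v) \<in> W" for u v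
      using that conn_sym unfolding W by blast
    define N where "N e = real (card {T \<in> trees_above n F. e \<in> T})" for e
    have "(\<Sum>T\<in>trees_above n F. real (card (T - F))) = (\<Sum>T\<in>trees_above n F. \<Sum>e\<in>complete_graph_edges n - F. if e \<in> T then 1 else 0)"
    proof (rule sum.cong[OF refl])
      fix T assume "T \<in> trees_above n F"
      then have "T \<subseteq> complete_graph_edges n" using spanning_tree_edges by (auto simp: trees_above_def)
      then have "T - F = {e \<in> complete_graph_edges n - F. e \<in> T}" by blast
      then show "real (card (T - F)) = (\<Sum>e\<in>complete_graph_edges n - F. if e \<in> T then 1 else 0)"
        by (simp add: sum.If_cases Int_def)
    qed
    also have "\<dots> = (\<Sum>e\<in>complete_graph_edges n - F. \<Sum>T\<in>trees_above n F. if e \<in> T then 1 else 0)"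
      by (rule sum.swap)
    also have "\<dots> = (\<Sum>e\<in>complete_graph_edges n - F. N e)"
      by (rule sum.cong[OF refl]) (simp add: N_def sum.If_cases Int_def)
    also have "\<dots> = (\<Sum>e\<in>(\<lambda>(u, v). {u, v}) ` W. N e)"
    proof (rule sum.mono_neutral_right)
      show "(\<lambda>(u, v). {u, v}) ` W \<subseteq> complete_graph_edges n - F"
      proof
        fix e assume "e \<in> (\<lambda>(u, v). {u, v}) ` W"
        then obtain u v where uv: "e = {u, v}" "(u, v) \<in> W" by auto
        then have "u \<noteq> v" "u \<in> {1..n}" "v \<in> {1..n}" "(u, v) \<notin> (adj_rel F)\<^sup>*"
          using Wsym[OF uv(2)] W[of u v] by (auto simp: V_def)
        then show "e \<in> complete_graph_edges n - F" using complete_edgeI conn_edge uv(1) by blast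
      qed
      show "\<forall>e\<in>complete_graph_edges n - F - (\<lambda>(u, v). {u, v}) ` W. N e = 0"
      proof
        fix e assume e: "e \<in> complete_graph_edges n - F - (\<lambda>(u, v). {u, v}) ` W"
        obtain u v where uv: "e = {u, v}" "u \<noteq> v" "u \<in> {1..n}" "v \<in> {1..n}"
          by (rule complete_edgeE[of e n]) (use e in blast)
        have "(u, v) \<notin> W"
        proof
          assume "(u, v) \<in> W"
          then have "e \<in> (\<lambda>(u, v). {u, v}) ` W" using uv(1) by (intro image_eqI[of _ _ "(u, v)"]) auto
          then show False using e by blast
        qed
        then have conn: "(u, v) \<in> (adj_rel F)\<^sup>*" using uv W by (simp add: V_def)
        have "e \<notin> T" if "T \<in> trees_above n F" for T
        proof
          assume "e \<in> T"
          have T: "forest_on n T" "F \<subseteq> T" using that tree_forest by (auto simp: trees_above_def)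
          have "forest_on n (insert {u, v} F)" by (rule forest_subset[OF T(1)]) (use T(2) \<open>e \<in> T\<close> uv(1) in blast)
          then show False using not_conn_in_tree[of n u v F] e uv conn by blast
        qed
        then have "{T \<in> trees_above n F. e \<in> T} = {}" by blast
        then show "N e = 0" unfolding N_def by (simp only: card.empty of_nat_0)
      qed
    qed simp
    finally have s1: "(\<Sum>T\<in>trees_above n F. real (card (T - F))) = (\<Sum>e\<in>(\<lambda>(u, v). {u, v}) ` W. N e)" .
    have "real (card (T - F)) = real (k - 1)" if "T \<in> trees_above n F" for T
    proof -
      have T: "T \<in> spanning_trees n" "F \<subseteq> T" using that by (simp_all add: trees_above_def)
      have "card (T - F) = card T - card F" using T finF by (intro card_Diff_subset) auto
      then show ?thesis using card_tree[OF n T(1)] F(2) by (simp add: k_def)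
    qed
    then have s2: "(\<Sum>T\<in>trees_above n F. real (card (T - F))) = real (card (trees_above n F)) * real (k - 1)" by simp
    have s3: "(\<Sum>(u, v)\<in>W. N {u, v}) = 2 * (\<Sum>e\<in>(\<lambda>(u, v). {u, v}) ` W. N e)"
      by (rule sum_pairs_eq[OF finW Wsym])
    have s4: "N {u, v} * real n ^ 2 = real n ^ (k - 1) * (real (comp_prod n F) * (1 / c u + 1 / c v))" if uv: "(u, v) \<in> W" for u v
    proof -
      have uv': "u \<in> {1..n}" "v \<in> {1..n}" "(u, v) \<notin> (adj_rel F)\<^sup>*" using uv W by (simp_all add: V_def)
      have nc: "Suc (ncomp n (insert {u, v} F)) = k" using ncomp_insert[OF uv'] by (simp add: k_def)
      have "{T \<in> trees_above n F. {u, v} \<in> T} = trees_above n (insert {u, v} F)"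
        unfolding trees_above_def by blast
      then have "N {u, v} * real n ^ 2 = real (card (trees_above n (insert {u, v} F))) * real n ^ 2"
        by (simp add: N_def)
      also have "\<dots> = real n ^ ncomp n (insert {u, v} F) * real (comp_prod n (insert {u, v} F))"
        by (rule less.hyps) (use nc forest_insert(1)[OF less.prems uv'] in \<open>simp_all add: k_def\<close>)
      also have "ncomp n (insert {u, v} F) = k - 1" using nc by simp
      also have "real (comp_prod n (insert {u, v} F)) = real (comp_prod n F) * (1 / c u + 1 / c v)"
        unfolding c_def by (rule comp_prod_insert[OF uv'])
      finally show ?thesis .
    qed
    have "(\<Sum>(u, v)\<in>W. N {u, v}) * real n ^ 2 = (\<Sum>(u, v)\<in>W. N {u, v} * real n ^ 2)"
      by (simp add: sum_distrib_right case_prod_unfold)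
    also have "\<dots> = (\<Sum>(u, v)\<in>W. real n ^ (k - 1) * (real (comp_prod n F) * (1 / c u + 1 / c v)))"
      by (rule sum.cong[OF refl]) (use s4 in \<open>simp add: case_prod_unfold\<close>)
    also have "\<dots> = real n ^ (k - 1) * real (comp_prod n F) * (\<Sum>(u, v)\<in>W. 1 / c u + 1 / c v)"
      by (simp add: sum_distrib_left case_prod_unfold mult.assoc)
    also have "(\<Sum>(u, v)\<in>W. 1 / c u + 1 / c v) = (\<Sum>(u, v)\<in>W. 1 / c u) + (\<Sum>(u, v)\<in>W. 1 / c v)"
      by (simp add: sum.distrib case_prod_unfold)
    also have "(\<Sum>(u, v)\<in>W. 1 / c v) = (\<Sum>(u, v)\<in>W. 1 / c u)"
      by (rule sum.reindex_bij_witness[of _ prod.swap prod.swap]) (use Wsym in auto)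
    also have "(\<Sum>(u, v)\<in>W. 1 / c u) = (\<Sum>u\<in>V. \<Sum>v\<in>V - component n F u. 1 / c u)"
      unfolding W_def by (subst sum.Sigma) (simp_all add: V_def)
    also have "\<dots> = (\<Sum>u\<in>V. real n * (1 / c u) - 1)"
    proof (rule sum.cong[OF refl])
      fix u assume u: "u \<in> V"
      have "c u > 0" using component_self[of u n F] u by (auto simp: c_def V_def card_gt_0_iff)
      moreover have "c u \<le> n" using card_mono[OF _ component_subset[of n F u]] by (simp add: c_def)
      moreover have "card (V - component n F u) = n - c u"
        using component_subset[of n F u] by (simp add: card_Diff_subset V_def c_def)
      ultimately show "(\<Sum>v\<in>V - component n F u. 1 / c u) = real n * (1 / c u) - 1"
        by (simp add: of_nat_diff field_simps)
    qed
    also have "\<dots> = real n * (\<Sum>u\<in>V. 1 / c u) - real n"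
      by (simp add: sum_subtractf sum_distrib_left V_def)
    also have "(\<Sum>u\<in>V. 1 / c u) = real k"
      using sum_inverse_component_size[of n F] by (simp add: V_def c_def k_def)
    finally have "2 * (real (card (trees_above n F)) * real (k - 1)) * real n ^ 2
        = real n ^ (k - 1) * real (comp_prod n F) * (2 * real n * real (k - 1))"
      using s1 s2 s3 k1 by (simp add: of_nat_diff algebra_simps)
    then have "(2 * real (k - 1)) * (real (card (trees_above n F)) * real n ^ 2)
        = (2 * real (k - 1)) * (real n ^ Suc (k - 1) * real (comp_prod n F))"
      by (simp add: mult_ac)
    moreover have "2 * real (k - 1) \<noteq> 0" using k2 by simp
    ultimately have "real (card (trees_above n F)) * real n ^ 2 = real n ^ Suc (k - 1) * real (comp_prod n F)"
      by (simp only: mult_cancel_left simp_thms)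
    moreover have "Suc (k - 1) = ncomp n F" using k1 by (simp add: k_def)
    ultimately show ?thesis by (simp only:)
  qed
qed

section \<open>Products of positive integers with a given sum\<close>

definition parts :: "nat \<Rightarrow> nat \<Rightarrow> nat list set" where
  "parts n k = {xs. length xs = k \<and> (\<forall>x\<in>set xs. 0 < x) \<and> sum_list xs = n}"

lemma partsD:
  assumes "xs \<in> parts n k"
  shows "length xs = k" "\<And>x. x \<in> set xs \<Longrightarrow> 0 < x" "sum_list xs = n"
  using assms by (auto simp: parts_def)

lemma partsI: "length xs = k \<Longrightarrow> (\<And>x. x \<in> set xs \<Longrightarrow> 0 < x) \<Longrightarrow> sum_list xs = n \<Longrightarrow> xs \<in> parts n k"
  by (auto simp: parts_def)

lemma max_prod_eq: "max_prod n t = Max (prod_list ` parts n (n - t))"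
proof -
  have "{prod_list xs | xs. length xs = n - t \<and> (\<forall>x\<in>set xs. 0 < x) \<and> sum_list xs = n} = prod_list ` parts n (n - t)"
    unfolding parts_def by blast
  then show ?thesis unfolding max_prod_def by (rule arg_cong)
qed

lemma finite_parts: "finite (parts n k)"
proof (rule finite_subset)
  show "parts n k \<subseteq> {xs. set xs \<subseteq> {..n} \<and> length xs = k}"
    unfolding parts_def using member_le_sum_list by fastforce
qed (rule finite_lists_length_eq, simp)

lemma parts_nonempty: "1 \<le> k \<Longrightarrow> k \<le> n \<Longrightarrow> parts n k \<noteq> {}"
proof -
  assume "1 \<le> k" "k \<le> n"
  then have "replicate (k - 1) 1 @ [n - k + 1] \<in> parts n k"
    by (intro partsI) (auto simp: sum_list_replicate)
  then show ?thesis by blast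
qed

lemma max_prod_ge: "xs \<in> parts n (n - t) \<Longrightarrow> prod_list xs \<le> max_prod n t"
  unfolding max_prod_eq by (rule Max_ge) (use finite_parts in auto)

lemma max_prod_attained:
  assumes "t < n" obtains xs where "xs \<in> parts n (n - t)" "prod_list xs = max_prod n t"
proof -
  have "Max (prod_list ` parts n (n - t)) \<in> prod_list ` parts n (n - t)"
    by (rule Max_in) (use finite_parts parts_nonempty[of "n - t" n] assms in auto)
  then show ?thesis using that unfolding max_prod_eq by auto
qed

lemma prod_list_pos: "(\<And>x. x \<in> set xs \<Longrightarrow> 0 < x) \<Longrightarrow> 0 < prod_list (xs :: nat list)"
  by (induction xs) auto

lemma max_prod_pos: "t < n \<Longrightarrow> 0 < max_prod n t"
  using max_prod_attained[of t n] prod_list_pos partsD(2) by metis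

lemma remove1_list:
  fixes xs :: "nat list"
  assumes "x \<in> set xs"
  shows "length xs = Suc (length (remove1 x xs))" "sum_list xs = x + sum_list (remove1 x xs)"
    "prod_list xs = x * prod_list (remove1 x xs)"
  using assms by (induction xs) (auto simp: length_remove1)

lemma sum_list_le_bound: "(\<And>x. x \<in> set xs \<Longrightarrow> x \<le> b) \<Longrightarrow> sum_list xs \<le> b * length (xs :: nat list)"
  by (induction xs) (auto simp: add_mono)

lemma parts_remove1:
  assumes "xs \<in> parts n k" "x \<in> set xs"
  shows "\<And>y. y \<in> set (remove1 x xs) \<Longrightarrow> 0 < y" "x + sum_list (remove1 x xs) = n"
    "Suc (length (remove1 x xs)) = k" "prod_list xs = x * prod_list (remove1 x xs)"
  using partsD[OF assms(1)] remove1_list[OF assms(2)] by (auto dest: notin_set_remove1[rotated] set_remove1_subset[THEN subsetD])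

text \<open>Replacing the part \<open>a + b\<close> by the two parts \<open>a\<close> and
  \<open>b\<close> turns a list admissible for \<open>Suc s\<close> into one admissible for
  \<open>s\<close>.\<close>

lemma max_prod_split:
  assumes xs: "xs \<in> parts n (n - Suc s)" "Suc s < n" and x: "a + b \<in> set xs" "0 < a" "0 < b"
  shows "prod_list xs * (a * b) \<le> max_prod n s * (a + b)"
proof -
  define r where "r = remove1 (a + b) xs"
  note r = parts_remove1[OF xs(1) x(1), folded r_def]
  have "a # b # r \<in> parts n (n - s)"
    by (rule partsI) (use r x xs(2) in auto)
  from max_prod_ge[OF this] have "a * b * prod_list r \<le> max_prod n s" by (simp add: mult.assoc)
  then have "(a * b * prod_list r) * (a + b) \<le> max_prod n s * (a + b)" by (rule mult_right_mono) simp
  then show ?thesis unfolding r(4) by (simp add: mult_ac)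
qed

text \<open>Splitting \<open>x\<close> as \<open>1 + (x - 1)\<close> gives the ratio
  \<open>x / (x - 1)\<close>, and as \<open>2 + (x - 2)\<close> the ratio
  \<open>x / (2 * (x - 2))\<close>. Both decrease in \<open>x\<close>; the first is 2 and 3/2 at 2
  and 3, the second is 1 and 5/6 at 4 and 5.\<close>

lemma max_prod_step_part:
  assumes xs: "xs \<in> parts n (n - Suc s)" "Suc s < n" and x: "x \<in> set xs"
  shows "x \<ge> 2 \<Longrightarrow> prod_list xs \<le> 2 * max_prod n s"
    and "x \<ge> 3 \<Longrightarrow> 2 * prod_list xs \<le> 3 * max_prod n s"
    and "x \<ge> 4 \<Longrightarrow> prod_list xs \<le> max_prod n s"
    and "x \<ge> 5 \<Longrightarrow> 6 * prod_list xs \<le> 5 * max_prod n s"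
proof -
  have one: "prod_list xs * (x - 1) \<le> max_prod n s * x" if "x \<ge> 2"
    using max_prod_split[OF xs, of 1 "x - 1"] that x by simp
  have two: "prod_list xs * (2 * (x - 2)) \<le> max_prod n s * x" if "x \<ge> 3"
  proof -
    have e: "2 + (x - 2) = x" using that by simp
    show ?thesis using max_prod_split[OF xs, of 2 "x - 2", unfolded e] that x by simp
  qed
  have cmp: "c * prod_list xs \<le> d * max_prod n s"
    if "prod_list xs * p \<le> max_prod n s * x" "c * x \<le> d * p" "0 < p" for c d p
  proof -
    have "c * prod_list xs * x \<le> d * prod_list xs * p" using mult_right_mono[OF that(2), of "prod_list xs"] by (simp add: mult_ac)
    also have "\<dots> \<le> d * (max_prod n s * x)" using mult_left_mono[OF that(1), of d] by (simp add: mult_ac)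
    finally have "(c * prod_list xs) * x \<le> (d * max_prod n s) * x" by (simp add: mult_ac)
    moreover have "x > 0" using partsD(2)[OF xs(1) x] .
    ultimately show ?thesis by simp
  qed
  show "prod_list xs \<le> 2 * max_prod n s" if "x \<ge> 2" using cmp[OF one[OF that], of 1 2] that by simp
  show "2 * prod_list xs \<le> 3 * max_prod n s" if "x \<ge> 3" using cmp[OF one, of 2 3] that by simp
  show "prod_list xs \<le> max_prod n s" if "x \<ge> 4" using cmp[OF two, of 1 1] that by simp
  show "6 * prod_list xs \<le> 5 * max_prod n s" if "x \<ge> 5" using cmp[OF two, of 6 5] that by simp
qed

lemma parts_large:
  assumes "xs \<in> parts n k" "b * k < n"
  obtains x where "x \<in> set xs" "b < x"
proof -
  have "\<exists>x\<in>set xs. b < x"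
  proof (rule ccontr)
    assume "\<not> ?thesis"
    then have "\<And>x. x \<in> set xs \<Longrightarrow> x \<le> b" by (simp add: not_less)
    then have "sum_list xs \<le> b * length xs" by (rule sum_list_le_bound)
    then show False using partsD[OF assms(1)] assms(2) by simp
  qed
  then show ?thesis using that by blast
qed

text \<open>A large average forces a large part, which is then split. When no part exceeds 3 and the
  average exceeds 2, there are two parts equal to 3; turning them into three parts equal to 2 gives
  9/8 instead of 3/2.\<close>

lemma max_prod_step:
  assumes "Suc s < n"
  shows "max_prod n (Suc s) \<le> 2 * max_prod n s"
    and "2 * s \<ge> n \<Longrightarrow> 8 * max_prod n (Suc s) \<le> 9 * max_prod n s"
    and "5 * s > 4 * n \<Longrightarrow> 6 * max_prod n (Suc s) \<le> 5 * max_prod n s"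
proof -
  obtain xs where xs: "xs \<in> parts n (n - Suc s)" "prod_list xs = max_prod n (Suc s)"
    using max_prod_attained[OF assms] .
  note len = partsD(1)[OF xs(1)] and sm = partsD(3)[OF xs(1)]
  show "max_prod n (Suc s) \<le> 2 * max_prod n s"
  proof -
    obtain x where x: "x \<in> set xs" "1 < x" by (rule parts_large[OF xs(1), of 1]) (use assms in auto)
    then show ?thesis using max_prod_step_part(1)[OF xs(1) assms x(1)] xs(2) by simp
  qed
  show "6 * max_prod n (Suc s) \<le> 5 * max_prod n s" if s: "5 * s > 4 * n"
  proof -
    obtain x where x: "x \<in> set xs" "4 < x" by (rule parts_large[OF xs(1), of 4]) (use assms s in auto)
    then show ?thesis using max_prod_step_part(4)[OF xs(1) assms x(1)] xs(2) by simp
  qed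
  show "8 * max_prod n (Suc s) \<le> 9 * max_prod n s" if s: "2 * s \<ge> n"
  proof (cases "\<exists>x\<in>set xs. x \<ge> 4")
    case True
    then obtain x where x: "x \<in> set xs" "x \<ge> 4" by blast
    then have "max_prod n (Suc s) \<le> max_prod n s" using max_prod_step_part(3)[OF xs(1) assms x(1)] xs(2) by simp
    then show ?thesis by simp
  next
    case False
    then have le3: "\<And>x. x \<in> set xs \<Longrightarrow> x \<le> 3" by force
    obtain x where "x \<in> set xs" "2 < x" by (rule parts_large[OF xs(1), of 2]) (use assms s in auto)
    then have x3: "3 \<in> set xs" using le3[of x] by (metis Suc_leI eval_nat_numeral(3) le_antisym)
    define r where "r = remove1 3 xs"
    note r = parts_remove1[OF xs(1) x3, folded r_def]
    have "r \<in> parts (n - 3) (n - Suc s - 1)" by (rule partsI) (use r in auto)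
    moreover have "2 * (n - Suc s - 1) < n - 3" using assms s r(2,3) by linarith
    ultimately obtain y where y: "y \<in> set r" "2 < y" by (rule parts_large)
    have "y \<in> set xs" using y(1) set_remove1_subset[of 3 xs] by (auto simp: r_def)
    then have y3: "3 \<in> set r" using y le3[of y] by (metis Suc_leI eval_nat_numeral(3) le_antisym)
    define q where "q = remove1 3 r"
    note q = remove1_list[OF y3, folded q_def]
    have qpos: "0 < z" if "z \<in> set q" for z
      using that r(1) set_remove1_subset[of 3 r] by (auto simp: q_def)
    have "2 # 2 # 2 # q \<in> parts n (n - s)"
      by (rule partsI) (use r(2,3) q qpos assms in auto)
    from max_prod_ge[OF this] have "8 * prod_list q \<le> max_prod n s" by simp
    moreover have "max_prod n (Suc s) = 9 * prod_list q" using xs(2) r(4) q(3) by simp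
    ultimately show ?thesis by simp
  qed
qed

text \<open>Moving one unit from \<open>x\<close> to \<open>y\<close> would enlarge the product, as
  \<open>x * y < (x - 1) * (y + 1)\<close> for \<open>x \<ge> y + 2\<close>.\<close>

lemma max_prod_imp_balanced:
  assumes xs: "xs \<in> parts n (n - t)" "prod_list xs = max_prod n t" and xy: "x \<in> set xs" "y \<in> set xs"
  shows "x \<le> y + 1"
proof (rule ccontr)
  assume gt: "\<not> x \<le> y + 1"
  define r where "r = remove1 x xs"
  note r = parts_remove1[OF xs(1) xy(1), folded r_def]
  have yr: "y \<in> set r" using xy gt by (simp add: r_def in_set_remove1)
  define q where "q = remove1 y r"
  note q = remove1_list[OF yr, folded q_def]
  have qpos: "0 < z" if "z \<in> set q" for z
    using that r(1) set_remove1_subset[of y r] by (auto simp: q_def)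
  have "(x - 1) # (y + 1) # q \<in> parts n (n - t)"
    by (rule partsI) (use r(2,3) q qpos gt in auto)
  from max_prod_ge[OF this] have le: "(x - 1) * (y + 1) * prod_list q \<le> max_prod n t" by (simp only: prod_list.Cons mult.assoc)
  obtain d where d: "x = y + 2 + d" using gt by (metis add.assoc add_2_eq_Suc' less_eqE not_less_eq_eq Suc_eq_plus1)
  have "x * y < (x - 1) * (y + 1)" unfolding d by (simp add: algebra_simps)
  moreover have "0 < prod_list q" by (rule prod_list_pos) (rule qpos)
  ultimately have "x * y * prod_list q < (x - 1) * (y + 1) * prod_list q" by (rule mult_strict_right_mono)
  moreover have "max_prod n t = x * y * prod_list q" using xs(2) r(4) q(3) by (simp only: mult.assoc)
  ultimately show False using le by (metis leD)
qed

lemma two_values_list: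
  assumes "\<And>x. x \<in> set xs \<Longrightarrow> x = d \<or> x = Suc d"
  shows "length (filter (\<lambda>x. x = Suc d) xs) \<le> length xs \<and>
    sum_list xs = d * length xs + length (filter (\<lambda>x. x = Suc d) xs) \<and>
    prod_list xs = d ^ (length xs - length (filter (\<lambda>x. x = Suc d) xs)) * Suc d ^ length (filter (\<lambda>x. x = Suc d) xs)"
  using assms
proof (induction xs)
  case (Cons x xs)
  then have IH: "length (filter (\<lambda>x. x = Suc d) xs) \<le> length xs"
    "sum_list xs = d * length xs + length (filter (\<lambda>x. x = Suc d) xs)"
    "prod_list xs = d ^ (length xs - length (filter (\<lambda>x. x = Suc d) xs)) * Suc d ^ length (filter (\<lambda>x. x = Suc d) xs)"
    by simp_all
  have "x = d \<or> x = Suc d" using Cons.prems by simp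
  then show ?case
  proof
    assume "x = d"
    then show ?thesis using IH by (simp add: Suc_diff_le mult_ac le_SucI)
  next
    assume "x = Suc d"
    then show ?thesis using IH by (simp add: algebra_simps)
  qed
qed simp

lemma balanced_prod_eq:
  assumes xs: "xs \<in> parts n k" and k: "1 \<le> k" and bal: "\<And>x y. x \<in> set xs \<Longrightarrow> y \<in> set xs \<Longrightarrow> x \<le> y + 1"
  shows "prod_list xs = (n div k) ^ (k - n mod k) * Suc (n div k) ^ (n mod k)"
proof -
  note p = partsD[OF xs]
  have ne: "set xs \<noteq> {}" using p(1) k by auto
  define d where "d = Min (set xs)"
  have din: "d \<in> set xs" unfolding d_def by (rule Min_in) (use ne in simp_all)
  have two: "x = d \<or> x = Suc d" if "x \<in> set xs" for x
  proof -
    have "d \<le> x" unfolding d_def using that by simp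
    moreover have "x \<le> d + 1" by (rule bal[OF that din])
    ultimately show ?thesis by linarith
  qed
  define r where "r = length (filter (\<lambda>x. x = Suc d) xs)"
  have t: "sum_list xs = d * length xs + r" "prod_list xs = d ^ (length xs - r) * Suc d ^ r"
    using two_values_list[of xs d, OF two] by (simp_all add: r_def)
  have "r < length xs"
    unfolding r_def by (rule length_filter_less[OF din]) simp
  then have rk: "r < k" using p(1) by simp
  have n: "n = d * k + r" using t p by simp
  have "n div k = d" "n mod k = r" using rk unfolding n by simp_all
  then show ?thesis using t(2) p(1) by simp
qed

text \<open>All balanced lists have the same product by \<open>balanced_prod_eq\<close>, and a
  maximal list is one of them.\<close>

lemma balanced_iff_max_prod:
  assumes xs: "xs \<in> parts n (n - t)" and t: "t < n"
  shows "prod_list xs = max_prod n t \<longleftrightarrow> (\<forall>x\<in>set xs. \<forall>y\<in>set xs. x \<le> y + 1)"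
proof
  assume "prod_list xs = max_prod n t"
  then show "\<forall>x\<in>set xs. \<forall>y\<in>set xs. x \<le> y + 1" using max_prod_imp_balanced[OF xs] by blast
next
  assume bal: "\<forall>x\<in>set xs. \<forall>y\<in>set xs. x \<le> y + 1"
  have k: "1 \<le> n - t" using t by simp
  obtain ys where ys: "ys \<in> parts n (n - t)" "prod_list ys = max_prod n t" using max_prod_attained[OF t] .
  have "prod_list ys = (n div (n - t)) ^ ((n - t) - n mod (n - t)) * Suc (n div (n - t)) ^ (n mod (n - t))"
    by (rule balanced_prod_eq[OF ys(1) k]) (rule max_prod_imp_balanced[OF ys])
  moreover have "prod_list xs = (n div (n - t)) ^ ((n - t) - n mod (n - t)) * Suc (n div (n - t)) ^ (n mod (n - t))"
    by (rule balanced_prod_eq[OF xs k]) (use bal in blast)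
  ultimately show "prod_list xs = max_prod n t" using ys(2) by simp
qed

lemma forest_parts:
  assumes F: "forest_on n F"
  obtains xs where "xs \<in> parts n (n - card F)" "prod_list xs = comp_prod n F" "set xs = card ` graph_components n F"
proof -
  obtain cs where cs: "set cs = graph_components n F" "distinct cs"
    using finite_distinct_list[OF finite_graph_components] by blast
  have r: "ncomp n F + card F = n" using F by (simp add: forest_iff_rank)
  have "sum_list (map card cs) = (\<Sum>C\<in>graph_components n F. card C)"
    using sum_list_distinct_conv_sum_set[OF cs(2), of card] cs(1) by simp
  also have "\<dots> = card (\<Union> (graph_components n F))"
    by (rule card_Union_disjoint[symmetric]) (use components_disjoint component_nonempty in \<open>auto simp: pairwise_def disjnt_def\<close>)
  also have "\<dots> = n" by (simp add: Union_components)
  finally have sm: "sum_list (map card cs) = n" .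
  have "length (map card cs) = n - card F" using distinct_card[OF cs(2)] cs(1) r by (simp add: ncomp_def)
  moreover have "0 < x" if "x \<in> set (map card cs)" for x
    using that component_nonempty cs(1) by (auto simp: card_gt_0_iff)
  ultimately have 1: "map card cs \<in> parts n (n - card F)" using sm by (intro partsI)
  have 2: "prod_list (map card cs) = comp_prod n F"
    unfolding comp_prod_def using prod.distinct_set_conv_list[OF cs(2), of card] cs(1) by simp
  show ?thesis by (rule that[OF 1 2]) (simp add: cs(1))
qed

lemma comp_prod_le: "forest_on n F \<Longrightarrow> comp_prod n F \<le> max_prod n (card F)"
  using forest_parts max_prod_ge by metis

lemma forest_card_less: "n \<ge> 1 \<Longrightarrow> forest_on n F \<Longrightarrow> card F < n"
proof -
  assume "n \<ge> 1" "forest_on n F"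
  moreover have "card (graph_components n F) > 0"
    using component_in[of 1 n F] \<open>n \<ge> 1\<close> by (auto simp: card_gt_0_iff)
  ultimately show ?thesis by (simp add: forest_iff_rank ncomp_def)
qed

lemma comp_prod_eq_iff:
  assumes "n \<ge> 1" and F: "forest_on n F"
  shows "comp_prod n F = max_prod n (card F) \<longleftrightarrow> balanced_forest n (card F) F"
proof -
  obtain xs where xs: "xs \<in> parts n (n - card F)" "prod_list xs = comp_prod n F" "set xs = card ` graph_components n F"
    by (rule forest_parts[OF F])
  have "ncomp n F + card F = n" using F by (simp add: forest_iff_rank)
  then have "card (graph_components n F) = n - card F" unfolding ncomp_def by linarith
  then show ?thesis
    using balanced_iff_max_prod[OF xs(1) forest_card_less[OF assms]] xs(2,3) F by (simp add: balanced_forest_def)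
qed

section \<open>Degrees in the family of spanning trees\<close>

lemma forest_finite: "forest_on n F \<Longrightarrow> finite F"
  unfolding forest_on_def using finite_edges by blast

text \<open>The bound of the theorem as a real quotient, so that it also covers
  \<open>s = n - 1\<close>, where the exponent \<open>n - 2 - s\<close> would be negative and the
  value is 1. From \<open>n\<close> edges on there are no forests, hence 0.\<close>

definition tree_bound :: "nat \<Rightarrow> nat \<Rightarrow> real" where
  "tree_bound n s = (if s < n then real (max_prod n s) * real n ^ (n - 2) / real n ^ s else 0)"

lemma tree_bound_nonneg: "tree_bound n s \<ge> 0"
  by (simp add: tree_bound_def)

lemma tree_bound_pos: "s < n \<Longrightarrow> tree_bound n s > 0"
  using max_prod_pos[of s n] by (simp add: tree_bound_def)

lemma tree_bound_nat:
  assumes "n \<ge> 2" "s \<le> n - 2"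
  shows "tree_bound n s = real (max_prod n s * n ^ (n - 2 - s))"
proof -
  have "n - 2 - s + s = n - 2" using assms by simp
  then have e: "real n ^ (n - 2) = real n ^ (n - 2 - s) * real n ^ s" by (simp only: power_add[symmetric])
  have "s < n" using assms by simp
  then have "tree_bound n s = real (max_prod n s) * real n ^ (n - 2) / real n ^ s" by (simp add: tree_bound_def)
  also have "\<dots> = real (max_prod n s) * real n ^ (n - 2 - s)" unfolding e using assms(1) by simp
  finally show ?thesis by simp
qed

lemma tree_bound_stepI:
  assumes "Suc s < n \<Longrightarrow> real (max_prod n (Suc s)) \<le> c * real (max_prod n s)" "c \<ge> 0"
  shows "tree_bound n (Suc s) \<le> c / n * tree_bound n s"
proof (cases "Suc s < n")
  case True
  have "real (max_prod n (Suc s)) * (real n ^ (n - 2) / real n ^ Suc s)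
      \<le> (c * real (max_prod n s)) * (real n ^ (n - 2) / real n ^ Suc s)"
    by (rule mult_right_mono[OF assms(1)[OF True]]) simp
  then show ?thesis using True by (simp add: tree_bound_def mult_ac)
next
  case False
  then show ?thesis using assms(2) tree_bound_nonneg[of n s] by (simp add: tree_bound_def)
qed

lemma tree_bound_step: "tree_bound n (Suc s) \<le> 2 / n * tree_bound n s"
proof (rule tree_bound_stepI)
  assume "Suc s < n"
  then have "max_prod n (Suc s) \<le> 2 * max_prod n s" by (rule max_prod_step)
  then have "real (max_prod n (Suc s)) \<le> real (2 * max_prod n s)" by (simp only: of_nat_le_iff)
  then show "real (max_prod n (Suc s)) \<le> 2 * real (max_prod n s)" by simp
qed simp

lemma tree_bound_step_half:
  assumes "2 * s \<ge> n" shows "tree_bound n (Suc s) \<le> (9/8) / n * tree_bound n s"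
proof (rule tree_bound_stepI)
  assume "Suc s < n"
  then have "8 * max_prod n (Suc s) \<le> 9 * max_prod n s" using assms by (rule max_prod_step)
  then have "real (8 * max_prod n (Suc s)) \<le> real (9 * max_prod n s)" by (simp only: of_nat_le_iff)
  then show "real (max_prod n (Suc s)) \<le> 9/8 * real (max_prod n s)" by simp
qed simp

lemma tree_bound_step_large:
  assumes "5 * s > 4 * n" shows "tree_bound n (Suc s) \<le> (5/6) / n * tree_bound n s"
proof (rule tree_bound_stepI)
  assume "Suc s < n"
  then have "6 * max_prod n (Suc s) \<le> 5 * max_prod n s" using assms by (rule max_prod_step)
  then have "real (6 * max_prod n (Suc s)) \<le> real (5 * max_prod n s)" by (simp only: of_nat_le_iff)
  then show "real (max_prod n (Suc s)) \<le> 5/6 * real (max_prod n s)" by simp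
qed simp

lemma card_trees_above_eq:
  assumes n: "n \<ge> 2" and F: "forest_on n F"
  shows "real (card (trees_above n F)) = real (comp_prod n F) * real n ^ (n - 2) / real n ^ card F"
proof -
  have r: "ncomp n F + card F = n" using F by (simp add: forest_iff_rank)
  have n2: "n - 2 + 2 = n" using n by simp
  have "real n ^ (n - 2) * real n ^ 2 = real n ^ n" by (simp only: power_add[symmetric] n2)
  also have "\<dots> = real n ^ ncomp n F * real n ^ card F" by (simp only: power_add[symmetric] r)
  finally have e: "real n ^ (n - 2) * real n ^ 2 = real n ^ ncomp n F * real n ^ card F" .
  have "(real (card (trees_above n F)) * real n ^ card F) * real n ^ 2 = real n ^ ncomp n F * real (comp_prod n F) * real n ^ card F"
    using card_trees_above[OF _ F] n by (simp add: mult_ac)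
  also have "\<dots> = (real (comp_prod n F) * real n ^ (n - 2)) * real n ^ 2" using e by (simp add: mult_ac)
  finally have "real (card (trees_above n F)) * real n ^ card F = real (comp_prod n F) * real n ^ (n - 2)"
    using n by simp
  then show ?thesis using n by (simp add: field_simps)
qed

lemma card_trees_above_le:
  assumes n: "n \<ge> 2"
  shows "real (card (trees_above n F)) \<le> tree_bound n (card F)"
proof (cases "forest_on n F")
  case True
  have "card F < n" using forest_card_less[OF _ True] n by simp
  moreover have "real (comp_prod n F) \<le> real (max_prod n (card F))" using comp_prod_le[OF True] by simp
  ultimately show ?thesis
    unfolding card_trees_above_eq[OF n True] tree_bound_def
    by (simp add: divide_right_mono mult_right_mono)
next
  case False
  then show ?thesis using trees_above_nonforest tree_bound_nonneg by simp
qed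

lemma comp_prod_pos: "comp_prod n F > 0"
  unfolding comp_prod_def by (rule prod_pos) (use component_nonempty in \<open>auto simp: card_gt_0_iff\<close>)

lemma trees_above_nonempty:
  assumes "n \<ge> 2" "forest_on n F" shows "trees_above n F \<noteq> {}"
proof
  assume "trees_above n F = {}"
  then show False using card_trees_above_eq[OF assms] comp_prod_pos[of n F] assms(1) by simp
qed

text \<open>The reciprocals of two component sizes add up to at most 2. The comparison is with the
  actual number of trees above \<open>F\<close> rather than with \<open>tree_bound\<close>, since
  \<open>missing_trees\<close> concerns forests that may be unbalanced.\<close>

lemma card_trees_above_insert_le:
  assumes n: "n \<ge> 2" and F: "forest_on n F" and e: "e \<in> complete_graph_edges n" "e \<notin> F"
  shows "real (card (trees_above n (insert e F))) \<le> 2 / n * real (card (trees_above n F))"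
proof (cases "forest_on n (insert e F)")
  case True
  obtain u v where uv: "e = {u, v}" "u \<noteq> v" "u \<in> {1..n}" "v \<in> {1..n}" using e(1) by (rule complete_edgeE)
  have nc: "(u, v) \<notin> (adj_rel F)\<^sup>*" by (rule not_conn_in_tree) (use True uv e in auto)
  have finF: "finite F" by (rule forest_finite[OF F])
  have pos: "card (component n F u) \<ge> 1" "card (component n F v) \<ge> 1"
    using component_self[OF uv(3), of F] component_self[OF uv(4), of F] by (auto simp: Suc_le_eq card_gt_0_iff)
  then have "1 / real (card (component n F u)) + 1 / real (card (component n F v)) \<le> 1 / 1 + 1 / 1"
    by (intro add_mono divide_left_mono) auto
  then have "real (comp_prod n F) * (1 / real (card (component n F u)) + 1 / real (card (component n F v))) \<le> real (comp_prod n F) * 2"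
    by (intro mult_left_mono) auto
  then have "real (comp_prod n (insert e F)) \<le> 2 * real (comp_prod n F)"
    unfolding uv(1) comp_prod_insert[OF uv(3,4) nc] by simp
  then have "real (comp_prod n (insert e F)) * (real n ^ (n - 2) / real n ^ card (insert e F))
     \<le> 2 * real (comp_prod n F) * (real n ^ (n - 2) / real n ^ card (insert e F))"
    by (rule mult_right_mono) simp
  then show ?thesis
    unfolding card_trees_above_eq[OF n True] card_trees_above_eq[OF n F] using finF e(2) by (simp add: mult_ac)
next
  case False
  then show ?thesis using trees_above_nonforest by simp
qed

lemma sum_card_inter:
  assumes "finite A" "finite H"
  shows "(\<Sum>T\<in>A. real (card (T \<inter> H))) = (\<Sum>e\<in>H. real (card {T \<in> A. e \<in> T}))"
proof -
  have "(\<Sum>T\<in>A. real (card (T \<inter> H))) = (\<Sum>T\<in>A. \<Sum>e\<in>H. if e \<in> T then 1 else 0)"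
    using assms by (intro sum.cong) (auto simp: sum.If_cases Int_def conj_commute)
  also have "\<dots> = (\<Sum>e\<in>H. \<Sum>T\<in>A. if e \<in> T then 1 else 0)" by (rule sum.swap)
  also have "\<dots> = (\<Sum>e\<in>H. real (card {T \<in> A. e \<in> T}))"
    using assms by (intro sum.cong) (auto simp: sum.If_cases Int_def)
  finally show ?thesis .
qed

lemma markov_inter:
  assumes "finite A" "finite H"
  shows "real m * real (card {T \<in> A. m \<le> card (T \<inter> H)}) \<le> (\<Sum>e\<in>H. real (card {T \<in> A. e \<in> T}))"
proof -
  have "real m * real (card {T \<in> A. m \<le> card (T \<inter> H)}) = (\<Sum>T\<in>{T \<in> A. m \<le> card (T \<inter> H)}. real m)" by simp
  also have "\<dots> \<le> (\<Sum>T\<in>{T \<in> A. m \<le> card (T \<inter> H)}. real (card (T \<inter> H)))" by (rule sum_mono) simp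
  also have "\<dots> \<le> (\<Sum>T\<in>A. real (card (T \<inter> H)))" by (rule sum_mono2) (use assms in auto)
  finally show ?thesis unfolding sum_card_inter[OF assms] .
qed

section \<open>Trees that miss an intersection\<close>

lemma graph_cycle_four:
  assumes "distinct [a, b, c, d]" "{a, b} \<in> E" "{b, c} \<in> E" "{c, d} \<in> E" "{d, a} \<in> E"
  shows "graph_cycle E [a, b, c, d]"
  unfolding graph_cycle_def
proof (intro conjI allI impI)
  fix i assume "i < length [a, b, c, d]"
  then have "i = 0 \<or> i = 1 \<or> i = 2 \<or> i = 3" by auto
  then show "{[a, b, c, d] ! i, [a, b, c, d] ! (Suc i mod length [a, b, c, d])} \<in> E"
    using assms(2-5) by (elim disjE) simp_all
qed (use assms(1) in auto)

text \<open>
  If every edge across the cut of \<open>h\<close> lay in \<open>T'\<close>, then \<open>T'\<close> would contain a complete bipartite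
  graph, which is acyclic only when \<open>T'\<close> is the star at a vertex that is isolated in \<open>T - {h}\<close>.
\<close>

lemma replacement_edge:
  assumes n: "n \<ge> 2" and T: "T \<in> spanning_trees n" and T': "T' \<in> spanning_trees n"
    and h: "h \<in> T" "h \<in> T'" and F0: "F0 \<subseteq> T - {h}" "F0 \<inter> T' \<noteq> {}"
  shows "\<exists>e. e \<notin> T \<and> e \<notin> T' \<and> insert e (T - {h}) \<in> spanning_trees n"
proof -
  have fT: "forest_on n T" "forest_on n T'" using T T' tree_forest by blast+
  have TK: "T \<subseteq> complete_graph_edges n" "T' \<subseteq> complete_graph_edges n" using T T' spanning_tree_edges by blast+
  obtain a b where ab: "h = {a, b}" "a \<noteq> b" "a \<in> {1..n}" "b \<in> {1..n}"
    by (rule complete_edgeE[of h n]) (use h TK in blast)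
  define S where "S = T - {h}"
  have fS: "forest_on n S" unfolding S_def by (rule forest_subset[OF fT(1)]) blast
  have hS: "T = insert {a, b} S" "{a, b} \<notin> S" using h ab by (auto simp: S_def)
  have nab: "(a, b) \<notin> (adj_rel S)\<^sup>*" using forest_edge_not_conn[OF fT(1), of a b] h(1) ab by (simp add: S_def)
  define A where "A = component n S a"
  define B where "B = component n S b"
  have cover: "w \<in> A \<or> w \<in> B" if w: "w \<in> {1..n}" for w
  proof -
    have "(a, w) \<in> (adj_rel T)\<^sup>*" using T w ab by (simp add: spanning_trees_def connected_graph_on_def)
    then have "(a, w) \<in> (adj_rel S)\<^sup>* \<or> (b, w) \<in> (adj_rel S)\<^sup>*" unfolding hS(1) conn_insert by blast
    then show ?thesis using w by (simp add: A_def B_def component_def)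
  qed
  have dis: "A \<inter> B = {}"
  proof (rule components_disjoint)
    show "A \<in> graph_components n S" "B \<in> graph_components n S" using ab component_in by (simp_all add: A_def B_def)
    show "A \<noteq> B" using component_eq_iff[OF ab(3), of S b] nab by (simp add: A_def B_def)
  qed
  have AB: "a \<in> A" "b \<in> B" using ab component_self by (simp_all add: A_def B_def)
  have ABn: "A \<subseteq> {1..n}" "B \<subseteq> {1..n}" using component_subset by (auto simp: A_def B_def)
  have ncAB: "(x, y) \<notin> (adj_rel S)\<^sup>*" if "x \<in> A" "y \<in> B" for x y
  proof
    assume "(x, y) \<in> (adj_rel S)\<^sup>*"
    moreover have "(a, x) \<in> (adj_rel S)\<^sup>*" "(b, y) \<in> (adj_rel S)\<^sup>*" using that by (simp_all add: A_def B_def component_def)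
    ultimately have "(a, b) \<in> (adj_rel S)\<^sup>*" by (meson conn_sym rtrancl_trans)
    then show False using nab by blast
  qed
  \<comment> \<open>A tree \<open>T'\<close> containing all edges at \<open>v\<close> is the star at
    \<open>v\<close>; an edge common to \<open>F0\<close> and \<open>T'\<close> would then be an
    edge of \<open>S\<close> at the isolated vertex \<open>v\<close>.\<close>
  have star: False if v: "v \<in> {1..n}" and iso: "\<And>y. y \<in> {1..n} \<Longrightarrow> y \<noteq> v \<Longrightarrow> (v, y) \<notin> (adj_rel S)\<^sup>* \<and> {v, y} \<in> T'" for v
  proof -
    define St where "St = (\<lambda>y. {v, y}) ` ({1..n} - {v})"
    have "inj_on (\<lambda>y. {v, y}) ({1..n} - {v})" by (rule inj_onI) (auto simp: doubleton_eq_iff)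
    then have "card St = n - 1" using v by (simp add: St_def card_image)
    moreover have "St \<subseteq> T'" unfolding St_def using iso by blast
    moreover have "card T' = n - 1" using card_tree[OF _ T'] n by simp
    ultimately have "St = T'" using finite_edges[OF TK(2)] by (metis card_subset_eq)
    obtain f where f: "f \<in> F0" "f \<in> St" using F0(2) \<open>St = T'\<close> by blast
    then obtain y where y: "y \<in> {1..n}" "y \<noteq> v" "f = {v, y}" unfolding St_def by blast
    have "{v, y} \<in> S" using y(3) f(1) F0(1) unfolding S_def by blast
    then have "(v, y) \<in> (adj_rel S)\<^sup>*" by (rule conn_edge)
    then show False using iso y(1,2) by blast
  qed
  have "\<exists>x\<in>A. \<exists>y\<in>B. {x, y} \<notin> T'"
  proof (rule ccontr)
    assume "\<not> ?thesis"
    then have all: "\<And>x y. x \<in> A \<Longrightarrow> y \<in> B \<Longrightarrow> {x, y} \<in> T'" by blast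
    show False
    proof (cases "A = {a} \<or> B = {b}")
      case True
      then show False
      proof
        assume Aa: "A = {a}"
        show False
        proof (rule star[OF ab(3)])
          fix y assume "y \<in> {1..n}" "y \<noteq> a"
          then have "y \<in> B" using cover[of y] Aa by simp
          then show "(a, y) \<notin> (adj_rel S)\<^sup>* \<and> {a, y} \<in> T'" using ncAB[OF AB(1), of y] all[OF AB(1), of y] by simp
        qed
      next
        assume Bb: "B = {b}"
        show False
        proof (rule star[OF ab(4)])
          fix y assume "y \<in> {1..n}" "y \<noteq> b"
          then have y: "y \<in> A" using cover[of y] Bb by simp
          have "(b, y) \<notin> (adj_rel S)\<^sup>*" using ncAB[OF y AB(2)] conn_sym[of b y S] by blast
          moreover have "{b, y} \<in> T'" using all[OF y AB(2)] by (simp only: insert_commute)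
          ultimately show "(b, y) \<notin> (adj_rel S)\<^sup>* \<and> {b, y} \<in> T'" by (rule conjI)
        qed
      qed
    next
      case False
      then obtain a' b' where a'b': "a' \<in> A" "a' \<noteq> a" "b' \<in> B" "b' \<noteq> b" using AB by blast
      have "graph_cycle T' [a, b, a', b']"
      proof (rule graph_cycle_four)
        show "distinct [a, b, a', b']" using a'b' AB dis by auto
        show "{a, b} \<in> T'" "{b, a'} \<in> T'" "{a', b'} \<in> T'" "{b', a} \<in> T'"
          using all[OF AB] all[OF a'b'(1) AB(2)] all[OF a'b'(1,3)] all[OF AB(1) a'b'(3)] by (simp_all only: insert_commute)
      qed
      then show False using fT(2) unfolding forest_on_def by blast
    qed
  qed
  then obtain x y where xy: "x \<in> A" "y \<in> B" "{x, y} \<notin> T'" by blast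
  have xy': "x \<in> {1..n}" "y \<in> {1..n}" using xy ABn by blast+
  note ins = forest_insert[OF fS xy' ncAB[OF xy(1,2)]]
  have "{x, y} \<notin> T" using ins(2) xy(3) h(2) unfolding S_def by auto
  moreover have "insert {x, y} S \<in> spanning_trees n"
  proof -
    have finT: "finite T" using finite_edges[OF TK(1)] .
    have "card (insert {x, y} S) = Suc (card S)" using ins(2) finT by (simp add: S_def)
    also have "\<dots> = card T" unfolding S_def by (rule card_Suc_Diff1[OF finT h(1)])
    finally have "card (insert {x, y} S) = card T" .
    then show ?thesis using ins(1) spanning_tree_iff[of n] T n by simp
  qed
  ultimately show ?thesis using xy(3) unfolding S_def by blast
qed

text \<open>A tree above \<open>F0\<close> meets \<open>T'\<close> in \<open>t\<close> edges only if
  it contains at least \<open>m\<close> edges of \<open>H\<close>, and on average it contains at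
  most \<open>2 * card H / n\<close> of them. For \<open>m \<ge> 2\<close>, Markov's inequality
  leaves a fraction \<open>1 / n\<close> of the trees. For \<open>m = 1\<close> it only shows that a
  third of the trees contain fewer than three edges of \<open>H\<close>; at most two switchings,
  each at most \<open>n ^ 2\<close> to one, bring this number down to zero.\<close>

lemma missing_trees:
  assumes n: "n \<ge> 3" and F0: "forest_on n F0" "card F0 = t" "t \<ge> 2"
    and T': "T' \<in> spanning_trees n" "\<not> F0 \<subseteq> T'"
  shows "real (card (trees_above n F0)) \<le> 9 * real n ^ 4 * real (card {T \<in> trees_above n F0. card (T \<inter> T') < t})"
proof -
  define \<A> where "\<A> = trees_above n F0"
  define H where "H = T' - F0"
  define m where "m = t - card (F0 \<inter> T')"
  define X where "X T = card (T \<inter> H)" for T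
  have n2: "n \<ge> 2" and n1: "n \<ge> 1" using n by simp_all
  have finF0: "finite F0" by (rule forest_finite[OF F0(1)])
  have T'K: "T' \<subseteq> complete_graph_edges n" using T' spanning_tree_edges by blast
  have finT': "finite T'" using finite_edges[OF T'K] .
  have finH: "finite H" using finT' by (simp add: H_def)
  have finA: "finite \<A>" by (simp add: \<A>_def)
  have A: "T \<in> spanning_trees n" "F0 \<subseteq> T" "finite T" "card T = n - 1" if "T \<in> \<A>" for T
    using that card_tree[OF n1] finite_edges[OF spanning_tree_edges] by (auto simp: \<A>_def trees_above_def)
  have m1: "m \<ge> 1"
  proof -
    have "F0 \<inter> T' \<subset> F0" using T'(2) by blast
    then have "card (F0 \<inter> T') < card F0" by (rule psubset_card_mono[OF finF0])
    then show ?thesis using F0(2) by (simp add: m_def)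
  qed
  have mt: "m + card (F0 \<inter> T') = t"
    using card_mono[OF finF0, of "F0 \<inter> T'"] F0(2) by (simp add: m_def)
  have cT: "card (T \<inter> T') = card (F0 \<inter> T') + X T" if "T \<in> \<A>" for T
  proof -
    have "T \<inter> T' = (F0 \<inter> T') \<union> (T \<inter> H)" using A(2)[OF that] by (auto simp: H_def)
    moreover have "card ((F0 \<inter> T') \<union> (T \<inter> H)) = card (F0 \<inter> T') + card (T \<inter> H)"
      by (rule card_Un_disjoint) (use finF0 finH in \<open>auto simp: H_def\<close>)
    ultimately show ?thesis by (simp add: X_def)
  qed
  define good where "good = {T \<in> \<A>. X T < m}"
  have good: "{T \<in> trees_above n F0. card (T \<inter> T') < t} = good"
    unfolding good_def \<A>_def[symmetric] using cT mt by auto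
  have cH: "real (card H) = real n - 1 - real t + real m"
  proof -
    have "card T' = card (T' \<inter> F0) + card H" unfolding H_def by (rule card_Int_Diff[OF finT'])
    moreover have "card T' = n - 1" using card_tree[OF n1 T'(1)] .
    ultimately have "card H + t + 1 = n + m" using mt n1 by (simp add: Int_commute)
    then have "real (card H + t + 1) = real (n + m)" by (simp only:)
    then show ?thesis by simp
  qed
  have markov: "real j * real (card {T \<in> \<A>. j \<le> X T}) \<le> (real n - 1 - real t + real m) * (2 / n * real (card \<A>))" for j
  proof -
    have "real j * real (card {T \<in> \<A>. j \<le> X T}) \<le> (\<Sum>e\<in>H. real (card {T \<in> \<A>. e \<in> T}))"
      unfolding X_def by (rule markov_inter[OF finA finH])
    also have "\<dots> \<le> (\<Sum>e\<in>H. 2 / n * real (card \<A>))"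
    proof (rule sum_mono)
      fix e assume e: "e \<in> H"
      have "{T \<in> \<A>. e \<in> T} = trees_above n (insert e F0)" by (auto simp: \<A>_def trees_above_def)
      then show "real (card {T \<in> \<A>. e \<in> T}) \<le> 2 / n * real (card \<A>)"
        using card_trees_above_insert_le[OF n2 F0(1), of e] e T'K by (auto simp: H_def \<A>_def)
    qed
    also have "\<dots> = real (card H) * (2 / n * real (card \<A>))" by simp
    finally show ?thesis unfolding cH .
  qed
  have split: "real (card \<A>) = real (card {T \<in> \<A>. X T < j}) + real (card {T \<in> \<A>. j \<le> X T})" for j
  proof -
    have "\<A> = {T \<in> \<A>. X T < j} \<union> {T \<in> \<A>. j \<le> X T}" by auto
    then have "card \<A> = card ({T \<in> \<A>. X T < j} \<union> {T \<in> \<A>. j \<le> X T})" by (rule arg_cong)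
    also have "\<dots> = card {T \<in> \<A>. X T < j} + card {T \<in> \<A>. j \<le> X T}"
      by (rule card_Un_disjoint) (use finA in auto)
    finally show ?thesis by simp
  qed
  have "real (card \<A>) \<le> 9 * real n ^ 4 * real (card good)"
  proof (cases "m \<ge> 2")
    case True
    define g where "g = real (card good)"
    define N where "N = real (card \<A>)"
    have N0: "N \<ge> 0" and g0: "g \<ge> 0" by (simp_all add: N_def g_def)
    have rn: "real n \<ge> 3" "real m \<ge> 2" "real t \<ge> 2" using n True F0(3) by simp_all
    have "real (card {T \<in> \<A>. m \<le> X T}) = N - g" using split[of m] by (simp add: good_def N_def g_def)
    then have "real m * (N - g) \<le> (real n - 1 - real t + real m) * (2 / n * N)" using markov[of m] by (simp add: N_def)
    then have "real n * (real m * (N - g)) \<le> real n * ((real n - 1 - real t + real m) * (2 / n * N))"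
      using rn by (intro mult_left_mono) auto
    also have "\<dots> = 2 * (real n - 1 - real t + real m) * N" using rn by simp
    also have "\<dots> \<le> ((real n - 1) * real m) * N"
    proof (rule mult_right_mono[OF _ N0])
      have "(real n - 3) * 2 \<le> (real n - 3) * real m" using rn by (intro mult_left_mono) auto
      then show "2 * (real n - 1 - real t + real m) \<le> (real n - 1) * real m" using rn by (simp add: algebra_simps)
    qed
    finally have "real m * N \<le> real m * (real n * g)" by (simp add: algebra_simps)
    then have "N \<le> real n * g" using rn by simp
    also have "\<dots> \<le> (9 * real n ^ 4) * g"
    proof (rule mult_right_mono[OF _ g0])
      have "real n ^ 1 \<le> real n ^ 4" using rn by (intro power_increasing) auto
      then have "real n \<le> real n ^ 4" by (simp only: power_one_right)
      then show "real n \<le> 9 * real n ^ 4" using rn by linarith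
    qed
    finally show ?thesis unfolding N_def g_def .
  next
    case False
    then have m: "m = 1" using m1 by simp
    \<comment> \<open>The place where \<open>t \<ge> 2\<close> is essential: if \<open>T'\<close>
      were a star disjoint from \<open>F0\<close>, every tree would meet it and no tree would be
      missed.\<close>
    have F0T': "F0 \<inter> T' \<noteq> {}"
    proof
      assume "F0 \<inter> T' = {}"
      then have "m = t" using mt by simp
      then show False using m F0(3) by simp
    qed
    define L where "L i = {T \<in> \<A>. X T = i}" for i
    have finL: "finite (L i)" for i using finA by (simp add: L_def)
    have switch: "card (L (Suc i)) \<le> n ^ 2 * card (L i)" for i
    proof -
      define P where "P T x \<longleftrightarrow> (case x of (h, e) \<Rightarrow> h \<in> T \<and> h \<in> H \<and> e \<notin> T \<and> e \<notin> T' \<and> insert e (T - {h}) \<in> spanning_trees n)" for T x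
      have ex: "\<exists>x. P T x" if T: "T \<in> L (Suc i)" for T
      proof -
        have TA: "T \<in> \<A>" and "card (T \<inter> H) = Suc i" using T by (simp_all add: L_def X_def)
        then obtain h where h: "h \<in> T" "h \<in> H" by (metis Int_iff card.empty equals0I nat.distinct(1))
        have "\<exists>e. e \<notin> T \<and> e \<notin> T' \<and> insert e (T - {h}) \<in> spanning_trees n"
          by (rule replacement_edge[OF n2 A(1)[OF TA] T'(1) h(1) _ _ F0T']) (use h A(2)[OF TA] in \<open>auto simp: H_def\<close>)
        then show ?thesis using h unfolding P_def by blast
      qed
      define w where "w T = (SOME x. P T x)" for T
      have w: "P T (w T)" if "T \<in> L (Suc i)" for T unfolding w_def by (rule someI_ex[OF ex[OF that]])
      \<comment> \<open>The new tree contains the inserted edge, and the removed edge lies in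
        \<open>H\<close>; the recorded pair is thus one of at most \<open>n * n\<close> and undoes
        the switching.\<close>
      define \<phi> where "\<phi> T = (insert (snd (w T)) (T - {fst (w T)}), w T)" for T
      have wP: "fst (w T) \<in> T" "fst (w T) \<in> H" "snd (w T) \<notin> T" "snd (w T) \<notin> T'"
          "insert (snd (w T)) (T - {fst (w T)}) \<in> spanning_trees n" if "T \<in> L (Suc i)" for T
        using w[OF that] unfolding P_def by (simp_all add: case_prod_unfold)
      have inj: "inj_on \<phi> (L (Suc i))"
      proof (rule inj_onI)
        fix T S assume TS: "T \<in> L (Suc i)" "S \<in> L (Suc i)" "\<phi> T = \<phi> S"
        have rec: "U = insert (fst (w U)) (insert (snd (w U)) (U - {fst (w U)}) - {snd (w U)})" if "U \<in> L (Suc i)" for U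
          using wP[OF that] by blast
        have e: "insert (snd (w T)) (T - {fst (w T)}) = insert (snd (w S)) (S - {fst (w S)})" "w T = w S"
          using TS(3) unfolding \<phi>_def prod.inject by blast+
        have "T = insert (fst (w T)) (insert (snd (w T)) (T - {fst (w T)}) - {snd (w T)})" by (rule rec[OF TS(1)])
        also have "\<dots> = insert (fst (w S)) (insert (snd (w S)) (S - {fst (w S)}) - {snd (w S)})"
          unfolding e(1) unfolding e(2) by (rule refl)
        also have "\<dots> = S" by (rule rec[OF TS(2), symmetric])
        finally show "T = S" .
      qed
      have "\<phi> ` L (Suc i) \<subseteq> (SIGMA U : L i. H \<times> U)"
      proof
        fix p assume "p \<in> \<phi> ` L (Suc i)"
        then obtain T where T: "T \<in> L (Suc i)" "p = \<phi> T" by blast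
        have TA: "T \<in> \<A>" "card (T \<inter> H) = Suc i" using T by (simp_all add: L_def X_def)
        define U where "U = insert (snd (w T)) (T - {fst (w T)})"
        note wT = wP[OF T(1)]
        have "U \<inter> H = (T \<inter> H) - {fst (w T)}" using wT by (auto simp: U_def H_def)
        then have "card (U \<inter> H) = i" using TA wT finH by simp
        moreover have "F0 \<subseteq> U" using A(2)[OF TA(1)] wT(2) by (auto simp: U_def H_def)
        ultimately have "U \<in> L i" using wT(5) by (simp add: L_def X_def \<A>_def trees_above_def U_def)
        moreover have "snd (w T) \<in> U" by (simp add: U_def)
        ultimately show "p \<in> (SIGMA U : L i. H \<times> U)"
          using wT(2) unfolding T(2) \<phi>_def U_def[symmetric] by (simp add: mem_Times_iff)
      qed
      then have "card (L (Suc i)) \<le> card (SIGMA U : L i. H \<times> U)"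
        by (rule card_inj_on_le[OF inj]) (rule finite_SigmaI[OF finL], use A(3) finH in \<open>simp add: L_def\<close>)
      also have "\<dots> = (\<Sum>U\<in>L i. card (H \<times> U))"
        by (rule card_SigmaI[OF finL]) (use A(3) finH in \<open>simp add: L_def\<close>)
      also have "\<dots> \<le> (\<Sum>U\<in>L i. n * n)"
      proof (rule sum_mono)
        fix U assume "U \<in> L i"
        then have "card U = n - 1" using A(4) by (simp add: L_def)
        moreover have "card H \<le> n" using card_mono[OF finT', of H] card_tree[OF n1 T'(1)] by (simp add: H_def)
        ultimately show "card (H \<times> U) \<le> n * n" by (simp add: card_cartesian_product mult_le_mono)
      qed
      finally show ?thesis by (simp add: power2_eq_square mult_ac)
    qed
    define g where "g = real (card good)"
    have L0: "real (card (L 0)) = g" by (simp add: L_def good_def m g_def)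
    have "real (card (L 1)) \<le> real (n ^ 2 * card (L 0))" using switch[of 0] by (simp only: of_nat_le_iff One_nat_def)
    then have L1: "real (card (L 1)) \<le> real n ^ 2 * g" by (simp add: L0)
    have "real (card (L 2)) \<le> real (n ^ 2 * card (L 1))" using switch[of 1] by (simp only: of_nat_le_iff numeral_2_eq_2 One_nat_def)
    then have "real (card (L 2)) \<le> real n ^ 2 * real (card (L 1))" by simp
    also have "\<dots> \<le> real n ^ 2 * (real n ^ 2 * g)" using L1 by (rule mult_left_mono) simp
    also have "\<dots> = real n ^ 4 * g" by (simp flip: power_add mult.assoc)
    finally have L2: "real (card (L 2)) \<le> real n ^ 4 * g" .
    have "{T \<in> \<A>. X T < 3} = L 0 \<union> (L 1 \<union> L 2)" by (auto simp: L_def)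
    then have "card {T \<in> \<A>. X T < 3} = card (L 0 \<union> (L 1 \<union> L 2))" by simp
    also have "\<dots> \<le> card (L 0) + (card (L 1) + card (L 2))"
      using card_Un_le[of "L 0" "L 1 \<union> L 2"] card_Un_le[of "L 1" "L 2"] by linarith
    finally have "real (card {T \<in> \<A>. X T < 3}) \<le> real (card (L 0)) + (real (card (L 1)) + real (card (L 2)))"
      by (simp flip: of_nat_add)
    also have "\<dots> \<le> g + (real n ^ 2 * g + real n ^ 4 * g)" using L0 L1 L2 by linarith
    also have "\<dots> \<le> real n ^ 4 * g + (real n ^ 4 * g + real n ^ 4 * g)"
    proof (intro add_mono order_refl)
      have g0: "g \<ge> 0" by (simp add: g_def)
      have "1 \<le> real n ^ 4" using n by simp
      then have "1 * g \<le> real n ^ 4 * g" using g0 by (rule mult_right_mono)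
      then show "g \<le> real n ^ 4 * g" by simp
      have "real n ^ 2 \<le> real n ^ 4" using n by (intro power_increasing) auto
      then show "real n ^ 2 * g \<le> real n ^ 4 * g" using g0 by (rule mult_right_mono)
    qed
    finally have lt3: "real (card {T \<in> \<A>. X T < 3}) \<le> 3 * real n ^ 4 * g" by linarith
    have "real 3 * real (card {T \<in> \<A>. 3 \<le> X T}) \<le> (real n - 1 - real t + real m) * (2 / n * real (card \<A>))"
      using markov[of 3] .
    also have "\<dots> \<le> real n * (2 / n * real (card \<A>))"
      using F0(3) m by (intro mult_right_mono) auto
    also have "\<dots> = 2 * real (card \<A>)" using n by simp
    finally have "3 * real (card {T \<in> \<A>. 3 \<le> X T}) \<le> 2 * real (card \<A>)" by simp
    then have "real (card \<A>) \<le> 9 * real n ^ 4 * g" using lt3 split[of 3] by linarith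
    then show ?thesis unfolding g_def .
  qed
  then show ?thesis unfolding good \<A>_def .
qed

section \<open>Matchings\<close>

definition disjoint_edges :: "nat set set \<Rightarrow> bool" where
  "disjoint_edges D \<longleftrightarrow> (\<forall>e\<in>D. \<forall>e'\<in>D. e \<noteq> e' \<longrightarrow> e \<inter> e' = {})"

lemma disjoint_edgesD: "disjoint_edges D \<Longrightarrow> e \<in> D \<Longrightarrow> e' \<in> D \<Longrightarrow> e \<noteq> e' \<Longrightarrow> e \<inter> e' = {}"
  unfolding disjoint_edges_def by blast

text \<open>Two adjacent edges lie in a component with at least three vertices, and splitting such a
  part costs 3/2 instead of 2.\<close>

lemma comp_prod_adjacent_edges:
  assumes n: "n \<ge> 2" and V: "forest_on n V" "card V = Suc s" and e: "e \<in> V" "e' \<in> V" "e \<noteq> e'" "e \<inter> e' \<noteq> {}"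
  shows "2 * comp_prod n V \<le> 3 * max_prod n s"
proof -
  have VK: "V \<subseteq> complete_graph_edges n" using V by (simp add: forest_on_def)
  obtain a where a: "a \<in> e" "a \<in> e'" using e(4) by blast
  have c2: "card e = 2" "card e' = 2" "e \<subseteq> {1..n}" "e' \<subseteq> {1..n}"
    using e(1,2) VK by (auto simp: complete_graph_edges_def)
  have fin: "finite e" "finite e'" using c2 finite_subset by blast+
  have sub: "f \<subseteq> component n V a" if f: "f \<in> V" "a \<in> f" for f
  proof
    fix y assume y: "y \<in> f"
    obtain u v where uv: "f = {u, v}" "u \<noteq> v" "u \<in> {1..n}" "v \<in> {1..n}"
      by (rule complete_edgeE[of f n]) (use f VK in blast)
    have "(a, y) \<in> (adj_rel V)\<^sup>*"
    proof (cases "a = y")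
      case False
      then have "f = {a, y}" using uv f(2) y by auto
      then show ?thesis using f(1) conn_edge by simp
    qed simp
    then show "y \<in> component n V a" using y uv by (auto simp: component_def)
  qed
  have "e \<union> e' \<subseteq> component n V a" using sub e(1,2) a by blast
  then have "card (e \<union> e') \<le> card (component n V a)" by (rule card_mono[rotated]) simp
  moreover have "card e < card (e \<union> e')"
  proof (rule psubset_card_mono)
    have "\<not> e' \<subseteq> e" using card_subset_eq[OF fin(1), of e'] c2 e(3) by auto
    then show "e \<subset> e \<union> e'" by blast
  qed (use fin in simp)
  ultimately have c3: "3 \<le> card (component n V a)" using c2 by linarith
  have an: "a \<in> {1..n}" using a c2 by blast
  obtain xs where xs: "xs \<in> parts n (n - card V)" "prod_list xs = comp_prod n V" "set xs = card ` graph_components n V"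
    by (rule forest_parts[OF V(1)])
  have "Suc s < n" using forest_card_less[OF _ V(1)] V(2) n by simp
  moreover have "card (component n V a) \<in> set xs" using xs(3) component_in[OF an] by blast
  ultimately show ?thesis using max_prod_step_part(2)[of xs n s "card (component n V a)"] xs(1,2) V(2) c3 by simp
qed

lemma trees_above_adjacent_edges:
  assumes n: "n \<ge> 2" and V: "card V = Suc s" and e: "e \<in> V" "e' \<in> V" "e \<noteq> e'" "e \<inter> e' \<noteq> {}"
  shows "real (card (trees_above n V)) \<le> (3/2) / n * tree_bound n s"
proof (cases "forest_on n V")
  case True
  have s: "s < n" using forest_card_less[OF _ True] V n by simp
  have "real (2 * comp_prod n V) \<le> real (3 * max_prod n s)"
    using comp_prod_adjacent_edges[OF n True V e] by (simp only: of_nat_le_iff)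
  then have "real (comp_prod n V) \<le> 3/2 * real (max_prod n s)" by simp
  then have "real (comp_prod n V) * (real n ^ (n - 2) / real n ^ Suc s) \<le> 3/2 * real (max_prod n s) * (real n ^ (n - 2) / real n ^ Suc s)"
    by (rule mult_right_mono) simp
  then show ?thesis using s unfolding card_trees_above_eq[OF n True] V by (simp add: tree_bound_def mult_ac)
next
  case False
  then show ?thesis using trees_above_nonforest tree_bound_nonneg by simp
qed

lemma disjoint_edges_forest:
  assumes D: "D \<subseteq> complete_graph_edges n" "disjoint_edges D"
  shows "forest_on n D"
  unfolding forest_on_def no_cycle_iff_bridges bridges_def
proof (intro conjI allI impI notI)
  fix u v assume uv: "{u, v} \<in> D" "u \<noteq> v" "(u, v) \<in> (adj_rel (D - {{u, v}}))\<^sup>*"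
  then obtain w where "(u, w) \<in> adj_rel (D - {{u, v}})" by (meson converse_rtranclE)
  then have "{u, w} \<in> D" "{u, w} \<noteq> {u, v}" by (simp_all add: adj_rel_def)
  then have "{u, w} \<inter> {u, v} = {}" using disjoint_edgesD[OF D(2), of "{u, w}" "{u, v}"] uv(1) by blast
  then show False by simp
qed (rule D)

lemma card_Union_disjoint_edges:
  assumes "D \<subseteq> complete_graph_edges n" "disjoint_edges D"
  shows "card (\<Union>D) = 2 * card D"
proof -
  have "card (\<Union>D) = (\<Sum>e\<in>D. card e)"
  proof (rule card_Union_disjoint)
    show "pairwise disjnt D" using disjoint_edgesD[OF assms(2)] by (simp add: pairwise_def disjnt_def)
    show "finite e" if "e \<in> D" for e
    proof -
      have "e \<subseteq> {1..n}" using assms(1) that by (auto simp: complete_graph_edges_def)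
      then show ?thesis using finite_subset by blast
    qed
  qed
  also have "\<dots> = (\<Sum>e\<in>D. 2)" by (rule sum.cong) (use assms in \<open>auto simp: complete_graph_edges_def\<close>)
  finally show ?thesis by simp
qed

text \<open>Every vertex outside \<open>U\<close> is a component by itself; many components mean few
  edges.\<close>

lemma card_forest_within:
  assumes E: "forest_on n E" and U: "U \<subseteq> {1..n}" "\<And>e. e \<in> E \<Longrightarrow> e \<subseteq> U"
  shows "card E \<le> card U"
proof -
  have "component n E v = {v}" if v: "v \<in> {1..n} - U" for v
  proof -
    have only: "w = v" if w: "(v, w) \<in> (adj_rel E)\<^sup>*" for w
    proof (rule converse_rtranclE[OF w])
      fix y assume "(v, y) \<in> adj_rel E"
      then have "{v, y} \<in> E" by (simp add: adj_rel_def)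
      then have "{v, y} \<subseteq> U" by (rule U(2))
      then show "w = v" using v by simp
    qed simp
    show ?thesis
    proof
      show "component n E v \<subseteq> {v}"
      proof
        fix u assume "u \<in> component n E v"
        then have "(v, u) \<in> (adj_rel E)\<^sup>*" by (simp add: component_def)
        then have "u = v" by (rule only)
        then show "u \<in> {v}" by simp
      qed
      show "{v} \<subseteq> component n E v" using component_self v by simp
    qed
  qed
  then have "(\<lambda>v. {v}) ` ({1..n} - U) \<subseteq> graph_components n E"
    unfolding graph_components_eq by force
  then have "card ((\<lambda>v. {v}) ` ({1..n} - U)) \<le> ncomp n E" unfolding ncomp_def by (rule card_mono[rotated]) simp
  moreover have "card ((\<lambda>v. {v}) ` ({1..n} - U)) = card ({1..n} - U)" by (rule card_image) simp
  moreover have "card ({1..n} - U) = n - card U" using U(1) finite_subset[OF U(1)] by (simp add: card_Diff_subset)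
  moreover have "ncomp n E + card E = n" using E by (simp add: forest_iff_rank)
  moreover have "card U \<le> n" using card_mono[OF _ U(1)] by simp
  ultimately show ?thesis by linarith
qed

section \<open>Intersecting families of spanning trees\<close>

lemma edge_family_trees:
  assumes "n \<ge> 2"
  shows "edge_family (complete_graph_edges n) (spanning_trees n) (tree_bound n) n"
proof
  show "T \<subseteq> complete_graph_edges n" if "T \<in> spanning_trees n" for T using that by (rule spanning_tree_edges)
  show "card T \<le> n" if "T \<in> spanning_trees n" for T using card_tree[OF _ that] assms by simp
  show "tree_bound n (Suc s) \<le> 2 / real n * tree_bound n s" for s by (rule tree_bound_step)
  show "real (card {T \<in> spanning_trees n. S \<subseteq> T}) \<le> tree_bound n (card S)" for S
    using card_trees_above_le[OF assms, of S] by (simp add: trees_above_def)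
qed (use assms in \<open>simp_all add: tree_bound_nonneg\<close>)

lemma exp_beats_quartic:
  "\<exists>N. \<forall>n\<ge>N. 9 * real n ^ 4 * (1/2 * exp (- 2 * real (n div 1024))) < 1"
proof (intro exI allI impI)
  \<comment> \<open>The degree 5 term of the exponential series beats the quartic; given
    \<open>n \<le> 2048 * h\<close>, the constant 17 works because
    \<open>17 * 32 / 120 > 9 / 2\<close>.\<close>
  fix n :: nat assume n: "n \<ge> 1024 * (17 * 2048 ^ 4)"
  define h where "h = n div 1024"
  have h17: "17 * 2048 ^ 4 \<le> h" using div_le_mono[OF n, of 1024] by (simp add: h_def)
  have hpos: "real h > 0" using h17 by simp
  have "n < 1024 * (h + 1)" unfolding h_def by (metis add.commute plus_1_eq_Suc dividend_less_times_div zero_less_numeral mult_Suc_right)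
  then have "n \<le> 2048 * h" using h17 by simp
  then have "real n \<le> real (2048 * h)" by (simp only: of_nat_le_iff)
  then have "real n ^ 4 \<le> (2048 * real h) ^ 4" by (intro power_mono) auto
  then have n4: "real n ^ 4 \<le> 2048 ^ 4 * real h ^ 4" by (simp add: power_mult_distrib)
  have "(\<Sum>j\<in>{5}. (2 * real h) ^ j / fact j) \<le> exp (2 * real h)" by (rule sum_exp_le) auto
  then have e5: "(2 * real h) ^ 5 / 120 \<le> exp (2 * real h)" by (simp add: fact_numeral)
  have "real (17 * 2048 ^ 4) \<le> real h" using h17 by (simp only: of_nat_le_iff)
  then have h17r: "17 * 2048 ^ 4 \<le> real h" by simp
  have "9/2 * (2048 ^ 4 * real h ^ 4) < (32/120 * (17 * 2048 ^ 4)) * real h ^ 4"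
    using hpos by simp
  also have "\<dots> \<le> (32/120 * real h) * real h ^ 4"
    using h17r by (intro mult_right_mono mult_left_mono) auto
  also have "\<dots> = (2 * real h) ^ 5 / 120" by (simp add: power_mult_distrib eval_nat_numeral)
  also note e5
  finally have "9/2 * real n ^ 4 < exp (2 * real h)" using n4 by linarith
  then have "9/2 * real n ^ 4 * exp (- 2 * real h) < exp (2 * real h) * exp (- 2 * real h)"
    by (rule mult_strict_right_mono) simp
  then show "9 * real n ^ 4 * (1/2 * exp (- 2 * real (n div 1024))) < 1"
    by (simp add: h_def flip: exp_add)
qed

text \<open>The excluded share is relative to the number \<open>N\<close> of trees above
  \<open>F0\<close>, which may be below the bound \<open>M\<close>; this is harmless because
  \<open>N - N / (9 * n ^ 4)\<close> increases with \<open>N\<close>.\<close>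

lemma family_with_center:
  assumes n: "n \<ge> 3" and t: "2 \<le> t" "t < n" and F: "F \<subseteq> spanning_trees n" "intersecting t F"
    and F0: "card F0 = t" and small: "real (card {T \<in> F. \<not> F0 \<subseteq> T}) \<le> \<epsilon> * tree_bound n t"
    and \<epsilon>: "9 * real n ^ 4 * \<epsilon> < 1"
  shows "F \<subseteq> trees_above n F0 \<or> real (card F) < tree_bound n t"
proof (cases "F \<subseteq> trees_above n F0")
  case False
  define M where "M = tree_bound n t"
  have Mpos: "M > 0" unfolding M_def by (rule tree_bound_pos[OF t(2)])
  have finF: "finite F" by (rule finite_subset[OF F(1)]) simp
  obtain T' where T': "T' \<in> F" "T' \<in> spanning_trees n" "\<not> F0 \<subseteq> T'"
    using False F(1) unfolding trees_above_def by blast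
  have n4: "real n ^ 4 \<ge> 1" using n by simp
  define N where "N = real (card (trees_above n F0))"
  have NM: "N \<le> M" using card_trees_above_le[of n F0] n F0 by (simp add: N_def M_def)
  have "9 * real n ^ 4 * real (card {T \<in> F. F0 \<subseteq> T}) \<le> (9 * real n ^ 4 - 1) * N"
  proof (cases "forest_on n F0")
    case True
    define miss where "miss = {T \<in> trees_above n F0. card (T \<inter> T') < t}"
    have miss: "N \<le> 9 * real n ^ 4 * real (card miss)"
      unfolding miss_def N_def by (rule missing_trees[OF n True F0 t(1) T'(2,3)])
    have "{T \<in> F. F0 \<subseteq> T} \<subseteq> trees_above n F0 - miss"
    proof
      fix T assume "T \<in> {T \<in> F. F0 \<subseteq> T}"
      then have T: "T \<in> F" "F0 \<subseteq> T" by simp_all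
      have "t \<le> card (T \<inter> T')" using F(2) T(1) T'(1) unfolding intersecting_def by blast
      then show "T \<in> trees_above n F0 - miss" using T F(1) by (auto simp: trees_above_def miss_def)
    qed
    then have "card {T \<in> F. F0 \<subseteq> T} \<le> card (trees_above n F0 - miss)" by (rule card_mono[rotated]) simp
    also have "\<dots> = card (trees_above n F0) - card miss"
      by (rule card_Diff_subset) (auto simp: miss_def)
    finally have "real (card {T \<in> F. F0 \<subseteq> T}) \<le> N - real (card miss)"
      using card_mono[OF finite_trees_above, of miss n F0] by (simp add: N_def miss_def)
    then have "9 * real n ^ 4 * real (card {T \<in> F. F0 \<subseteq> T}) \<le> 9 * real n ^ 4 * (N - real (card miss))"
      by (rule mult_left_mono) simp
    then show ?thesis using miss by (simp add: algebra_simps)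
  next
    case False
    then have z: "trees_above n F0 = {}" by (rule trees_above_nonforest)
    moreover have "{T \<in> F. F0 \<subseteq> T} \<subseteq> trees_above n F0" using F(1) unfolding trees_above_def by blast
    ultimately have e: "{T \<in> F. F0 \<subseteq> T} = {}" by blast
    show ?thesis unfolding e N_def z by simp
  qed
  also have "\<dots> \<le> (9 * real n ^ 4 - 1) * M" using NM n4 by (intro mult_left_mono) auto
  finally have 1: "9 * real n ^ 4 * real (card {T \<in> F. F0 \<subseteq> T}) \<le> (9 * real n ^ 4 - 1) * M" .
  have "9 * real n ^ 4 * real (card {T \<in> F. \<not> F0 \<subseteq> T}) \<le> 9 * real n ^ 4 * (\<epsilon> * M)"
    using small by (intro mult_left_mono) (auto simp: M_def)
  also have "\<dots> = (9 * real n ^ 4 * \<epsilon>) * M" by simp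
  also have "\<dots> < 1 * M" using \<epsilon> Mpos by (rule mult_strict_right_mono)
  finally have 2: "9 * real n ^ 4 * real (card {T \<in> F. \<not> F0 \<subseteq> T}) < M" by simp
  have "F = {T \<in> F. F0 \<subseteq> T} \<union> {T \<in> F. \<not> F0 \<subseteq> T}" by blast
  then have "card F = card ({T \<in> F. F0 \<subseteq> T} \<union> {T \<in> F. \<not> F0 \<subseteq> T})" by (rule arg_cong)
  also have "\<dots> \<le> card {T \<in> F. F0 \<subseteq> T} + card {T \<in> F. \<not> F0 \<subseteq> T}" by (rule card_Un_le)
  finally have "real (card F) \<le> real (card {T \<in> F. F0 \<subseteq> T}) + real (card {T \<in> F. \<not> F0 \<subseteq> T})" by (simp flip: of_nat_add)
  then have "9 * real n ^ 4 * real (card F) \<le> 9 * real n ^ 4 * (real (card {T \<in> F. F0 \<subseteq> T}) + real (card {T \<in> F. \<not> F0 \<subseteq> T}))"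
    by (rule mult_left_mono) simp
  also have "\<dots> = 9 * real n ^ 4 * real (card {T \<in> F. F0 \<subseteq> T}) + 9 * real n ^ 4 * real (card {T \<in> F. \<not> F0 \<subseteq> T})"
    by (rule distrib_left)
  also have "\<dots> < (9 * real n ^ 4 - 1) * M + M" using 1 2 by linarith
  also have "\<dots> = 9 * real n ^ 4 * M" by (simp add: algebra_simps)
  finally have "real (card F) < M" using n4 by (simp add: mult_less_cancel_left)
  then show ?thesis by (simp add: M_def)
qed simp

text \<open>The union bound over exchanges of level \<open>k\<close> is
  \<open>(t * p) ^ k / fact k\<close>, so \<open>t * p\<close> decides. With \<open>p\<close> equal
  to \<open>2 / n\<close>, \<open>(9/8) / n\<close> or \<open>(5/6) / n\<close> it stays at most
  98/100 except when \<open>t / n\<close> lies between 49/100 and 1/2.\<close>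

lemma step_ratio:
  assumes "n \<ge> 2" "t < n"
  obtains p where "p \<ge> 0" "\<And>s. t \<le> s \<Longrightarrow> tree_bound n (Suc s) \<le> p * tree_bound n s" "real t * p \<le> 1"
    "100 * t \<le> 49 * n \<or> n \<le> 2 * t \<Longrightarrow> real t * p \<le> 98/100"
proof -
  consider "2 * t < n" | "n \<le> 2 * t" "5 * t \<le> 4 * n" | "4 * n < 5 * t" by linarith
  then show ?thesis
  proof cases
    case 1
    have "real (2 * t) < real n" using 1 by (simp only: of_nat_less_iff)
    then have a: "real t * (2 / n) \<le> 1" using assms by (simp add: field_simps)
    have b: "real t * (2 / n) \<le> 98/100" if "100 * t \<le> 49 * n \<or> n \<le> 2 * t"
    proof -
      have "real (100 * t) \<le> real (49 * n)" using that 1 by (simp only: of_nat_le_iff) linarith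
      then show ?thesis using assms by (simp add: field_simps)
    qed
    show ?thesis by (rule that[OF _ tree_bound_step a b]) simp
  next
    case 2
    have "real (5 * t) \<le> real (4 * n)" using 2 by (simp only: of_nat_le_iff)
    then have a: "real t * ((9/8) / n) \<le> 9/10" using assms by (simp add: field_simps)
    have s: "tree_bound n (Suc s) \<le> (9/8) / n * tree_bound n s" if "t \<le> s" for s
      by (rule tree_bound_step_half) (use that 2 in linarith)
    show ?thesis by (rule that[OF _ s]) (use a in auto)
  next
    case 3
    have "real t \<le> real n" using assms by simp
    then have a: "real t * ((5/6) / n) \<le> 5/6" using assms by (simp add: field_simps)
    have s: "tree_bound n (Suc s) \<le> (5/6) / n * tree_bound n s" if "t \<le> s" for s
      by (rule tree_bound_step_large) (use that 3 in linarith)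
    show ?thesis by (rule that[OF _ s]) (use a in auto)
  qed
qed

lemma steps_pow:
  fixes M :: "nat \<Rightarrow> real"
  assumes "p \<ge> 0" "\<And>s. t \<le> s \<Longrightarrow> M (Suc s) \<le> p * M s"
  shows "M (t + i) \<le> p ^ i * M t"
proof (induction i)
  case (Suc i)
  have "M (t + Suc i) \<le> p * M (t + i)" using assms(2)[of "t + i"] by simp
  also have "\<dots> \<le> p * (p ^ i * M t)" using Suc assms(1) by (rule mult_left_mono)
  finally show ?case by simp
qed simp

text \<open>
  When \<open>t\<close> is just below \<open>n / 2\<close> and \<open>D\<close> is a matching with \<open>t + 2\<close> edges, the trees containing
  at least \<open>t + 1\<close> edges of \<open>D\<close> form a family that is smaller than the extremal one only by a
  factor \<open>1 - O(1/n)\<close>. Hence this range needs an exact argument.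
\<close>

lemma all_but_one_of_matching:
  assumes n: "n \<ge> 2" and t: "t < n" and F: "F \<subseteq> spanning_trees n"
    and D: "D \<subseteq> complete_graph_edges n" "card D = t + 2" "disjoint_edges D"
    and all: "\<And>T. T \<in> F \<Longrightarrow> t + 1 \<le> card (T \<inter> D)"
  shows "real (card F) < tree_bound n t"
proof -
  define M where "M = tree_bound n t"
  have Mpos: "M > 0" unfolding M_def by (rule tree_bound_pos[OF t])
  have finD: "finite D" by (rule finite_edges[OF D(1)])
  define A where "A f = trees_above n (D - {f})" for f
  have cA: "real (card (A f)) \<le> 2 / n * M" if "f \<in> D" for f
  proof -
    have "card (D - {f}) = Suc t" using that finD D(2) by simp
    then show ?thesis using card_trees_above_le[OF n, of "D - {f}"] tree_bound_step[of n t]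
      by (simp add: A_def M_def)
  qed
  obtain T0 where T0: "T0 \<in> trees_above n D"
    using trees_above_nonempty[OF n disjoint_edges_forest[OF D(1,3)]] by blast
  have T0A: "T0 \<in> A f" for f using T0 unfolding A_def trees_above_def by blast
  have "D \<noteq> {}" using D(2) by auto
  then obtain f0 where f0: "f0 \<in> D" by blast
  \<comment> \<open>A tree above all of \<open>D\<close> lies in every \<open>A f\<close> but is
    counted only once, which makes the final inequality strict.\<close>
  have "F \<subseteq> A f0 \<union> (\<Union>f\<in>D - {f0}. A f - {T0})"
  proof
    fix T assume T: "T \<in> F"
    have "card D = card (D \<inter> T) + card (D - T)" by (rule card_Int_Diff[OF finD])
    then have c1: "card (D - T) \<le> 1" using all[OF T] D(2) by (simp add: Int_commute)
    have "\<exists>f\<in>D. D - T \<subseteq> {f}"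
    proof (cases "D - T = {}")
      case True
      then show ?thesis using f0 by blast
    next
      case False
      then obtain f where f: "f \<in> D - T" by blast
      have "D - T = {f}"
      proof (rule ccontr)
        assume "D - T \<noteq> {f}"
        then obtain g where "g \<in> D - T" "g \<noteq> f" using f by blast
        then have "card {f, g} \<le> card (D - T)" using f finD by (intro card_mono) auto
        then show False using c1 \<open>g \<noteq> f\<close> by simp
      qed
      then show ?thesis using f by blast
    qed
    then obtain f where f: "f \<in> D" "D - {f} \<subseteq> T" by blast
    then have TA: "T \<in> A f" using T F unfolding A_def trees_above_def by blast
    show "T \<in> A f0 \<union> (\<Union>f\<in>D - {f0}. A f - {T0})"
    proof (cases "T = T0 \<or> f = f0")
      case True
      then show ?thesis using T0A TA by blast
    next
      case False
      then show ?thesis using TA f(1) by blast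
    qed
  qed
  then have "card F \<le> card (A f0 \<union> (\<Union>f\<in>D - {f0}. A f - {T0}))"
    by (rule card_mono[rotated]) (use finD in \<open>simp add: A_def\<close>)
  also have "\<dots> \<le> card (A f0) + card (\<Union>f\<in>D - {f0}. A f - {T0})" by (rule card_Un_le)
  also have "\<dots> \<le> card (A f0) + (\<Sum>f\<in>D - {f0}. card (A f - {T0}))"
    using card_UN_le[of "D - {f0}" "\<lambda>f. A f - {T0}"] finD by simp
  finally have "real (card F) \<le> real (card (A f0)) + (\<Sum>f\<in>D - {f0}. real (card (A f - {T0})))"
    by (simp flip: of_nat_sum of_nat_add)
  also have "\<dots> \<le> 2 / n * M + (\<Sum>f\<in>D - {f0}. 2 / n * M - 1)"
  proof (intro add_mono sum_mono)
    fix f assume f: "f \<in> D - {f0}"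
    have "Suc (card (A f - {T0})) = card (A f)" using T0A by (intro card_Suc_Diff1) (simp_all add: A_def)
    then have "real (card (A f - {T0})) = real (card (A f)) - 1" by linarith
    then show "real (card (A f - {T0})) \<le> 2 / n * M - 1" using cA[of f] f by simp
  qed (rule cA[OF f0])
  also have "\<dots> = 2 / n * M + real (t + 1) * (2 / n * M - 1)" using f0 finD D(2) by simp
  also have "\<dots> < real (t + 2) * (2 / n * M)"
  proof -
    have "x + real (t + 1) * (x - 1) < real (t + 2) * x" for x :: real by (simp add: algebra_simps)
    then show ?thesis .
  qed
  also have "\<dots> \<le> M"
  proof -
    \<comment> \<open>A matching of \<open>t + 2\<close> edges occupies \<open>2 * (t + 2)\<close>
      vertices, hence \<open>(t + 2) * (2 / n)\<close> is at most 1.\<close>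
    have "2 * (t + 2) = card (\<Union>D)" using card_Union_disjoint_edges[OF D(1,3)] D(2) by simp
    also have "\<dots> \<le> card {1..n}" by (rule card_mono) (use D(1) in \<open>auto simp: complete_graph_edges_def\<close>)
    finally have "2 * (t + 2) \<le> n" by simp
    then have le: "real (2 * (t + 2)) \<le> real n" by (simp only: of_nat_le_iff)
    have npos: "real n > 0" using n by simp
    have "real (2 * (t + 2)) / real n \<le> 1" using le by (simp only: divide_le_eq_1_pos[OF npos])
    then have "real (2 * (t + 2)) / real n * M \<le> 1 * M" using Mpos by (intro mult_right_mono) simp_all
    moreover have "real (t + 2) * (2 / real n * M) = real (2 * (t + 2)) / real n * M" by simp
    ultimately show ?thesis by linarith
  qed
  finally show ?thesis by (simp add: M_def)
qed

text \<open>Members above \<open>V = D - {f}\<close> need \<open>m\<close> edges of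
  \<open>H = T' - V\<close>. An edge touching the matching \<open>V\<close> has the smaller factor
  \<open>(3/2) / n\<close>; the edges of \<open>H\<close> avoiding it form a forest on at most
  \<open>n / 50\<close> vertices, so there are few. As \<open>H\<close> has about
  \<open>n - t\<close> edges, that is little more than half of \<open>n\<close>, Markov's inequality
  leaves a fraction 777/1000 of \<open>tree_bound n (Suc t)\<close>, and twice 777/1000 is below
  156/100.\<close>

lemma near_half_degree:
  assumes n: "n \<ge> 1000" and t: "49 * n < 100 * t" "2 * t < n" and F: "F \<subseteq> spanning_trees n" "intersecting t F"
    and D: "D \<subseteq> complete_graph_edges n" "card D = t + 2" "disjoint_edges D"
    and T': "T' \<in> F" and f: "f \<in> D" "card (T' \<inter> (D - {f})) < t"
  shows "real (card {T \<in> F. D - {f} \<subseteq> T}) \<le> (156/100) / n * tree_bound n t"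
proof -
  have n2: "n \<ge> 2" and n1: "n \<ge> 1" using n by simp_all
  define V where "V = D - {f}"
  define H where "H = T' - V"
  define m where "m = t - card (T' \<inter> V)"
  define M' where "M' = tree_bound n (Suc t)"
  have M'0: "M' \<ge> 0" by (simp add: M'_def tree_bound_nonneg)
  have finD: "finite D" by (rule finite_edges[OF D(1)])
  have finV: "finite V" using finD by (simp add: V_def)
  have cV: "card V = Suc t" using finD D(2) f(1) by (simp add: V_def)
  have m1: "m \<ge> 1" and mt: "m + card (T' \<inter> V) = t" using f(2) by (simp_all add: m_def V_def)
  have T's: "T' \<in> spanning_trees n" using T' F(1) by blast
  have T'K: "T' \<subseteq> complete_graph_edges n" by (rule spanning_tree_edges[OF T's])
  have finT': "finite T'" by (rule finite_edges[OF T'K])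
  have finH: "finite H" using finT' by (simp add: H_def)
  have sub: "{T \<in> F. V \<subseteq> T} \<subseteq> {T \<in> trees_above n V. m \<le> card (T \<inter> H)}"
  proof
    fix T assume "T \<in> {T \<in> F. V \<subseteq> T}"
    then have T: "T \<in> F" "V \<subseteq> T" by simp_all
    have "t \<le> card (T \<inter> T')" using F(2) T(1) T' unfolding intersecting_def by blast
    also have "\<dots> \<le> card ((T' \<inter> V) \<union> (T \<inter> H))" by (rule card_mono) (use finV finH in \<open>auto simp: H_def\<close>)
    also have "\<dots> \<le> card (T' \<inter> V) + card (T \<inter> H)" by (rule card_Un_le)
    finally have "m \<le> card (T \<inter> H)" using mt by linarith
    then show "T \<in> {T \<in> trees_above n V. m \<le> card (T \<inter> H)}" using T F(1) by (auto simp: trees_above_def)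
  qed
  define H0 where "H0 = {e \<in> H. e \<inter> \<Union>V = {}}"
  have "real m * real (card {T \<in> F. V \<subseteq> T}) \<le> real m * real (card {T \<in> trees_above n V. m \<le> card (T \<inter> H)})"
    using card_mono[OF _ sub] by (intro mult_left_mono) auto
  also have "\<dots> \<le> (\<Sum>e\<in>H. real (card {T \<in> trees_above n V. e \<in> T}))"
    by (rule markov_inter) (use finH in auto)
  also have "\<dots> \<le> (\<Sum>e\<in>H. (3/2) / n * M' + (if e \<in> H0 then (1/2) / n * M' else 0))"
  proof (rule sum_mono)
    fix e assume e: "e \<in> H"
    have eV: "e \<notin> V" using e by (simp add: H_def)
    have eq: "{T \<in> trees_above n V. e \<in> T} = trees_above n (insert e V)" by (auto simp: trees_above_def)
    have ci: "card (insert e V) = Suc (Suc t)" using eV finV cV by simp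
    show "real (card {T \<in> trees_above n V. e \<in> T}) \<le> (3/2) / n * M' + (if e \<in> H0 then (1/2) / n * M' else 0)"
    proof (cases "e \<in> H0")
      case True
      have "real (card (trees_above n (insert e V))) \<le> tree_bound n (Suc (Suc t))"
        using card_trees_above_le[OF n2, of "insert e V"] ci by simp
      also have "\<dots> \<le> 2 / n * M'" unfolding M'_def by (rule tree_bound_step)
      also have "\<dots> = (3/2) / n * M' + (1/2) / n * M'" by (simp add: field_simps)
      finally show ?thesis using True eq by simp
    next
      case False
      then obtain e' where e': "e' \<in> V" "e \<inter> e' \<noteq> {}" using e unfolding H0_def by blast
      then have "e \<noteq> e'" using eV by blast
      then have "real (card (trees_above n (insert e V))) \<le> (3/2) / n * M'"
        unfolding M'_def using e' by (intro trees_above_adjacent_edges[OF n2 ci, of e e']) auto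
      then show ?thesis using False eq by simp
    qed
  qed
  also have "\<dots> = card H * ((3/2) / n * M') + card H0 * ((1/2) / n * M')"
    using finH by (simp add: sum.distrib sum.If_cases H0_def Int_def)
  also have "\<dots> = ((3/2 * card H + 1/2 * card H0) / n) * M'"
    by (simp add: add_divide_distrib algebra_simps)
  also have "\<dots> \<le> (real m * (777/1000)) * M'"
  proof (rule mult_right_mono[OF _ M'0])
    have "card T' = card (T' \<inter> V) + card H" unfolding H_def by (rule card_Int_Diff[OF finT'])
    then have "card H + t + 1 = n + m" using mt card_tree[OF n1 T's] n1 by simp
    then have "real (card H + t + 1) = real (n + m)" by (simp only:)
    then have cH: "real (card H) = real n + real m - real t - 1" by simp
    have "card H0 \<le> card ({1..n} - \<Union>V)"
    proof (rule card_forest_within)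
      show "forest_on n H0" by (rule forest_subset[OF tree_forest[OF T's]]) (auto simp: H0_def H_def)
      show "e \<subseteq> {1..n} - \<Union>V" if "e \<in> H0" for e
        using that T'K by (auto simp: H0_def H_def complete_graph_edges_def)
    qed simp
    also have "\<dots> = n - 2 * Suc t"
    proof -
      have VK: "V \<subseteq> complete_graph_edges n" "disjoint_edges V"
        using D(1,3) by (auto simp: V_def disjoint_edges_def)
      have "\<Union>V \<subseteq> {1..n}" using VK(1) by (auto simp: complete_graph_edges_def)
      then show ?thesis using card_Union_disjoint_edges[OF VK] cV finite_subset[of "\<Union>V" "{1..n}"]
        by (simp add: card_Diff_subset)
    qed
    finally have h: "card H0 \<le> n - 2 * Suc t" .
    have "real (49 * n) < real (100 * t)" using t(1) by (simp only: of_nat_less_iff)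
    then have "49 * real n < 100 * real t" by (simp only: of_nat_mult of_nat_numeral)
    then have tr: "real t > 49/100 * real n" by linarith
    have cH0: "real (card H0) \<le> 2/100 * real n"
    proof (cases "2 * Suc t \<le> n")
      case True
      then have "card H0 + 2 * Suc t \<le> n" using h by (simp only: le_diff_conv2)
      then have "real (card H0 + 2 * Suc t) \<le> real n" by (simp only: of_nat_le_iff)
      then have "real (card H0) + 2 * real t + 2 \<le> real n" by simp
      then show ?thesis using tr by linarith
    next
      case False
      then have "card H0 = 0" using h by simp
      then show ?thesis by simp
    qed
    have rn: "real n \<ge> 1000" and rm: "real m \<ge> 1" using n m1 by simp_all
    have "3/2 * real (card H) + 1/2 * real (card H0) \<le> 775/1000 * real n + 3/2 * real m"
      using cH cH0 tr by linarith
    also have "\<dots> \<le> 775/1000 * (real n * real m) + 2/1000 * (real n * real m)"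
    proof (rule add_mono)
      have "real n * 1 \<le> real n * real m" using rm by (intro mult_left_mono) auto
      then show "775/1000 * real n \<le> 775/1000 * (real n * real m)" by simp
      have "1000 * real m \<le> real n * real m" using rn by (intro mult_right_mono) auto
      then show "3/2 * real m \<le> 2/1000 * (real n * real m)" by simp
    qed
    finally show "(3/2 * real (card H) + 1/2 * real (card H0)) / real n \<le> real m * (777/1000)"
      using rn by (simp add: field_simps)
  qed
  finally have "real m * real (card {T \<in> F. V \<subseteq> T}) \<le> real m * (777/1000 * M')" by simp
  then have "real (card {T \<in> F. V \<subseteq> T}) \<le> 777/1000 * M'" using m1 by simp
  also have "\<dots> \<le> 777/1000 * (2 / n * tree_bound n t)"
    unfolding M'_def using tree_bound_step[of n t] by (intro mult_left_mono) auto
  also have "\<dots> \<le> (156/100) / n * tree_bound n t"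
  proof -
    have "777/1000 * (2 / real n) \<le> (156/100) / real n" using n by (simp add: field_simps)
    from mult_right_mono[OF this tree_bound_nonneg[of n t]] show ?thesis by (simp only: mult.assoc)
  qed
  finally show ?thesis by (simp add: V_def)
qed

text \<open>Outside the exact case, all but at most two \<open>f\<close> have degree at most
  \<open>(156/100) / n\<close>. Two adjacent edges of \<open>D\<close> survive in
  \<open>D - {f}\<close> unless \<open>f\<close> is one of them; and a member meeting
  \<open>D\<close> in at most \<open>t\<close> edges meets \<open>D - {f}\<close> in
  \<open>t\<close> edges only if \<open>f\<close> is one of two edges of \<open>D\<close> outside
  it. Since \<open>2 * t < n\<close>, these degrees add up to about 78/100.\<close>

lemma family_near_half:
  assumes n: "n \<ge> 1000" and t: "49 * n < 100 * t" "2 * t < n" and F: "F \<subseteq> spanning_trees n" "intersecting t F"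
    and D: "D \<subseteq> complete_graph_edges n" "card D = t + 2" and F0: "F0 \<subseteq> D" "card F0 = t"
    and rest: "real (card {T \<in> F. \<not> (\<exists>f\<in>F0. D - {f} \<subseteq> T)}) \<le> 3/1000 * tree_bound n t"
  shows "real (card F) < tree_bound n t"
proof (cases "disjoint_edges D \<and> (\<forall>T\<in>F. t + 1 \<le> card (T \<inter> D))")
  case True
  then show ?thesis using n t by (intro all_but_one_of_matching[OF _ _ F(1) D]) auto
next
  case False
  have n2: "n \<ge> 2" using n by simp
  define M where "M = tree_bound n t"
  have Mpos: "M > 0" unfolding M_def by (rule tree_bound_pos) (use t in simp)
  have finF: "finite F" by (rule finite_subset[OF F(1)]) simp
  have finD: "finite D" by (rule finite_edges[OF D(1)])
  have finF0: "finite F0" using F0(1) finD finite_subset by blast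
  define B where "B f = {T \<in> F. D - {f} \<subseteq> T}" for f
  have cB: "real (card (B f)) \<le> real (card (trees_above n (D - {f})))" for f
    using card_mono[OF finite_trees_above, of "B f" n "D - {f}"] F(1) by (auto simp: B_def trees_above_def)
  have cDf: "card (D - {f}) = Suc t" if "f \<in> D" for f using that finD D(2) by simp
  have B2: "real (card (B f)) \<le> 2 / n * M" if "f \<in> D" for f
    using cB[of f] card_trees_above_le[OF n2, of "D - {f}"] tree_bound_step[of n t] cDf[OF that] by (simp add: M_def)
  have "\<exists>Z. card Z \<le> 2 \<and> finite Z \<and> (\<forall>f\<in>F0 - Z. real (card (B f)) \<le> (156/100) / n * M)"
  proof (cases "disjoint_edges D")
    case False
    then obtain g g' where g: "g \<in> D" "g' \<in> D" "g \<noteq> g'" "g \<inter> g' \<noteq> {}" unfolding disjoint_edges_def by blast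
    have "real (card (B f)) \<le> (156/100) / n * M" if f: "f \<in> F0 - {g, g'}" for f
    proof -
      have "real (card (trees_above n (D - {f}))) \<le> (3/2) / n * tree_bound n t"
        using f g F0(1) by (intro trees_above_adjacent_edges[OF n2 cDf, of f g g']) auto
      also have "\<dots> \<le> (156/100) / n * M" unfolding M_def
        by (intro mult_right_mono tree_bound_nonneg divide_right_mono) auto
      finally show ?thesis using cB[of f] by linarith
    qed
    moreover have "card {g, g'} \<le> 2" using g(3) by simp
    ultimately show ?thesis by (intro exI[of _ "{g, g'}"]) simp
  next
    case True
    then obtain T' where T': "T' \<in> F" "card (T' \<inter> D) \<le> t" using False by force
    define Z where "Z = {f \<in> F0. t \<le> card (T' \<inter> (D - {f}))}"
    have "card Z \<le> 2"
    proof (cases "Z = {}")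
      case False
      then obtain f where "f \<in> Z" by blast
      then have "t \<le> card (T' \<inter> (D - {f}))" by (simp add: Z_def)
      also have "\<dots> \<le> card (T' \<inter> D)" by (rule card_mono) (use finD in auto)
      finally have c: "card (T' \<inter> D) = t" using T'(2) by simp
      have "Z \<subseteq> D - T'"
      proof
        fix f assume f: "f \<in> Z"
        have "f \<notin> T'"
        proof
          assume fT: "f \<in> T'"
          have fD: "f \<in> D" using f F0(1) by (auto simp: Z_def)
          have "T' \<inter> (D - {f}) = (T' \<inter> D) - {f}" by blast
          then have "card (T' \<inter> (D - {f})) < card (T' \<inter> D)"
            using fT fD finD by (simp only:) (rule card_Diff1_less, auto)
          then show False using f c by (simp add: Z_def)
        qed
        then show "f \<in> D - T'" using f F0(1) by (auto simp: Z_def)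
      qed
      then have "card Z \<le> card (D - T')" by (rule card_mono[rotated]) (use finD in simp)
      moreover have "card D = card (D \<inter> T') + card (D - T')" by (rule card_Int_Diff[OF finD])
      ultimately show ?thesis using c D(2) by (simp add: Int_commute)
    qed simp
    moreover have "real (card (B f)) \<le> (156/100) / n * M" if f: "f \<in> F0 - Z" for f
      unfolding B_def M_def
      by (rule near_half_degree[OF n t F D True T'(1)]) (use f F0(1) in \<open>auto simp: Z_def\<close>)
    ultimately show ?thesis using finF0 by (intro exI[of _ Z]) (simp add: Z_def)
  qed
  then obtain Z where Z: "card Z \<le> 2" "finite Z" "\<And>f. f \<in> F0 - Z \<Longrightarrow> real (card (B f)) \<le> (156/100) / n * M" by blast
  define R where "R = {T \<in> F. \<not> (\<exists>f\<in>F0. D - {f} \<subseteq> T)}"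
  have finB: "finite (B f)" for f using finF by (simp add: B_def)
  have "F \<subseteq> R \<union> (\<Union>f\<in>F0. B f)" by (auto simp: R_def B_def)
  then have "card F \<le> card (R \<union> (\<Union>f\<in>F0. B f))"
    by (rule card_mono[rotated]) (use finF finF0 finB in \<open>simp add: R_def\<close>)
  also have "\<dots> \<le> card R + card (\<Union>f\<in>F0. B f)" by (rule card_Un_le)
  also have "\<dots> \<le> card R + (\<Sum>f\<in>F0. card (B f))" using card_UN_le[OF finF0, of B] by simp
  finally have "real (card F) \<le> real (card R) + (\<Sum>f\<in>F0. real (card (B f)))" by (simp flip: of_nat_sum of_nat_add)
  also have "\<dots> \<le> 3/1000 * M + (\<Sum>f\<in>F0. (156/100) / n * M + (if f \<in> Z then 2 / n * M else 0))"
  proof (intro add_mono sum_mono)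
    show "real (card R) \<le> 3/1000 * M" using rest by (simp add: R_def M_def)
    fix f assume f: "f \<in> F0"
    have "(156/100) / n * M \<ge> 0" using Mpos by simp
    then show "real (card (B f)) \<le> (156/100) / n * M + (if f \<in> Z then 2 / n * M else 0)"
      using B2[of f] Z(3)[of f] f F0(1) by auto
  qed
  also have "\<dots> = 3/1000 * M + (t * ((156/100) / n * M) + card (F0 \<inter> Z) * (2 / n * M))"
    using finF0 F0(2) by (simp add: sum.distrib sum.If_cases Int_def)
  also have "\<dots> \<le> 3/1000 * M + (78/100 * M + 4/1000 * M)"
  proof (intro add_mono order_refl)
    have "real (2 * t) < real n" using t(2) by (simp only: of_nat_less_iff)
    then have "real t * ((156/100) / n) \<le> 78/100" using n by (simp add: field_simps)
    from mult_right_mono[OF this, of M] show "t * ((156/100) / n * M) \<le> 78/100 * M" using Mpos by (simp add: mult.assoc)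
    have "card (F0 \<inter> Z) \<le> 2" using card_mono[OF Z(2), of "F0 \<inter> Z"] Z(1) by simp
    then have "real (card (F0 \<inter> Z)) \<le> 2" by simp
    then have "real (card (F0 \<inter> Z)) * (2 / n) \<le> 2 * (2 / n)" by (rule mult_right_mono) simp
    also have "\<dots> \<le> 4/1000" using n by (simp add: field_simps)
    finally have "real (card (F0 \<inter> Z)) * (2 / n) \<le> 4/1000" .
    from mult_right_mono[OF this, of M] show "card (F0 \<inter> Z) * (2 / n * M) \<le> 4/1000 * M" using Mpos by (simp add: mult.assoc)
  qed
  also have "\<dots> < M" using Mpos by simp
  finally show ?thesis by (simp add: M_def)
qed

text \<open>Union bound over the sets \<open>J\<close>: for \<open>k \<ge> 2\<close> the factorial
  brings it down to 1/2, for \<open>k = 1\<close> the ratio from \<open>step_ratio\<close> gives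
  98/100. The range of \<open>t\<close> left open there is \<open>family_near_half\<close> with
  \<open>D = F0 \<union> K \<union> L\<close>.\<close>

lemma family_with_exchanges:
  assumes n: "n \<ge> 1000" and t: "t < n" and F: "F \<subseteq> spanning_trees n" "intersecting t F"
    and k: "0 < k" and sub: "F0 \<subseteq> complete_graph_edges n" "K \<subseteq> complete_graph_edges n" "L \<subseteq> complete_graph_edges n"
    and c: "card F0 = t" "card K = k" "card L = k" and dis: "F0 \<inter> K = {}" "F0 \<inter> L = {}" "K \<inter> L = {}"
    and rest: "real (card {T \<in> F. \<not> (\<exists>J\<subseteq>F0. card J = k \<and> (F0 - J) \<union> K \<union> L \<subseteq> T)}) \<le> 3/1000 * tree_bound n t"
  shows "real (card F) < tree_bound n t"
proof -
  have n2: "n \<ge> 2" using n by simp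
  define M where "M = tree_bound n"
  have Mpos: "M t > 0" unfolding M_def by (rule tree_bound_pos[OF t])
  have fin: "finite F0" "finite K" "finite L" using sub finite_edges by blast+
  obtain p where p: "p \<ge> 0" "\<And>s. t \<le> s \<Longrightarrow> M (Suc s) \<le> p * M s" "real t * p \<le> 1"
    "100 * t \<le> 49 * n \<or> n \<le> 2 * t \<Longrightarrow> real t * p \<le> 98/100"
    unfolding M_def using step_ratio[OF n2 t] by blast
  show ?thesis
  proof (cases "k = 1 \<and> \<not> (100 * t \<le> 49 * n \<or> n \<le> 2 * t)")
    case True
    obtain e1 e2 where e: "K = {e1}" "L = {e2}" using True c(2,3) by (metis card_1_singletonE)
    define D where "D = F0 \<union> K \<union> L"
    have cD: "card D = t + 2"
      using card_Un_disjoint[OF fin(1,2) dis(1)] card_Un_disjoint[of "F0 \<union> K" L] fin dis c True by (auto simp: D_def)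
    have "real (card {T \<in> F. \<not> (\<exists>f\<in>F0. D - {f} \<subseteq> T)}) \<le> 3/1000 * tree_bound n t"
    proof -
      have "{T \<in> F. \<not> (\<exists>f\<in>F0. D - {f} \<subseteq> T)} \<subseteq> {T \<in> F. \<not> (\<exists>J\<subseteq>F0. card J = k \<and> (F0 - J) \<union> K \<union> L \<subseteq> T)}"
      proof
        fix T assume T: "T \<in> {T \<in> F. \<not> (\<exists>f\<in>F0. D - {f} \<subseteq> T)}"
        have "\<not> (F0 - J) \<union> K \<union> L \<subseteq> T" if J: "J \<subseteq> F0" "card J = k" for J
        proof
          assume a: "(F0 - J) \<union> K \<union> L \<subseteq> T"
          obtain f where f: "J = {f}" using J(2) True by (metis card_1_singletonE)
          have "D - {f} \<subseteq> (F0 - J) \<union> K \<union> L" by (auto simp: D_def f)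
          then have "D - {f} \<subseteq> T" using a by (rule subset_trans)
          moreover have "f \<in> F0" using J(1) f by simp
          ultimately show False using T by blast
        qed
        then have "\<not> (\<exists>J\<subseteq>F0. card J = k \<and> (F0 - J) \<union> K \<union> L \<subseteq> T)" by blast
        moreover have "T \<in> F" using T by blast
        ultimately show "T \<in> {T \<in> F. \<not> (\<exists>J\<subseteq>F0. card J = k \<and> (F0 - J) \<union> K \<union> L \<subseteq> T)}"
          by (intro CollectI conjI)
      qed
      then have "card {T \<in> F. \<not> (\<exists>f\<in>F0. D - {f} \<subseteq> T)} \<le> card {T \<in> F. \<not> (\<exists>J\<subseteq>F0. card J = k \<and> (F0 - J) \<union> K \<union> L \<subseteq> T)}"
        by (rule card_mono[rotated]) (use finite_subset[OF F(1)] in simp)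
      then show ?thesis using rest by linarith
    qed
    then show ?thesis
      using True sub by (intro family_near_half[OF n _ _ F _ cD _ c(1)]) (auto simp: D_def)
  next
    case False
    define Js where "Js = {J. J \<subseteq> F0 \<and> card J = k}"
    define V where "V J = (F0 - J) \<union> K \<union> L" for J
    define R where "R = {T \<in> F. \<not> (\<exists>J\<subseteq>F0. card J = k \<and> (F0 - J) \<union> K \<union> L \<subseteq> T)}"
    have finJs: "finite Js" using fin(1) by (simp add: Js_def)
    have finR: "finite R" using finite_subset[OF F(1)] by (simp add: R_def)
    have cV: "card (V J) = t + k" if "J \<in> Js" for J
      using card_exchange[OF fin dis, of "(J, K, L)" k] that c by (simp add: V_def exchange_def exchanges_def Js_def)
    have "F \<subseteq> R \<union> (\<Union>J\<in>Js. trees_above n (V J))" using F(1) unfolding R_def Js_def V_def trees_above_def by blast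
    then have "card F \<le> card (R \<union> (\<Union>J\<in>Js. trees_above n (V J)))"
      by (rule card_mono[rotated]) (use finR finJs in simp)
    also have "\<dots> \<le> card R + card (\<Union>J\<in>Js. trees_above n (V J))" by (rule card_Un_le)
    also have "\<dots> \<le> card R + (\<Sum>J\<in>Js. card (trees_above n (V J)))"
      using card_UN_le[OF finJs, of "\<lambda>J. trees_above n (V J)"] by simp
    finally have FR: "real (card F) \<le> real (card R) + (\<Sum>J\<in>Js. real (card (trees_above n (V J))))"
      by (simp flip: of_nat_sum of_nat_add)
    have "(\<Sum>J\<in>Js. real (card (trees_above n (V J)))) \<le> card Js * M (t + k)"
      by (rule sum_bounded_above) (use card_trees_above_le[OF n2] cV in \<open>metis M_def\<close>)
    also have "\<dots> \<le> (real t ^ k / fact k) * (p ^ k * M t)"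
    proof (rule mult_mono)
      show "real (card Js) \<le> real t ^ k / fact k"
        unfolding Js_def using n_subsets[OF fin(1), of k] binomial_le_pow_div_fact[of t k] c(1) by simp
      show "M (t + k) \<le> p ^ k * M t" by (rule steps_pow[where M = M and t = t and p = p, OF p(1) p(2)])
      show "0 \<le> M (t + k)" unfolding M_def by (rule tree_bound_nonneg)
    qed simp
    also have "\<dots> = ((real t * p) ^ k / fact k) * M t" by (simp add: power_mult_distrib)
    also have "\<dots> \<le> 98/100 * M t"
    proof (rule mult_right_mono)
      have tp0: "real t * p \<ge> 0" using p(1) by simp
      show "(real t * p) ^ k / fact k \<le> 98/100"
      proof (cases "k = 1")
        case True
        then show ?thesis using p(4) False by simp
      next
        case k1: False
        have "(real t * p) ^ k \<le> 1" using p(3) tp0 by (intro power_le_one)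
        moreover have "(fact 2 :: real) \<le> fact k" using k k1 by (intro fact_mono) simp
        ultimately have "(real t * p) ^ k / fact k \<le> 1 / 2" by (intro frac_le) auto
        then show ?thesis by linarith
      qed
      show "0 \<le> M t" using Mpos by (rule less_imp_le)
    qed
    finally have "(\<Sum>J\<in>Js. real (card (trees_above n (V J)))) \<le> 98/100 * M t" .
    moreover have "real (card R) \<le> 3/1000 * M t" using rest unfolding R_def M_def .
    ultimately have "real (card F) < M t" using FR Mpos by linarith
    then show ?thesis unfolding M_def .
  qed
qed

section \<open>The extremal families\<close>

lemma card_trees_above_balanced:
  assumes "n \<ge> 2" "balanced_forest n t F0"
  shows "real (card (trees_above n F0)) = tree_bound n t"
proof -
  have F0: "forest_on n F0" "card F0 = t" using assms(2) by (simp_all add: balanced_forest_def)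
  have "comp_prod n F0 = max_prod n t" using comp_prod_eq_iff[of n F0] F0 assms by simp
  moreover have "t < n" using forest_card_less[OF _ F0(1)] F0(2) assms(1) by simp
  ultimately show ?thesis using card_trees_above_eq[OF assms(1) F0(1)] F0(2) by (simp add: tree_bound_def)
qed

lemma balanced_of_card_trees_above:
  assumes n: "n \<ge> 2" and t: "t < n" and c: "card F0 = t" and eq: "real (card (trees_above n F0)) = tree_bound n t"
  shows "balanced_forest n t F0"
proof -
  have f: "forest_on n F0"
  proof (rule ccontr)
    assume "\<not> ?thesis"
    then have "real (card (trees_above n F0)) = 0" using trees_above_nonforest by simp
    then show False using eq tree_bound_pos[OF t] by simp
  qed
  have "real (comp_prod n F0) = real (max_prod n t)"
    using eq card_trees_above_eq[OF n f] c t n by (simp add: tree_bound_def)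
  then show ?thesis using comp_prod_eq_iff[of n F0] f c n by simp
qed

theorem theorem1:
  shows "\<exists>n0 :: nat. \<forall>n \<ge> n0. \<forall>t :: nat. 2 \<le> t \<longrightarrow> t \<le> n - 2 \<longrightarrow>
    (\<forall>\<F> :: nat set set set. \<F> \<subseteq> spanning_trees n \<longrightarrow> t_intersecting t \<F> \<longrightarrow>
       card \<F> \<le> max_prod n t * n ^ (n - 2 - t) \<and>
       (card \<F> = max_prod n t * n ^ (n - 2 - t) \<longleftrightarrow>
          (\<exists>F. balanced_forest n t F \<and> \<F> = {T \<in> spanning_trees n. F \<subseteq> T})))"
proof -
  obtain n1 where n1: "\<forall>n\<ge>n1. \<forall>(E :: nat set set) \<T> M t F. edge_family E \<T> M n \<longrightarrow> F \<subseteq> \<T> \<longrightarrow> intersecting t F \<longrightarrow>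
     t \<le> n \<longrightarrow> M t > 0 \<longrightarrow>
     real (card F) \<le> 51/100 * M t \<or>
     (\<exists>F0\<subseteq>E. card F0 = t \<and> real (card {T \<in> F. \<not> F0 \<subseteq> T}) \<le> 1/2 * exp (- 2 * real (n div 1024)) * M t) \<or>
     (\<exists>F0 K L k. 0 < k \<and> F0 \<subseteq> E \<and> K \<subseteq> E \<and> L \<subseteq> E \<and> card F0 = t \<and> card K = k \<and> card L = k \<and>
       F0 \<inter> K = {} \<and> F0 \<inter> L = {} \<and> K \<inter> L = {} \<and>
       real (card {T \<in> F. \<not> (\<exists>J\<subseteq>F0. card J = k \<and> (F0 - J) \<union> K \<union> L \<subseteq> T)}) \<le> 3/1000 * M t)"
    by (rule exE[OF intersecting_structure])
  obtain n2 where n2: "\<forall>n\<ge>n2. 9 * real n ^ 4 * (1/2 * exp (- 2 * real (n div 1024))) < 1"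
    by (rule exE[OF exp_beats_quartic])
  show ?thesis
  proof (intro exI[of _ "n1 + n2 + 1000"] allI impI)
    fix n t :: nat and \<F> :: "nat set set set"
    assume n: "n1 + n2 + 1000 \<le> n" and t: "2 \<le> t" "t \<le> n - 2"
      and F: "\<F> \<subseteq> spanning_trees n" and ti: "t_intersecting t \<F>"
    have I: "intersecting t \<F>" using ti unfolding t_intersecting_def intersecting_def .
    have nn: "n1 \<le> n" "n2 \<le> n" "1000 \<le> n" "2 \<le> n" "3 \<le> n" using n by linarith+
    have tn: "t < n" "t \<le> n" using t(2) nn(3) by linarith+
    define B where "B = max_prod n t * n ^ (n - 2 - t)"
    have MB: "tree_bound n t = real B" unfolding B_def by (rule tree_bound_nat[OF nn(4) t(2)])
    have Mpos: "tree_bound n t > 0" by (rule tree_bound_pos[OF tn(1)])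
    \<comment> \<open>Equality can only come from a centre contained in all members; every other
      alternative is strictly below the bound.\<close>
    have "real (card \<F>) < tree_bound n t \<or> (\<exists>F0. card F0 = t \<and> \<F> \<subseteq> trees_above n F0)"
      using n1[rule_format, OF nn(1) edge_family_trees[OF nn(4)] F I tn(2) Mpos]
    proof (elim disjE exE conjE)
      assume "real (card \<F>) \<le> 51/100 * tree_bound n t"
      then have "real (card \<F>) < tree_bound n t" using Mpos by linarith
      then show ?thesis by blast
    next
      fix F0 assume "card F0 = t"
        "real (card {T \<in> \<F>. \<not> F0 \<subseteq> T}) \<le> 1/2 * exp (- 2 * real (n div 1024)) * tree_bound n t"
      then show ?thesis using family_with_center[OF nn(5) t(1) tn(1) F I _ _ n2[rule_format, OF nn(2)]] by blast
    next
      fix F0 K L k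
      assume "0 < k" "F0 \<subseteq> complete_graph_edges n" "K \<subseteq> complete_graph_edges n" "L \<subseteq> complete_graph_edges n"
        "card F0 = t" "card K = k" "card L = k" "F0 \<inter> K = {}" "F0 \<inter> L = {}" "K \<inter> L = {}"
        "real (card {T \<in> \<F>. \<not> (\<exists>J\<subseteq>F0. card J = k \<and> (F0 - J) \<union> K \<union> L \<subseteq> T)}) \<le> 3/1000 * tree_bound n t"
      then have "real (card \<F>) < tree_bound n t" by (rule family_with_exchanges[OF nn(3) tn(1) F I])
      then show ?thesis by blast
    qed
    then have "card \<F> \<le> B \<and> (card \<F> = B \<longleftrightarrow> (\<exists>F. balanced_forest n t F \<and> \<F> = trees_above n F))"
    proof
      assume "real (card \<F>) < tree_bound n t"
      then have lt: "card \<F> < B" unfolding MB by simp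
      have "\<F> \<noteq> trees_above n F0" if "balanced_forest n t F0" for F0
        using card_trees_above_balanced[OF nn(4) that] lt unfolding MB by auto
      then show ?thesis using lt by auto
    next
      assume "\<exists>F0. card F0 = t \<and> \<F> \<subseteq> trees_above n F0"
      then obtain F0 where F0: "card F0 = t" "\<F> \<subseteq> trees_above n F0" by blast
      have le1: "card \<F> \<le> card (trees_above n F0)" by (rule card_mono[OF finite_trees_above F0(2)])
      have le2: "card (trees_above n F0) \<le> B" using card_trees_above_le[OF nn(4), of F0] F0(1) MB by simp
      show ?thesis
      proof (intro conjI iffI)
        show "card \<F> \<le> B" using le1 le2 by simp
        assume eq: "card \<F> = B"
        then have "\<F> = trees_above n F0" using le1 le2 by (intro card_seteq[OF finite_trees_above F0(2)]) simp
        moreover have "balanced_forest n t F0"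
          by (rule balanced_of_card_trees_above[OF nn(4) tn(1) F0(1)]) (use eq le1 le2 MB in simp)
        ultimately show "\<exists>F. balanced_forest n t F \<and> \<F> = trees_above n F" by blast
      next
        assume "\<exists>F. balanced_forest n t F \<and> \<F> = trees_above n F"
        then obtain G where "balanced_forest n t G" "\<F> = trees_above n G" by blast
        then show "card \<F> = B" using card_trees_above_balanced[OF nn(4), of t G] MB by simp
      qed
    qed
    then show "card \<F> \<le> max_prod n t * n ^ (n - 2 - t) \<and>
       (card \<F> = max_prod n t * n ^ (n - 2 - t) \<longleftrightarrow>
          (\<exists>F. balanced_forest n t F \<and> \<F> = {T \<in> spanning_trees n. F \<subseteq> T}))"
      unfolding B_def trees_above_def .
  qed
qed

end
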